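(* Let $X$ and $Y$ be metric spaces with bounded geometry. Assume that either $X$ or $Y$ contains no sparse subspaces consisting of ghostly measured asymptotic expanders. Then the following are equivalent: (1) $X$ is coarsely equivalent to $Y$; (2) the uniform Roe algebras $C^*_u(X)$ and $C^*_u(Y)$ are stably $*$-isomorphic; (3) the Roe algebras $C^*(X)$ and $C^*(Y)$ are $*$-isomorphic.
   Context: All metric spaces are non-empty and discrete. $B(x,R)$ is the closed ball. $(X,d)$ has bounded geometry if $\sup_{x\in X}|B(x,R)|<\infty$ for each $R>0$. Coarse equivalence: a map $f:X\to Y$ is a coarse embedding if there are non-decreasing unbounded $\rho_\pm:[0,\infty)\to[0,\infty)$ with $\rho_-(d_X(x,y))\le d_Y(f(x),f(y))\le\rho_+(d_X(x,y))$ for all $x,y\in X$; $X$ and $Y$ are coarsely equivalent if there is a coarse embedding $f:X\to Y$ such that, for some $C>0$, every point of $Y$ is within distance $C$ of $f(X)$. Sparse: a metric space $(X,d)$ is sparse if there is a partition $X=\bigsqcup_{n\in\mathbb N}X_n$ with $0<|X_n|<\infty$ for all $n$ and $d(X_n,X_m)\to\infty$ as $n+m\to\infty$, $n\ne m$. Measured asymptotic expanders: a sequence of finite probability-measured metric spaces $\{(X_n,d_n,m_n)\}_{n\in\mathbb N}$ is a sequence of measured asymptotic expanders if for every $\alpha\in(0,\frac12]$ there exist $c_\alpha\in(0,1)$ and $R_\alpha>0$ such that for every $n$ and every $A\subseteq X_n$ with $\alpha\le m_n(A)\le\frac12$ one has $m_n(\partial_{R_\alpha}A)>c_\alpha m_n(A)$,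 where $\partial_RA=\{x\in X_n\setminus A: d_n(x,A)\le R\}$. A sparse space $X$ consists of ghostly measured asymptotic expanders if there exist a decomposition $X=\bigsqcup_nX_n$ as in the definition of sparse and probability measures $m_n$ on $X_n$ with $\lim_{n}\sup_{x\in X_n}m_n(x)=0$ such that $\{(X_n,d|_{X_n},m_n)\}_n$ is a sequence of measured asymptotic expanders. Roe algebras: for a Hilbert space $H_0$, write $T\in\mathfrak B(\ell^2(X;H_0))$ as a matrix $(T_{x,y})_{x,y\in X}$ with entries in $\mathfrak B(H_0)$. $T$ has finite propagation if $\sup\{d(x,y):T_{x,y}\neq0\}<\infty$, and is locally compact if all $T_{x,y}$ are compact. $C^*_u(X)$ is the norm closure of the finite propagation operators in $\mathfrak B(\ell^2(X))$. $C^*(X)$ is the norm closure of the finite propagation locally compact operators in $\mathfrak B(\ell^2(X;H_0))$, with $H_0$ a fixed infinite-dimensional separable Hilbert space. $C^*$-algebras $A,B$ are stably $*$-isomorphic if $A\otimes\mathfrak K\cong B\otimes\mathfrak K$, with $\mathfrak K$ the compact operators on a separable infinite-dimensional Hilbert space. *)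

theory Defs
  imports "HOL-Analysis.Analysis" "HOL-Probability.Probability_Mass_Function"
begin

section \<open>Complex Hilbert spaces\<close>

class scaleC =
  fixes scaleC :: "complex \<Rightarrow> 'a \<Rightarrow> 'a" (infixr "*\<^sub>C" 75)

class complex_vector = real_vector + scaleC +
  assumes scaleC_add_right: "c *\<^sub>C (x + y) = c *\<^sub>C x + c *\<^sub>C y"
    and scaleC_add_left: "(c + d) *\<^sub>C x = c *\<^sub>C x + d *\<^sub>C x"
    and scaleC_scaleC: "c *\<^sub>C d *\<^sub>C x = (c * d) *\<^sub>C x"
    and scaleC_of_real: "complex_of_real r *\<^sub>C x = r *\<^sub>R x"

global_interpretation complex_vector:
  vector_space "scaleC :: complex \<Rightarrow> 'a \<Rightarrow> 'a :: complex_vector"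
proof
  show "1 *\<^sub>C x = x" for x :: 'a
    using scaleC_of_real[of 1 x] by simp
qed (auto intro: scaleC_add_right scaleC_add_left scaleC_scaleC)

abbreviation cspan :: "'a::complex_vector set \<Rightarrow> 'a set" where
  "cspan \<equiv> module.span scaleC"

class complex_inner_space = complex_vector + real_normed_vector +
  fixes cinner :: "'a \<Rightarrow> 'a \<Rightarrow> complex"
  assumes cinner_commute: "cinner x y = cnj (cinner y x)"
    and cinner_add_left: "cinner (x + y) z = cinner x z + cinner y z"
    and cinner_scaleC_left: "cinner (c *\<^sub>C x) y = c * cinner x y"
    and cinner_self: "cinner x x = complex_of_real ((norm x)\<^sup>2)"

class complex_hilbert_space = complex_inner_space + complete_space

lemma cinner_add_right: "cinner x (y + z) = cinner x y + cinner x z"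
  by (metis cinner_add_left cinner_commute complex_cnj_add)

lemma cinner_scaleC_right: "cinner x (c *\<^sub>C y) = cnj c * cinner x y"
  by (metis cinner_commute cinner_scaleC_left complex_cnj_mult)

lemma scaleC_minus1: "(-1) *\<^sub>C x = - (x :: 'a :: complex_vector)"
  using scaleC_of_real[of "-1" x] by simp

lemma cinner_minus_left: "cinner (- x) y = - cinner x y"
  by (metis cinner_scaleC_left mult_minus1 scaleC_minus1)

lemma cinner_minus_right: "cinner x (- y) = - cinner x y"
  by (metis cinner_commute cinner_minus_left complex_cnj_minus)

lemma cinner_diff_left: "cinner (x - y) z = cinner x z - cinner y z"
  using cinner_add_left[of x "- y" z] by (simp add: cinner_minus_left)

lemma cinner_diff_right: "cinner x (y - z) = cinner x y - cinner x z"
  using cinner_add_right[of x y "- z"] by (simp add: cinner_minus_right)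

lemma cinner_zero_left [simp]: "cinner 0 x = 0"
  using cinner_diff_left[of 0 0 x] by simp

lemma cinner_zero_right [simp]: "cinner x 0 = 0"
  using cinner_diff_right[of x 0 0] by simp

lemma norm_scaleC: "norm (c *\<^sub>C x) = cmod c * norm (x :: 'a :: complex_inner_space)"
proof -
  have "complex_of_real ((norm (c *\<^sub>C x))\<^sup>2) = complex_of_real ((cmod c * norm x)\<^sup>2)"
    unfolding cinner_self[symmetric] cinner_scaleC_left cinner_scaleC_right
    by (simp add: cinner_self power_mult_distrib complex_norm_square mult.assoc[symmetric]
             del: of_real_power)
  then have "(norm (c *\<^sub>C x))\<^sup>2 = (cmod c * norm x)\<^sup>2"
    by (simp only: of_real_eq_iff)
  then show ?thesis
    by (rule power2_eq_imp_eq) auto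
qed

lemma cinner_cauchy_schwarz: "cmod (cinner x y) \<le> norm x * norm y"
proof (cases "y = 0")
  case False
  define c where "c = cinner x y"
  define a where "a = (norm y)\<^sup>2"
  have a: "a > 0"
    using False by (simp add: a_def)
  define z where "z = complex_of_real a *\<^sub>C x - c *\<^sub>C y"
  have yx: "cinner y x = cnj c"
    unfolding c_def by (rule cinner_commute)
  have "cinner z z = complex_of_real (a\<^sup>2 * (norm x)\<^sup>2 - a * (cmod c)\<^sup>2)"
    unfolding z_def cinner_diff_left cinner_diff_right cinner_scaleC_left cinner_scaleC_right
    by (simp add: cinner_self yx c_def[symmetric] a_def[symmetric] algebra_simps power2_eq_square
        flip: complex_norm_square of_real_power)
      (simp add: a_def complex_norm_square power2_eq_square algebra_simps)
  then have "a\<^sup>2 * (norm x)\<^sup>2 - a * (cmod c)\<^sup>2 = (norm z)\<^sup>2"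
    by (metis cinner_self of_real_eq_iff)
  then have "a * (cmod c)\<^sup>2 \<le> a * (a * (norm x)\<^sup>2)"
    by (smt (verit) mult.assoc power2_eq_square zero_le_power2)
  then have "(cmod c)\<^sup>2 \<le> a * (norm x)\<^sup>2"
    using a by simp
  then have "(cmod c)\<^sup>2 \<le> (norm x * norm y)\<^sup>2"
    by (simp add: a_def power_mult_distrib mult.commute)
  then show ?thesis
    unfolding c_def by (rule power2_le_imp_le) simp
qed simp

instantiation complex :: complex_hilbert_space
begin
definition scaleC_complex :: "complex \<Rightarrow> complex \<Rightarrow> complex" where
  "scaleC_complex c x = c * x"
definition cinner_complex :: "complex \<Rightarrow> complex \<Rightarrow> complex" where
  "cinner_complex x y = x * cnj y"
instance
proof
  fix x y z c d :: complex and r :: real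
  show "c *\<^sub>C (x + y) = c *\<^sub>C x + c *\<^sub>C y" "(c + d) *\<^sub>C x = c *\<^sub>C x + d *\<^sub>C x"
    "c *\<^sub>C d *\<^sub>C x = (c * d) *\<^sub>C x" "cinner (c *\<^sub>C x) y = c * cinner x y"
    "cinner (x + y) z = cinner x z + cinner y z"
    by (simp_all add: scaleC_complex_def cinner_complex_def distrib_left distrib_right mult.assoc)
  show "complex_of_real r *\<^sub>C x = r *\<^sub>R x"
    by (simp add: scaleC_complex_def scaleR_conv_of_real)
  show "cinner x y = cnj (cinner y x)"
    by (simp add: cinner_complex_def mult.commute)
  show "cinner x x = complex_of_real ((norm x)\<^sup>2)"
    unfolding cinner_complex_def by (rule complex_norm_square[symmetric])
qed
end


section \<open>The Hilbert space of square-summable functions\<close>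

typedef (overloaded) ('x, 'h::real_normed_vector) ell2 =
  "{f :: 'x \<Rightarrow> 'h. (\<lambda>x. (norm (f x))\<^sup>2) summable_on UNIV}"
  morphisms coord Abs_ell2
  by (rule exI[of _ "\<lambda>_. 0"]) simp

setup_lifting type_definition_ell2

lemma ell2_bound:
  fixes f :: "'x \<Rightarrow> 'h::real_normed_vector"
  assumes "\<And>F. finite F \<Longrightarrow> L2_set (\<lambda>x. norm (f x)) F \<le> B" and "B \<ge> 0"
  shows "(\<lambda>x. (norm (f x))\<^sup>2) summable_on UNIV"
    and "sqrt (\<Sum>\<^sub>\<infinity>x. (norm (f x))\<^sup>2) \<le> B"
proof -
  have *: "(\<Sum>x\<in>F. (norm (f x))\<^sup>2) \<le> B\<^sup>2" if "finite F" for F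
    using assms(1)[OF that] by (simp add: L2_set_def sqrt_le_D)
  show s: "(\<lambda>x. (norm (f x))\<^sup>2) summable_on UNIV"
    by (rule nonneg_bdd_above_summable_on) (auto intro!: bdd_aboveI2[of _ _ "B\<^sup>2"] *)
  have "(\<Sum>\<^sub>\<infinity>x. (norm (f x))\<^sup>2) \<le> B\<^sup>2"
    using s by (rule infsum_le_finite_sums) (auto intro: *)
  then show "sqrt (\<Sum>\<^sub>\<infinity>x. (norm (f x))\<^sup>2) \<le> B"
    using assms(2) by (simp add: real_le_lsqrt infsum_nonneg)
qed

lemma ell2_finite_le:
  fixes f :: "'x \<Rightarrow> 'h::real_normed_vector"
  assumes "(\<lambda>x. (norm (f x))\<^sup>2) summable_on UNIV" "finite F"
  shows "L2_set (\<lambda>x. norm (f x)) F \<le> sqrt (\<Sum>\<^sub>\<infinity>x. (norm (f x))\<^sup>2)"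
  unfolding L2_set_def using assms by (intro real_sqrt_le_mono finite_sum_le_infsum) auto

lemma ell2_add:
  fixes f g :: "'x \<Rightarrow> 'h::real_normed_vector"
  assumes "(\<lambda>x. (norm (f x))\<^sup>2) summable_on UNIV" "(\<lambda>x. (norm (g x))\<^sup>2) summable_on UNIV"
  shows "(\<lambda>x. (norm (f x + g x))\<^sup>2) summable_on UNIV"
    and "sqrt (\<Sum>\<^sub>\<infinity>x. (norm (f x + g x))\<^sup>2)
      \<le> sqrt (\<Sum>\<^sub>\<infinity>x. (norm (f x))\<^sup>2) + sqrt (\<Sum>\<^sub>\<infinity>x. (norm (g x))\<^sup>2)"
proof -
  have *: "L2_set (\<lambda>x. norm (f x + g x)) F
      \<le> sqrt (\<Sum>\<^sub>\<infinity>x. (norm (f x))\<^sup>2) + sqrt (\<Sum>\<^sub>\<infinity>x. (norm (g x))\<^sup>2)"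
    if "finite F" for F
  proof -
    have "L2_set (\<lambda>x. norm (f x + g x)) F \<le> L2_set (\<lambda>x. norm (f x) + norm (g x)) F"
      by (intro L2_set_mono norm_triangle_ineq norm_ge_zero)
    also have "\<dots> \<le> L2_set (\<lambda>x. norm (f x)) F + L2_set (\<lambda>x. norm (g x)) F"
      by (rule L2_set_triangle_ineq)
    finally show ?thesis
      using ell2_finite_le[OF assms(1) that] ell2_finite_le[OF assms(2) that] by linarith
  qed
  have nn: "0 \<le> sqrt (\<Sum>\<^sub>\<infinity>x. (norm (f x))\<^sup>2) + sqrt (\<Sum>\<^sub>\<infinity>x. (norm (g x))\<^sup>2)"
    by (simp add: infsum_nonneg)
  show "(\<lambda>x. (norm (f x + g x))\<^sup>2) summable_on UNIV"
    by (rule ell2_bound(1)[OF * nn])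
  show "sqrt (\<Sum>\<^sub>\<infinity>x. (norm (f x + g x))\<^sup>2)
      \<le> sqrt (\<Sum>\<^sub>\<infinity>x. (norm (f x))\<^sup>2) + sqrt (\<Sum>\<^sub>\<infinity>x. (norm (g x))\<^sup>2)"
    by (rule ell2_bound(2)[OF * nn])
qed

instantiation ell2 :: (type, real_normed_vector) real_normed_vector
begin

lift_definition zero_ell2 :: "('a, 'b) ell2" is "\<lambda>_. 0" by simp
lift_definition uminus_ell2 :: "('a, 'b) ell2 \<Rightarrow> ('a, 'b) ell2" is "\<lambda>f x. - f x" by simp
lift_definition plus_ell2 :: "('a, 'b) ell2 \<Rightarrow> ('a, 'b) ell2 \<Rightarrow> ('a, 'b) ell2"
  is "\<lambda>f g x. f x + g x" by (rule ell2_add)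
lift_definition minus_ell2 :: "('a, 'b) ell2 \<Rightarrow> ('a, 'b) ell2 \<Rightarrow> ('a, 'b) ell2"
  is "\<lambda>f g x. f x - g x"
  using ell2_add(1)[where g = "\<lambda>x. - _ x"] by simp
lift_definition scaleR_ell2 :: "real \<Rightarrow> ('a, 'b) ell2 \<Rightarrow> ('a, 'b) ell2"
  is "\<lambda>r f x. r *\<^sub>R f x"
  by (simp add: power_mult_distrib summable_on_cmult_right)
lift_definition norm_ell2 :: "('a, 'b) ell2 \<Rightarrow> real"
  is "\<lambda>f. sqrt (\<Sum>\<^sub>\<infinity>x. (norm (f x))\<^sup>2)" .

definition sgn_ell2 :: "('a, 'b) ell2 \<Rightarrow> ('a, 'b) ell2" where
  "sgn_ell2 f = scaleR (inverse (norm f)) f"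
definition dist_ell2 :: "('a, 'b) ell2 \<Rightarrow> ('a, 'b) ell2 \<Rightarrow> real" where
  "dist_ell2 f g = norm (f - g)"
definition uniformity_ell2 :: "(('a, 'b) ell2 \<times> ('a, 'b) ell2) filter" where
  "uniformity_ell2 = (INF e\<in>{0<..}. principal {(f, g). dist f g < e})"
definition open_ell2 :: "('a, 'b) ell2 set \<Rightarrow> bool" where
  "open_ell2 U \<longleftrightarrow> (\<forall>f\<in>U. \<forall>\<^sub>F (f', g) in uniformity. f' = f \<longrightarrow> g \<in> U)"

instance
proof
  fix f g h :: "('a, 'b) ell2" and r s :: real
  show "dist f g = norm (f - g)" by (rule dist_ell2_def)
  show "sgn f = scaleR (inverse (norm f)) f" by (rule sgn_ell2_def)
  show "f + g + h = f + (g + h)" by transfer (simp add: add.assoc)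
  show "f + g = g + f" by transfer (simp add: add.commute)
  show "0 + f = f" by transfer simp
  show "- f + f = 0" by transfer simp
  show "f - g = f + - g" by transfer simp
  show "r *\<^sub>R (f + g) = r *\<^sub>R f + r *\<^sub>R g" by transfer (simp add: scaleR_add_right)
  show "(r + s) *\<^sub>R f = r *\<^sub>R f + s *\<^sub>R f" by transfer (simp add: scaleR_add_left)
  show "r *\<^sub>R s *\<^sub>R f = (r * s) *\<^sub>R f" by transfer simp
  show "1 *\<^sub>R f = f" by transfer simp
  show "norm f = 0 \<longleftrightarrow> f = 0"
  proof transfer
    fix f :: "'a \<Rightarrow> 'b"
    assume s: "(\<lambda>x. (norm (f x))\<^sup>2) summable_on UNIV"
    show "sqrt (\<Sum>\<^sub>\<infinity>x. (norm (f x))\<^sup>2) = 0 \<longleftrightarrow> f = (\<lambda>_. 0)"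
    proof
      assume "sqrt (\<Sum>\<^sub>\<infinity>x. (norm (f x))\<^sup>2) = 0"
      then have "(\<Sum>\<^sub>\<infinity>x. (norm (f x))\<^sup>2) \<le> 0" by simp
      from nonneg_infsum_le_0D[OF this s] show "f = (\<lambda>_. 0)"
        by (intro ext) simp
    qed simp
  qed
  show "norm (f + g) \<le> norm f + norm g" by transfer (rule ell2_add)
  show "norm (r *\<^sub>R f) = \<bar>r\<bar> * norm f"
    by transfer (simp add: power_mult_distrib infsum_cmult_right' real_sqrt_mult)
  show "uniformity = (INF e\<in>{0<..}. principal {(f :: ('a, 'b) ell2, g). dist f g < e})"
    by (rule uniformity_ell2_def)
  show "open U \<longleftrightarrow> (\<forall>f\<in>U. \<forall>\<^sub>F (f', g) in uniformity. f' = f \<longrightarrow> g \<in> U)"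
    for U :: "('a, 'b) ell2 set"
    by (rule open_ell2_def)
qed

end

lemma coord_zero [simp]: "coord 0 x = 0" by transfer simp
lemma coord_add [simp]: "coord (f + g) x = coord f x + coord g x" by transfer simp
lemma coord_diff [simp]: "coord (f - g) x = coord f x - coord g x" by transfer simp
lemma coord_scaleR [simp]: "coord (r *\<^sub>R f) x = r *\<^sub>R coord f x" by transfer simp

lemma L2_set_coord_le: "finite F \<Longrightarrow> L2_set (\<lambda>x. norm (coord f x)) F \<le> norm f"
  by transfer (rule ell2_finite_le)

lemma norm_coord_le: "norm (coord f x) \<le> norm f"
  using L2_set_coord_le[of "{x}" f] by simp

instance ell2 :: (type, "{real_normed_vector, complete_space}") complete_space
proof
  fix X :: "nat \<Rightarrow> ('a, 'b) ell2"
  assume X: "Cauchy X"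
  have "Cauchy (\<lambda>n. coord (X n) x)" for x
  proof (rule metric_CauchyI)
    fix e :: real assume "e > 0"
    then obtain N where N: "\<forall>m\<ge>N. \<forall>n\<ge>N. dist (X m) (X n) < e"
      using X by (meson Cauchy_def)
    have "dist (coord (X m) x) (coord (X n) x) \<le> dist (X m) (X n)" for m n
      using norm_coord_le[of "X m - X n" x] by (simp add: dist_norm)
    then show "\<exists>N. \<forall>m\<ge>N. \<forall>n\<ge>N. dist (coord (X m) x) (coord (X n) x) < e"
      using N by (meson le_less_trans)
  qed
  then have "\<forall>x. \<exists>l. (\<lambda>n. coord (X n) x) \<longlonglongrightarrow> l"
    by (meson Cauchy_convergent_iff convergent_def)
  then obtain g where g: "\<And>x. (\<lambda>n. coord (X n) x) \<longlonglongrightarrow> g x"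
    by metis
  have key: "L2_set (\<lambda>x. norm (coord (X n) x - g x)) F \<le> e"
    if "\<forall>m\<ge>N. \<forall>n\<ge>N. dist (X m) (X n) < e" "n \<ge> N" "finite F" for N e n F
  proof (rule tendsto_upperbound)
    show "(\<lambda>m. L2_set (\<lambda>x. norm (coord (X n) x - coord (X m) x)) F)
        \<longlonglongrightarrow> L2_set (\<lambda>x. norm (coord (X n) x - g x)) F"
      unfolding L2_set_def by (intro tendsto_intros g)
    have "L2_set (\<lambda>x. norm (coord (X n) x - coord (X m) x)) F \<le> e" if "m \<ge> N" for m
    proof -
      have "L2_set (\<lambda>x. norm (coord (X n - X m) x)) F \<le> norm (X n - X m)"
        using \<open>finite F\<close> by (rule L2_set_coord_le)
      also have "\<dots> \<le> e"
        using \<open>m \<ge> N\<close> \<open>n \<ge> N\<close> \<open>\<forall>m\<ge>N. \<forall>n\<ge>N. dist (X m) (X n) < e\<close>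
        by (simp add: dist_norm less_imp_le)
      finally show ?thesis by simp
    qed
    then show "\<forall>\<^sub>F m in sequentially.
        L2_set (\<lambda>x. norm (coord (X n) x - coord (X m) x)) F \<le> e"
      by (auto simp: eventually_sequentially)
  qed simp
  obtain N1 where N1: "\<forall>m\<ge>N1. \<forall>n\<ge>N1. dist (X m) (X n) < 1"
    using X by (meson Cauchy_def zero_less_one)
  have "(\<lambda>x. (norm (coord (X N1) x - g x))\<^sup>2) summable_on UNIV"
    using key[OF N1] by (intro ell2_bound(1)[of _ 1]) auto
  then have "(\<lambda>x. (norm (g x - coord (X N1) x))\<^sup>2) summable_on UNIV"
    by (simp add: norm_minus_commute)
  moreover have "(\<lambda>x. (norm (coord (X N1) x))\<^sup>2) summable_on UNIV"
    using coord[of "X N1"] by simp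
  ultimately have sg: "(\<lambda>x. (norm (g x))\<^sup>2) summable_on UNIV"
    using ell2_add(1) by fastforce
  define G where "G = Abs_ell2 g"
  have G: "coord G x = g x" for x
    unfolding G_def using sg by (simp add: Abs_ell2_inverse)
  have "X \<longlonglongrightarrow> G"
  proof (rule metric_LIMSEQ_I)
    fix e :: real assume "e > 0"
    then obtain N where N: "\<forall>m\<ge>N. \<forall>n\<ge>N. dist (X m) (X n) < e / 2"
      using X by (meson Cauchy_def half_gt_zero)
    have "dist (X n) G < e" if "n \<ge> N" for n
    proof -
      have "norm (X n - G) = sqrt (\<Sum>\<^sub>\<infinity>x. (norm (coord (X n - G) x))\<^sup>2)"
        by transfer simp
      also have "\<dots> \<le> e / 2"
        using key[OF N that] \<open>e > 0\<close> by (intro ell2_bound(2)) (auto simp: G)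
      finally show ?thesis
        using \<open>e > 0\<close> by (simp add: dist_norm)
    qed
    then show "\<exists>N. \<forall>n\<ge>N. dist (X n) G < e" by blast
  qed
  then show "convergent X" by (auto simp: convergent_def)
qed

lemma cinner_ell2_summable:
  fixes f g :: "'x \<Rightarrow> 'h::complex_inner_space"
  assumes "(\<lambda>x. (norm (f x))\<^sup>2) summable_on UNIV" "(\<lambda>x. (norm (g x))\<^sup>2) summable_on UNIV"
  shows "(\<lambda>x. cinner (f x) (g x)) summable_on UNIV"
proof (rule Infinite_Sum.abs_summable_summable,
    rule Infinite_Sum.abs_summable_on_comparison_test'[OF summable_on_add[OF assms]])
  fix x
  have "0 \<le> (norm (f x) - norm (g x))\<^sup>2" "0 \<le> norm (f x) * norm (g x)" by simp_all
  then show "cmod (cinner (f x) (g x)) \<le> (norm (f x))\<^sup>2 + (norm (g x))\<^sup>2"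
    using cinner_cauchy_schwarz[of "f x" "g x"] unfolding power2_diff by linarith
qed

instantiation ell2 :: (type, complex_inner_space) complex_inner_space
begin

lift_definition scaleC_ell2 :: "complex \<Rightarrow> ('a, 'b) ell2 \<Rightarrow> ('a, 'b) ell2"
  is "\<lambda>c f x. c *\<^sub>C f x"
  by (simp add: norm_scaleC power_mult_distrib summable_on_cmult_right)

lift_definition cinner_ell2 :: "('a, 'b) ell2 \<Rightarrow> ('a, 'b) ell2 \<Rightarrow> complex"
  is "\<lambda>f g. \<Sum>\<^sub>\<infinity>x. cinner (f x) (g x)" .

instance
proof
  fix f g h :: "('a, 'b) ell2" and c d :: complex and r :: real
  show "c *\<^sub>C (f + g) = c *\<^sub>C f + c *\<^sub>C g" by transfer (simp add: scaleC_add_right)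
  show "(c + d) *\<^sub>C f = c *\<^sub>C f + d *\<^sub>C f" by transfer (simp add: scaleC_add_left)
  show "c *\<^sub>C d *\<^sub>C f = (c * d) *\<^sub>C f" by transfer (simp add: scaleC_scaleC)
  show "complex_of_real r *\<^sub>C f = r *\<^sub>R f" by transfer (simp add: scaleC_of_real)
  show "cinner f g = cnj (cinner g f)"
    by transfer (subst cinner_commute, rule infsum_cnj)
  show "cinner (f + g) h = cinner f h + cinner g h"
    by transfer (simp add: cinner_add_left infsum_add cinner_ell2_summable)
  show "cinner (c *\<^sub>C f) g = c * cinner f g"
    by transfer (simp add: cinner_scaleC_left infsum_cmult_right')
  show "cinner f f = complex_of_real ((norm f)\<^sup>2)"
  proof transfer
    fix f :: "'a \<Rightarrow> 'b"
    assume "(\<lambda>x. (norm (f x))\<^sup>2) summable_on UNIV"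
    then have "((\<lambda>x. complex_of_real ((norm (f x))\<^sup>2)) has_sum
        complex_of_real (\<Sum>\<^sub>\<infinity>x. (norm (f x))\<^sup>2)) UNIV"
      by (intro has_sum_of_real) simp
    then have "(\<Sum>\<^sub>\<infinity>x. cinner (f x) (f x))
        = complex_of_real (\<Sum>\<^sub>\<infinity>x. (norm (f x))\<^sup>2)"
      unfolding cinner_self by (rule infsumI)
    moreover have "(sqrt (\<Sum>\<^sub>\<infinity>x. (norm (f x))\<^sup>2))\<^sup>2 = (\<Sum>\<^sub>\<infinity>x. (norm (f x))\<^sup>2)"
      by (intro real_sqrt_pow2 infsum_nonneg) simp
    ultimately show "(\<Sum>\<^sub>\<infinity>x. cinner (f x) (f x))
        = complex_of_real ((sqrt (\<Sum>\<^sub>\<infinity>x. (norm (f x))\<^sup>2))\<^sup>2)"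
      by (simp only:)
  qed
qed

end

instance ell2 :: (type, complex_hilbert_space) complex_hilbert_space ..

lemma coord_scaleC [simp]: "coord (c *\<^sub>C f) x = c *\<^sub>C coord f x" by transfer simp

lift_definition single :: "'x \<Rightarrow> 'h::real_normed_vector \<Rightarrow> ('x, 'h) ell2"
  is "\<lambda>x v y. if y = x then v else 0"
proof -
  fix x :: 'x and v :: 'h
  have "(\<lambda>y. (norm (if y = x then v else 0))\<^sup>2) summable_on {x}" by simp
  then show "(\<lambda>y. (norm (if y = x then v else 0))\<^sup>2) summable_on UNIV"
    by (rule summable_on_cong_neutral[THEN iffD1, rotated -1]) auto
qed

lemma norm_single: "norm (single (x :: 'x) (v :: 'h::real_normed_vector)) = norm v"
proof transfer
  fix x :: 'x and v :: "'h::real_normed_vector"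
  have "(\<Sum>\<^sub>\<infinity>y. (norm (if y = x then v else 0))\<^sup>2) = (\<Sum>\<^sub>\<infinity>y\<in>{x}. (norm v)\<^sup>2)"
    by (rule infsum_cong_neutral) auto
  then show "sqrt (\<Sum>\<^sub>\<infinity>y. (norm (if y = x then v else 0))\<^sup>2) = norm v" by simp
qed

lemma bounded_linear_single: "bounded_linear (single x)"
proof (rule bounded_linear_intro[of _ 1])
  show "single x (v + w) = single x v + single x w" for v w :: 'a
    by transfer auto
  show "single x (r *\<^sub>R v) = r *\<^sub>R single x v" for r and v :: 'a
    by transfer auto
qed (simp add: norm_single)

lemma bounded_linear_coord: "bounded_linear (\<lambda>f. coord f x)"
  by (rule bounded_linear_intro[of _ 1]) (auto simp: norm_coord_le)

lift_definition ell2_tensor :: "('x, complex) ell2 \<Rightarrow> 'h::complex_inner_space \<Rightarrow> ('x, 'h) ell2"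
  is "\<lambda>f v x. f x *\<^sub>C v"
  by (simp add: norm_scaleC power_mult_distrib summable_on_cmult_left)


section \<open>Bounded operators\<close>

text \<open>
  The library type \<open>'a \<Rightarrow>\<^sub>L 'b\<close> consists of the real-linear bounded maps with the operator norm.
  The algebra of bounded operators on a complex Hilbert space is its norm-closed subset of
  complex-linear maps; on these the operator norm is the usual one.
\<close>

definition bounded_operators :: "('h::complex_inner_space \<Rightarrow>\<^sub>L 'h) set" where
  "bounded_operators = {T. \<forall>c u. blinfun_apply T (c *\<^sub>C u) = c *\<^sub>C blinfun_apply T u}"

instantiation blinfun :: (real_normed_vector, complex_inner_space) complex_vector
begin

lift_definition scaleC_blinfun :: "complex \<Rightarrow> ('a \<Rightarrow>\<^sub>L 'b) \<Rightarrow> ('a \<Rightarrow>\<^sub>L 'b)"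
  is "\<lambda>c T u. c *\<^sub>C T u"
proof -
  fix c :: complex and T :: "'a \<Rightarrow> 'b"
  assume T: "bounded_linear T"
  have "bounded_linear (\<lambda>v :: 'b. c *\<^sub>C v)"
  proof (rule bounded_linear_intro[of _ "cmod c"])
    show "c *\<^sub>C r *\<^sub>R v = r *\<^sub>R c *\<^sub>C v" for r and v :: 'b
      unfolding scaleC_of_real[symmetric] scaleC_scaleC by (simp add: mult.commute)
  qed (auto simp: scaleC_add_right norm_scaleC)
  from bounded_linear_compose[OF this T] show "bounded_linear (\<lambda>u. c *\<^sub>C T u)" .
qed

instance
  by standard
    (transfer, simp add: fun_eq_iff scaleC_add_right scaleC_add_left scaleC_scaleC scaleC_of_real)+

end

lemma hilbert_riesz:
  fixes \<phi> :: "'a::complex_hilbert_space \<Rightarrow> complex"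
  assumes add: "\<And>u v. \<phi> (u + v) = \<phi> u + \<phi> v"
    and scale: "\<And>c u. \<phi> (c *\<^sub>C u) = c * \<phi> u"
    and bound: "\<And>u. cmod (\<phi> u) \<le> K * norm u"
  shows "\<exists>v. \<forall>u. \<phi> u = cinner u v"
proof -
  define r where "r u = Re (\<phi> u)" for u
  define J where "J u = (norm u)\<^sup>2 - 2 * r u" for u
  define m where "m = Inf (range J)"
  have r_add: "r (u + v) = r u + r v" for u v
    by (simp add: r_def add)
  have r_scale: "r (t *\<^sub>R u) = t * r u" for t u
    by (simp add: r_def scale flip: scaleC_of_real)
  have r_bound: "\<bar>r u\<bar> \<le> K * norm u" for u
    unfolding r_def using abs_Re_le_cmod[of "\<phi> u"] bound[of u] by linarith
  have norm_add: "(norm (u + v))\<^sup>2 = (norm u)\<^sup>2 + (norm v)\<^sup>2 + 2 * Re (cinner u v)" for u v :: 'a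
  proof -
    have "complex_of_real ((norm (u + v))\<^sup>2)
        = complex_of_real ((norm u)\<^sup>2) + complex_of_real ((norm v)\<^sup>2) + (cinner u v + cinner v u)"
      unfolding cinner_self[symmetric] by (simp add: cinner_add_left cinner_add_right)
    then have "Re (complex_of_real ((norm (u + v))\<^sup>2))
        = Re (complex_of_real ((norm u)\<^sup>2) + complex_of_real ((norm v)\<^sup>2) + (cinner u v + cinner v u))"
      by (rule arg_cong)
    moreover have "Re (cinner v u) = Re (cinner u v)"
      by (subst cinner_commute) simp
    ultimately show ?thesis
      by (simp del: of_real_power)
  qed
  have re_scale: "Re (cinner (t *\<^sub>R u) v) = t * Re (cinner u v)" for t and u v :: 'a
    by (simp add: cinner_scaleC_left flip: scaleC_of_real)
  have lower: "- (K\<^sup>2) \<le> J u" for u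
  proof -
    have "0 \<le> (norm u - K)\<^sup>2" by simp
    then show ?thesis
      using r_bound[of u] unfolding J_def power2_diff by (simp add: algebra_simps)
  qed
  have bdd: "bdd_below (range J)"
    using lower by (intro bdd_belowI2)
  have m_le: "m \<le> J u" for u
    unfolding m_def using bdd by (simp add: cINF_lower)
  have "\<exists>u. J u < m + 1 / real (Suc n)" for n
  proof -
    have "Inf (range J) < m + 1 / real (Suc n)"
      unfolding m_def by simp
    then show ?thesis
      using cInf_lessD[of "range J"] by fastforce
  qed
  then obtain s where s: "\<And>n. J (s n) < m + 1 / real (Suc n)"
    by metis
  have par: "(norm (u - v))\<^sup>2 \<le> 2 * ((J u - m) + (J v - m))" for u v
  proof -
    have "(norm (u - v))\<^sup>2 = (norm u)\<^sup>2 + (norm v)\<^sup>2 - 2 * Re (cinner u v)"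
      using norm_add[of u "- v"] by (simp add: cinner_minus_right)
    moreover have "J ((1 / 2) *\<^sub>R (u + v)) = (norm (u + v))\<^sup>2 / 4 - (r u + r v)"
      unfolding J_def r_scale r_add by (simp add: power_divide add_divide_distrib del: scaleR_add_right)
    ultimately have "m \<le> (norm (u + v))\<^sup>2 / 4 - (r u + r v)"
      and "(norm (u - v))\<^sup>2 = (norm u)\<^sup>2 + (norm v)\<^sup>2 - 2 * Re (cinner u v)"
      using m_le[of "(1 / 2) *\<^sub>R (u + v)"] by auto
    then show ?thesis
      using norm_add[of u v] unfolding J_def by argo
  qed
  have "Cauchy s"
  proof (rule metric_CauchyI)
    fix e :: real assume e: "e > 0"
    obtain N where N: "1 / real (Suc N) < e\<^sup>2 / 4"
      using nat_approx_posE[of "e\<^sup>2 / 4"] e by auto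
    have "dist (s i) (s j) < e" if "i \<ge> N" "j \<ge> N" for i j
    proof -
      have "1 / real (Suc i) \<le> 1 / real (Suc N)" "1 / real (Suc j) \<le> 1 / real (Suc N)"
        using that by (auto intro!: divide_left_mono)
      then have "(norm (s i - s j))\<^sup>2 < e\<^sup>2"
        using par[of "s i" "s j"] s[of i] s[of j] N by argo
      then show ?thesis
        unfolding dist_norm using e by (simp add: power2_less_imp_less)
    qed
    then show "\<exists>N. \<forall>i\<ge>N. \<forall>j\<ge>N. dist (s i) (s j) < e" by blast
  qed
  then obtain v where v: "s \<longlonglongrightarrow> v"
    using Cauchy_convergent_iff convergent_def by blast
  have "linear r"
    by (rule linearI) (auto simp: r_add r_scale)
  then have "bounded_linear r"
    using r_bound by (auto simp: bounded_linear_def bounded_linear_axioms_def mult.commute)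
  then have "(\<lambda>n. J (s n)) \<longlonglongrightarrow> J v"
    unfolding J_def using v
    by (intro tendsto_intros bounded_linear.tendsto[of r])
  moreover have "(\<lambda>n. m + 1 / real (Suc n)) \<longlonglongrightarrow> m + 0"
    using LIMSEQ_inverse_real_of_nat
    by (intro tendsto_add tendsto_const) (simp add: inverse_eq_divide)
  ultimately have "J v \<le> m"
    using s by (intro LIMSEQ_le[of "\<lambda>n. J (s n)" _ "\<lambda>n. m + 1 / real (Suc n)"])
      (auto intro: less_imp_le)
  have re: "r w = Re (cinner w v)" for w
  proof -
    define a where "a = Re (cinner w v) - r w"
    have t: "0 \<le> t\<^sup>2 * (norm w)\<^sup>2 + 2 * t * a" for t
    proof -
      have "J v \<le> J (t *\<^sub>R w + v)"
        using \<open>J v \<le> m\<close> m_le by (meson order_trans)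
      then show ?thesis
        unfolding J_def norm_add r_add r_scale re_scale a_def
        by (simp add: power_mult_distrib algebra_simps)
    qed
    have "a = 0"
    proof (cases "norm w = 0")
      case True
      then show ?thesis using t[of "- a"] by (simp add: power2_eq_square)
         (metis mult_le_0_iff not_square_less_zero order_antisym zero_le_square mult_eq_0_iff)
    next
      case False
      then have "(- a / (norm w)\<^sup>2)\<^sup>2 * (norm w)\<^sup>2 + 2 * (- a / (norm w)\<^sup>2) * a
          = - (a\<^sup>2 / (norm w)\<^sup>2)"
        by (simp add: field_simps power2_eq_square)
      then have "a\<^sup>2 / (norm w)\<^sup>2 \<le> 0"
        using t[of "- a / (norm w)\<^sup>2"] by linarith
      moreover have "0 < (norm w)\<^sup>2" using False by simp
      ultimately show ?thesis
        by (simp add: divide_le_0_iff)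
    qed
    then show ?thesis by (simp add: a_def)
  qed
  have "\<phi> u = cinner u v" for u
  proof (rule complex_eqI)
    show "Re (\<phi> u) = Re (cinner u v)"
      using re[of u] by (simp add: r_def)
    show "Im (\<phi> u) = Im (cinner u v)"
      using re[of "\<i> *\<^sub>C u"] by (simp add: r_def scale cinner_scaleC_left)
  qed
  then show ?thesis by blast
qed

definition adj :: "('h::complex_hilbert_space \<Rightarrow>\<^sub>L 'h) \<Rightarrow> ('h \<Rightarrow>\<^sub>L 'h)" where
  "adj T = (THE S. \<forall>u v. cinner (blinfun_apply T u) v = cinner u (blinfun_apply S v))"

lemma cinner_eqI:
  assumes "\<And>u. cinner u v = cinner u (w :: 'a :: complex_inner_space)"
  shows "v = w"
proof -
  have "cinner (v - w) (v - w) = 0"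
    using assms[of "v - w"] unfolding cinner_diff_right by simp
  then show ?thesis by (simp add: cinner_self)
qed

lemma cinner_adj:
  fixes T :: "'h::complex_hilbert_space \<Rightarrow>\<^sub>L 'h"
  assumes "T \<in> bounded_operators"
  shows "cinner (blinfun_apply T u) v = cinner u (blinfun_apply (adj T) v)"
proof -
  have ex: "\<exists>w. \<forall>u. cinner (blinfun_apply T u) v = cinner u w" for v
  proof (rule hilbert_riesz)
    show "cmod (cinner (blinfun_apply T u) v) \<le> (norm T * norm v) * norm u" for u
    proof -
      have "cmod (cinner (blinfun_apply T u) v) \<le> norm (blinfun_apply T u) * norm v"
        by (rule cinner_cauchy_schwarz)
      also have "\<dots> \<le> (norm T * norm u) * norm v"
        by (intro mult_right_mono norm_blinfun norm_ge_zero)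
      finally show ?thesis by (simp add: algebra_simps)
    qed
    show "cinner (blinfun_apply T (c *\<^sub>C u)) v = c * cinner (blinfun_apply T u) v" for c u
      using assms by (simp add: bounded_operators_def cinner_scaleC_left)
  qed (simp add: blinfun.add_right cinner_add_left)
  then obtain S where S: "\<And>u v. cinner (blinfun_apply T u) v = cinner u (S v)"
    by metis
  have "bounded_linear S"
  proof (rule bounded_linear_intro[of _ "norm T"])
    show "S (v + w) = S v + S w" for v w
      by (rule cinner_eqI) (simp add: cinner_add_right flip: S)
    show "S (r *\<^sub>R v) = r *\<^sub>R S v" for r v
      by (rule cinner_eqI) (simp add: cinner_scaleC_right flip: S scaleC_of_real)
    show "norm (S v) \<le> norm v * norm T" for v
    proof -
      have "(norm (S v))\<^sup>2 = cmod (cinner (S v) (S v))"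
        by (simp add: cinner_self norm_power)
      also have "\<dots> = cmod (cinner (blinfun_apply T (S v)) v)"
        by (simp add: S)
      also have "\<dots> \<le> norm (blinfun_apply T (S v)) * norm v"
        by (rule cinner_cauchy_schwarz)
      also have "\<dots> \<le> (norm T * norm (S v)) * norm v"
        by (intro mult_right_mono norm_blinfun norm_ge_zero)
      finally have "norm (S v) * norm (S v) \<le> (norm v * norm T) * norm (S v)"
        by (simp add: power2_eq_square algebra_simps)
      then show ?thesis
        by (cases "norm (S v) = 0") (auto simp: mult_le_cancel_right)
    qed
  qed
  then have B: "\<forall>u v. cinner (blinfun_apply T u) v = cinner u (blinfun_apply (Blinfun S) v)"
    by (simp add: S bounded_linear_Blinfun_apply)
  have "\<forall>u v. cinner (blinfun_apply T u) v = cinner u (blinfun_apply (adj T) v)"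
    unfolding adj_def
  proof (rule theI[where a = "Blinfun S"])
    fix S' assume S': "\<forall>u v. cinner (blinfun_apply T u) v = cinner u (blinfun_apply S' v)"
    show "S' = Blinfun S"
      by (rule blinfun_eqI, rule cinner_eqI) (metis S' B)
  qed (rule B)
  then show ?thesis by blast
qed

definition compact_operators :: "('h::complex_inner_space \<Rightarrow>\<^sub>L 'h) set" where
  "compact_operators =
     {T \<in> bounded_operators. compact (closure (blinfun_apply T ` cball 0 1))}"

definition separable_infinite_dimensional :: "'h::complex_inner_space itself \<Rightarrow> bool" where
  "separable_infinite_dimensional _ \<longleftrightarrow>
     (\<exists>D :: 'h set. countable D \<and> closure D = UNIV) \<and>
     \<not> (\<exists>B :: 'h set. finite B \<and> cspan B = UNIV)"


section \<open>Concrete C*-algebras and isomorphism\<close>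

text \<open>
  C*-algebras occur as norm-closed *-subalgebras of bounded operators. The isomorphisms are
  abstract: no compatibility with the representing Hilbert spaces is required.
\<close>

definition star_isomorphic ::
    "('h::complex_hilbert_space \<Rightarrow>\<^sub>L 'h) set \<Rightarrow> ('k::complex_hilbert_space \<Rightarrow>\<^sub>L 'k) set \<Rightarrow> bool" where
  "star_isomorphic A B \<longleftrightarrow>
     (\<exists>\<Phi>. bij_betw \<Phi> A B \<and>
        (\<forall>S\<in>A. \<forall>T\<in>A. \<Phi> (S + T) = \<Phi> S + \<Phi> T) \<and>
        (\<forall>c. \<forall>T\<in>A. \<Phi> (c *\<^sub>C T) = c *\<^sub>C \<Phi> T) \<and>
        (\<forall>S\<in>A. \<forall>T\<in>A. \<Phi> (S o\<^sub>L T) = \<Phi> S o\<^sub>L \<Phi> T) \<and>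
        (\<forall>T\<in>A. \<Phi> (adj T) = adj (\<Phi> T)))"

text \<open>
  For \<open>A\<close> acting on \<open>\<ell>\<^sup>2(X)\<close>, the C*-tensor product of \<open>A\<close> with the compact operators on
  \<open>H\<close>, realised on \<open>\<ell>\<^sup>2(X) \<otimes> H = \<ell>\<^sup>2(X; H)\<close>. As the compact operators are nuclear, the
  spatial tensor product is the only C*-tensor product. The elementary tensor \<open>a \<otimes> k\<close> is the
  bounded operator with \<open>(a \<otimes> k)(f \<otimes> v) = a f \<otimes> k v\<close>, which determines it.
\<close>

definition elementary_tensors ::
    "(('x, complex) ell2 \<Rightarrow>\<^sub>L ('x, complex) ell2) set \<Rightarrow> ('h::complex_hilbert_space \<Rightarrow>\<^sub>L 'h) set
     \<Rightarrow> (('x, 'h) ell2 \<Rightarrow>\<^sub>L ('x, 'h) ell2) set" where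
  "elementary_tensors A B =
     {T \<in> bounded_operators. \<exists>a\<in>A. \<exists>b\<in>B. \<forall>f v.
        blinfun_apply T (ell2_tensor f v) = ell2_tensor (blinfun_apply a f) (blinfun_apply b v)}"

definition stabilisation ::
    "(('x, complex) ell2 \<Rightarrow>\<^sub>L ('x, complex) ell2) set
     \<Rightarrow> (('x, 'h::complex_hilbert_space) ell2 \<Rightarrow>\<^sub>L ('x, 'h) ell2) set" where
  "stabilisation A = closure (cspan (elementary_tensors A compact_operators))"

definition stably_star_isomorphic ::
    "'h::complex_hilbert_space itself
     \<Rightarrow> (('x, complex) ell2 \<Rightarrow>\<^sub>L ('x, complex) ell2) set
     \<Rightarrow> (('y, complex) ell2 \<Rightarrow>\<^sub>L ('y, complex) ell2) set \<Rightarrow> bool" where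
  "stably_star_isomorphic _ A B \<longleftrightarrow>
     star_isomorphic (stabilisation A :: (('x, 'h) ell2 \<Rightarrow>\<^sub>L ('x, 'h) ell2) set)
                     (stabilisation B :: (('y, 'h) ell2 \<Rightarrow>\<^sub>L ('y, 'h) ell2) set)"


section \<open>Roe algebras\<close>

lift_definition matrix_entry ::
    "(('x, 'h::real_normed_vector) ell2 \<Rightarrow>\<^sub>L ('x, 'h) ell2) \<Rightarrow> 'x \<Rightarrow> 'x \<Rightarrow> ('h \<Rightarrow>\<^sub>L 'h)"
  is "\<lambda>T x y v. coord (T (single y v)) x"
  by (intro bounded_linear_compose[OF bounded_linear_coord] bounded_linear_compose[OF _ bounded_linear_single])

definition finite_propagation ::
    "(('x::metric_space, 'h::complex_inner_space) ell2 \<Rightarrow>\<^sub>L ('x, 'h) ell2) \<Rightarrow> bool" where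
  "finite_propagation T \<longleftrightarrow> (\<exists>R. \<forall>x y. matrix_entry T x y \<noteq> 0 \<longrightarrow> dist x y \<le> R)"

definition locally_compact_operator ::
    "(('x, 'h::complex_inner_space) ell2 \<Rightarrow>\<^sub>L ('x, 'h) ell2) \<Rightarrow> bool" where
  "locally_compact_operator T \<longleftrightarrow> (\<forall>x y. matrix_entry T x y \<in> compact_operators)"

definition uniform_roe_algebra ::
    "(('x::metric_space, complex) ell2 \<Rightarrow>\<^sub>L ('x, complex) ell2) set" where
  "uniform_roe_algebra = closure {T \<in> bounded_operators. finite_propagation T}"

definition roe_algebra ::
    "(('x::metric_space, 'h::complex_hilbert_space) ell2 \<Rightarrow>\<^sub>L ('x, 'h) ell2) set" where
  "roe_algebra =
     closure {T \<in> bounded_operators. finite_propagation T \<and> locally_compact_operator T}"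


section \<open>Coarse geometry\<close>

text \<open>Finiteness of balls also makes the topology discrete.\<close>

definition bounded_geometry :: "'x::metric_space itself \<Rightarrow> bool" where
  "bounded_geometry _ \<longleftrightarrow>
     (\<forall>R>0. \<exists>N. \<forall>x :: 'x. finite (cball x R) \<and> card (cball x R) \<le> N)"

definition control_function :: "(real \<Rightarrow> real) \<Rightarrow> bool" where
  "control_function \<rho> \<longleftrightarrow>
     \<rho> ` {0..} \<subseteq> {0..} \<and> mono_on {0..} \<rho> \<and> \<not> bdd_above (\<rho> ` {0..})"

definition coarse_embedding :: "('x::metric_space \<Rightarrow> 'y::metric_space) \<Rightarrow> bool" where
  "coarse_embedding f \<longleftrightarrow>
     (\<exists>\<rho>\<^sub>1 \<rho>\<^sub>2. control_function \<rho>\<^sub>1 \<and> control_function \<rho>\<^sub>2 \<and>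
        (\<forall>x y. \<rho>\<^sub>1 (dist x y) \<le> dist (f x) (f y) \<and> dist (f x) (f y) \<le> \<rho>\<^sub>2 (dist x y)))"

definition coarsely_equivalent :: "'x::metric_space itself \<Rightarrow> 'y::metric_space itself \<Rightarrow> bool" where
  "coarsely_equivalent _ _ \<longleftrightarrow>
     (\<exists>f :: 'x \<Rightarrow> 'y. coarse_embedding f \<and> (\<exists>C>0. \<forall>y. infdist y (range f) \<le> C))"

definition sparse_decomposition :: "'x::metric_space set \<Rightarrow> (nat \<Rightarrow> 'x set) \<Rightarrow> bool" where
  "sparse_decomposition Z P \<longleftrightarrow>
     disjoint_family P \<and> (\<Union>n. P n) = Z \<and> (\<forall>n. finite (P n) \<and> P n \<noteq> {}) \<and>
     (\<forall>K. \<exists>N. \<forall>n m. n \<noteq> m \<and> n + m \<ge> N \<longrightarrow> setdist (P n) (P m) \<ge> K)"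

definition outer_boundary :: "'x::metric_space set \<Rightarrow> real \<Rightarrow> 'x set \<Rightarrow> 'x set" where
  "outer_boundary X R A = {x \<in> X - A. infdist x A \<le> R}"

text \<open>
  A probability measure on a finite set \<open>P n\<close> is a probability mass function supported in
  \<open>P n\<close>. The convention \<open>infdist x {} = 0\<close> plays no role below, since sets of measure at
  least \<open>\<alpha> > 0\<close> are non-empty.
\<close>

definition measured_asymptotic_expanders ::
    "(nat \<Rightarrow> 'x::metric_space set) \<Rightarrow> (nat \<Rightarrow> 'x pmf) \<Rightarrow> bool" where
  "measured_asymptotic_expanders P \<mu> \<longleftrightarrow>
     (\<forall>n. finite (P n) \<and> P n \<noteq> {} \<and> set_pmf (\<mu> n) \<subseteq> P n) \<and>
     (\<forall>\<alpha>. 0 < \<alpha> \<and> \<alpha> \<le> 1 / 2 \<longrightarrow>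
        (\<exists>c R. 0 < c \<and> c < 1 \<and> 0 < R \<and>
          (\<forall>n. \<forall>A\<subseteq>P n.
             \<alpha> \<le> measure_pmf.prob (\<mu> n) A \<and> measure_pmf.prob (\<mu> n) A \<le> 1 / 2 \<longrightarrow>
             measure_pmf.prob (\<mu> n) (outer_boundary (P n) R A)
               > c * measure_pmf.prob (\<mu> n) A)))"

definition consists_of_ghostly_measured_asymptotic_expanders :: "'x::metric_space set \<Rightarrow> bool" where
  "consists_of_ghostly_measured_asymptotic_expanders Z \<longleftrightarrow>
     (\<exists>P \<mu>. sparse_decomposition Z P \<and>
        (\<forall>n. set_pmf (\<mu> n) \<subseteq> P n) \<and>
        (\<lambda>n. SUP x\<in>P n. pmf (\<mu> n) x) \<longlonglongrightarrow> 0 \<and>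
        measured_asymptotic_expanders P \<mu>)"

definition contains_ghostly_measured_asymptotic_expanders :: "'x::metric_space itself \<Rightarrow> bool" where
  "contains_ghostly_measured_asymptotic_expanders _ \<longleftrightarrow>
     (\<exists>Z :: 'x set. consists_of_ghostly_measured_asymptotic_expanders Z)"

end

theory Submission
  imports Defs
begin

text \<open>
  Both kinds of algebra are closures of operators of finite propagation with compact matrix entries
  in the corner of some member of an increasing sequence of projections on the fibre, so they can be
  treated together.

  A coarse equivalence yields a bijection \<open>X \<times> \<nat> \<rightarrow> Y \<times> \<nat>\<close> that lies at bounded distance from it and
  controls the second coordinates; the unitary permuting orthonormal bases accordingly conjugates
  one algebra onto the other.

  Conversely, as both algebras contain the compact operators, an isomorphism is implemented by a
  unitary \<open>U\<close>. Let \<open>V\<close> be its inverse and \<open>e\<^sub>x\<close> the unit vector \<open>\<delta>\<^sub>x \<otimes> e\<^sub>0\<close>. The point is that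
  \<open>sup\<^sub>y \<parallel>\<chi>\<^sub>y U e\<^sub>x\<parallel>\<close> is bounded below uniformly in \<open>x\<close>. A gliding hump shows that \<open>V \<chi>\<^sub>A U e\<^sub>x\<close> is concentrated
  near \<open>x\<close> uniformly in \<open>A \<subseteq> Y\<close>; averaging over signs, most of the vectors \<open>V \<chi>\<^sub>y U e\<^sub>x\<close> are concentrated
  in one ball around \<open>x\<close>. If all of them were small, there would be so many that two of the points \<open>y\<close>
  are far apart. The rank-one operator exchanging the two vectors has bounded propagation over \<open>X\<close>,
  but a large matrix entry far from the diagonal over \<open>Y\<close>, and infinitely many such operators add up to
  an element of the algebra of \<open>X\<close> whose image is not in the algebra of \<open>Y\<close>. Choosing \<open>f x\<close> with
  \<open>\<chi>\<^sub>y U e\<^sub>x\<close> large at \<open>y = f x\<close>, the same argument with rank-one operators shows that \<open>f\<close> is coarse and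
  that the map obtained from \<open>V\<close> is a coarse inverse.
\<close>

section \<open>Complex-linear operators and orthogonality\<close>

text \<open>The obstacle is uniformity: an abstract isomorphism knows nothing of distances, and
  membership in a norm closure gives a propagation bound that depends on the operator. Two devices
  yield one bound for all points. The projection onto the closed span of all vectors
  \<open>single x e0\<close> is a single element of the algebra, so one approximation of its
  conjugate serves every \<open>x\<close>. Where no single element contains the whole family, a
  failing sequence is glued into one element, and at each step both the terms already chosen and
  those still to come must be made small. Such arguments are blind to finitely many points, so the
  estimates are first proved off a finite set and the remaining points are handled separately. The
  corners \<open>P n\<close> are carried along because a glued sum of rank-one operators is
  controlled only if all its vectors lie in one corner; hence the lower bound is proved for
  \<open>P m\<close> applied to the coordinate, with \<open>m\<close> independent of
  \<open>x\<close>.\<close>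

definition clinear :: "('a::complex_inner_space \<Rightarrow>\<^sub>L 'b::complex_inner_space) \<Rightarrow> bool" where
  "clinear T \<longleftrightarrow> (\<forall>c u. T (c *\<^sub>C u) = c *\<^sub>C T u)"

lemma bounded_operators_iff: "T \<in> bounded_operators \<longleftrightarrow> clinear T"
  by (simp add: bounded_operators_def clinear_def)

lemma clinear_scaleC: "clinear T \<Longrightarrow> T (c *\<^sub>C u) = c *\<^sub>C T u"
  by (simp add: clinear_def)

lemma clinear_id: "clinear id_blinfun"
  and clinear_zero: "clinear 0"
  and clinear_add: "clinear S \<Longrightarrow> clinear T \<Longrightarrow> clinear (S + T)"
  by (simp_all add: clinear_def blinfun.add_left scaleC_add_right)

lemma clinear_compose: "clinear S \<Longrightarrow> clinear T \<Longrightarrow> clinear (S o\<^sub>L T)"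
  by (simp add: clinear_def)

lemma scaleC_blinfun_apply: "blinfun_apply (c *\<^sub>C T) u = c *\<^sub>C blinfun_apply T u"
  by transfer simp

lemma clinear_scaleC_blinfun: "clinear T \<Longrightarrow> clinear (c *\<^sub>C T)"
  by (simp add: clinear_def scaleC_blinfun_apply scaleC_scaleC mult.commute)

lemma bounded_linear_scaleC: "bounded_linear (\<lambda>x. c *\<^sub>C (x :: 'a :: complex_inner_space))"
proof -
  have "c *\<^sub>C (x::'a) = blinfun_apply (c *\<^sub>C id_blinfun) x" for x
    by (simp add: scaleC_blinfun_apply)
  then show ?thesis by (simp add: blinfun.bounded_linear_right)
qed

lemma norm_scaleC_blinfun_le:
  fixes T :: "'a::real_normed_vector \<Rightarrow>\<^sub>L 'b::complex_inner_space"
  shows "norm (c *\<^sub>C T) \<le> cmod c * norm T"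
  by (rule norm_blinfun_bound)
     (auto simp: scaleC_blinfun_apply norm_scaleC mult.assoc intro!: mult_left_mono norm_blinfun)

lemma bounded_linear_cinner_left: "bounded_linear (\<lambda>u. cinner u (v::'a::complex_inner_space))"
  by (rule bounded_linear_intro[of _ "norm v"])
     (auto simp: cinner_add_left cinner_cauchy_schwarz cinner_scaleC_left scaleR_conv_of_real
       simp flip: scaleC_of_real)

lemma bounded_linear_cinner_right: "bounded_linear (\<lambda>u. cinner (v::'a::complex_inner_space) u)"
  by (rule bounded_linear_intro[of _ "norm v"])
     (auto simp: cinner_add_right cinner_scaleC_right scaleR_conv_of_real mult.commute
        cinner_cauchy_schwarz[THEN order_trans] simp flip: scaleC_of_real)

lemmas cinner_sum_left = linear_sum[OF bounded_linear.linear[OF bounded_linear_cinner_left]]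
lemmas cinner_sum_right = linear_sum[OF bounded_linear.linear[OF bounded_linear_cinner_right]]
lemmas tendsto_cinner_left = bounded_linear.tendsto[OF bounded_linear_cinner_left]
lemmas tendsto_cinner_right = bounded_linear.tendsto[OF bounded_linear_cinner_right]

lemma cinner_self_eq_0 [simp]: "cinner x x = 0 \<longleftrightarrow> x = 0"
  by (simp add: cinner_self)

lemma cinner_eq_0_commute: "cinner x y = 0 \<longleftrightarrow> cinner y x = 0"
  by (metis cinner_commute complex_cnj_zero)

lemma norm_add_orthogonal:
  assumes "cinner x (y::'a::complex_inner_space) = 0"
  shows "(norm (x + y))\<^sup>2 = (norm x)\<^sup>2 + (norm y)\<^sup>2"
proof -
  have "complex_of_real ((norm (x + y))\<^sup>2) = complex_of_real ((norm x)\<^sup>2 + (norm y)\<^sup>2)"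
    using assms cinner_eq_0_commute[of x y]
    unfolding of_real_add cinner_self[symmetric] by (simp add: cinner_add_left cinner_add_right)
  then show ?thesis by (simp only: of_real_eq_iff)
qed

lemma norm_sum_orthogonal:
  fixes v :: "'i \<Rightarrow> 'a::complex_inner_space"
  assumes "finite I" "\<And>i j. i \<in> I \<Longrightarrow> j \<in> I \<Longrightarrow> i \<noteq> j \<Longrightarrow> cinner (v i) (v j) = 0"
  shows "(norm (\<Sum>i\<in>I. v i))\<^sup>2 = (\<Sum>i\<in>I. (norm (v i))\<^sup>2)"
  using assms
proof (induction I)
  case (insert k I)
  have "cinner (v k) (\<Sum>i\<in>I. v i) = 0"
    unfolding cinner_sum_right using insert by (intro sum.neutral) auto
  then show ?case
    using insert by (simp add: norm_add_orthogonal)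
qed simp

lemma norm_parallelogram:
  "(norm (x + y))\<^sup>2 + (norm (x - y))\<^sup>2 = 2 * (norm x)\<^sup>2 + 2 * (norm (y::'a::complex_inner_space))\<^sup>2"
proof -
  have "complex_of_real ((norm (x + y))\<^sup>2 + (norm (x - y))\<^sup>2) =
      complex_of_real (2 * (norm x)\<^sup>2 + 2 * (norm y)\<^sup>2)"
    unfolding of_real_add of_real_mult cinner_self[symmetric]
    by (simp add: cinner_add_left cinner_add_right cinner_diff_left cinner_diff_right)
  then show ?thesis by (simp only: of_real_eq_iff)
qed

text \<open>By the parallelogram law, the mean of the squared norms of \<open>w + v k\<close> and
  \<open>w - v k\<close> splits off the squared norm of \<open>v k\<close>, so averaging over all
  signs leaves the sum of squares. The offset \<open>w\<close> serves the induction, which absorbs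
  one signed vector into it.\<close>

lemma sum_norm_squares_le_signed_sums:
  fixes v :: "'i \<Rightarrow> 'a::complex_inner_space"
  assumes "finite I"
    and "\<And>J. J \<subseteq> I \<Longrightarrow> norm (w + (\<Sum>i\<in>J. v i) - (\<Sum>i\<in>I - J. v i)) \<le> c"
  shows "(norm w)\<^sup>2 + (\<Sum>i\<in>I. (norm (v i))\<^sup>2) \<le> c\<^sup>2"
  using assms
proof (induction I arbitrary: w)
  case empty
  then show ?case using power_mono[of "norm w" c 2] by simp
next
  case (insert k I)
  have "norm ((w + v k) + (\<Sum>i\<in>J. v i) - (\<Sum>i\<in>I - J. v i)) \<le> c" if "J \<subseteq> I" for J
  proof -
    have "finite J" "k \<notin> J" "insert k I - insert k J = I - J"
      using that insert.hyps finite_subset by auto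
    then show ?thesis
      using insert.prems[of "insert k J"] that by (auto simp: algebra_simps)
  qed
  then have 1: "(norm (w + v k))\<^sup>2 + (\<Sum>i\<in>I. (norm (v i))\<^sup>2) \<le> c\<^sup>2"
    by (rule insert.IH)
  have "norm ((w - v k) + (\<Sum>i\<in>J. v i) - (\<Sum>i\<in>I - J. v i)) \<le> c" if "J \<subseteq> I" for J
  proof -
    have "insert k I - J = insert k (I - J)" "k \<notin> I - J" "finite (I - J)"
      using that insert.hyps by auto
    then show ?thesis
      using insert.prems[of J] that by (auto simp: algebra_simps)
  qed
  then have 2: "(norm (w - v k))\<^sup>2 + (\<Sum>i\<in>I. (norm (v i))\<^sup>2) \<le> c\<^sup>2"
    by (rule insert.IH)
  show ?case
    using 1 2 norm_parallelogram[of w "v k"] insert.hyps by simp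
qed

lemma norm_blinfun_unit_le: "norm u \<le> 1 \<Longrightarrow> norm (blinfun_apply T u) \<le> norm T"
  using norm_blinfun[of T u] mult_left_mono[of "norm u" 1 "norm T"] by simp

lemma norm_blinfun_bound_unit:
  assumes "b \<ge> 0" "\<And>u. norm u \<le> 1 \<Longrightarrow> norm (blinfun_apply T u) \<le> b"
  shows "norm T \<le> b"
proof (rule norm_blinfun_bound[OF assms(1)])
  fix u
  show "norm (T u) \<le> b * norm u"
  proof (cases "u = 0")
    case False
    have "norm (T (u /\<^sub>R norm u)) \<le> b" using False by (intro assms(2)) simp
    then show ?thesis using False by (simp add: blinfun.scaleR_right field_simps)
  qed simp
qed

lemma cinner_self_eq_1_iff: "cinner v v = 1 \<longleftrightarrow> norm v = 1"
proof -
  have "cinner v v = 1 \<longleftrightarrow> (norm v)\<^sup>2 = 1"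
    unfolding cinner_self by (rule of_real_eq_1_iff)
  also have "\<dots> \<longleftrightarrow> norm v = 1"
    by (simp add: abs_square_eq_1)
  finally show ?thesis .
qed

lemma cinner_sgn: "cinner c (sgn c) = of_real (norm (c :: 'a::complex_inner_space))"
proof (cases "c = 0")
  case False
  have "cinner c (sgn c) = cnj (of_real (inverse (norm c))) * cinner c c"
    unfolding sgn_div_norm scaleC_of_real[symmetric] cinner_scaleC_right ..
  then show ?thesis using False by (simp add: cinner_self power2_eq_square)
qed simp

text \<open>Pairing \<open>f\<close> with the combination \<open>g\<close> of the \<open>b i\<close>
  gives \<open>s\<close>, while the squared norm of \<open>g\<close> is at most \<open>s\<close>;
  Cauchy-Schwarz finishes. Norm at most 1 is enough, which is all that is known of the blocks glued
  together below.\<close>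

lemma bessel:
  fixes b :: "'i \<Rightarrow> 'a::complex_inner_space"
  assumes "finite M" "\<And>i j. i \<in> M \<Longrightarrow> j \<in> M \<Longrightarrow> i \<noteq> j \<Longrightarrow> cinner (b i) (b j) = 0"
    and "\<And>i. i \<in> M \<Longrightarrow> norm (b i) \<le> 1"
  shows "(\<Sum>i\<in>M. (cmod (cinner f (b i)))\<^sup>2) \<le> (norm f)\<^sup>2"
proof -
  define c where "c i = cinner f (b i)" for i
  define g where "g = (\<Sum>i\<in>M. c i *\<^sub>C b i)"
  define s where "s = (\<Sum>i\<in>M. (cmod (c i))\<^sup>2)"
  have s0: "s \<ge> 0" by (simp add: s_def sum_nonneg)
  have "cinner f g = (\<Sum>i\<in>M. of_real ((cmod (c i))\<^sup>2))"
    unfolding g_def cinner_sum_right cinner_scaleC_right c_def[symmetric]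
    by (simp add: complex_norm_square mult.commute del: of_real_power)
  then have fg: "cinner f g = of_real s" by (simp add: s_def)
  have "(norm g)\<^sup>2 = (\<Sum>i\<in>M. (norm (c i *\<^sub>C b i))\<^sup>2)"
    unfolding g_def by (rule norm_sum_orthogonal[OF assms(1)])
      (simp add: cinner_scaleC_left cinner_scaleC_right assms(2))
  also have "\<dots> \<le> s"
    unfolding s_def norm_scaleC power_mult_distrib
    using assms(3) by (intro sum_mono) (simp add: mult_left_le power_le_one)
  finally have g: "(norm g)\<^sup>2 \<le> s" .
  have "s = cmod (cinner f g)" using s0 by (simp add: fg)
  also have "\<dots> \<le> norm f * norm g" by (rule cinner_cauchy_schwarz)
  finally have "s\<^sup>2 \<le> (norm f * norm g)\<^sup>2" using s0 by (intro power_mono)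
  also have "\<dots> \<le> (norm f)\<^sup>2 * s" unfolding power_mult_distrib using g by (intro mult_left_mono) auto
  finally have "s * s \<le> (norm f)\<^sup>2 * s" by (simp add: power2_eq_square)
  then have "s \<le> (norm f)\<^sup>2"
    using s0 by (cases "s = 0") auto
  then show ?thesis by (simp add: s_def c_def)
qed

lemma isometry_norm:
  fixes U :: "'a::complex_inner_space \<Rightarrow>\<^sub>L 'b::complex_inner_space"
  assumes "\<And>u v. cinner (U u) (U v) = cinner u v"
  shows "norm (U u) = norm u"
proof -
  have "(norm (U u))\<^sup>2 = (norm u)\<^sup>2"
    using assms[of u u] unfolding cinner_self of_real_eq_iff .
  then show ?thesis by (rule power2_eq_imp_eq) auto
qed


section \<open>Square-summable functions\<close>

lemma ell2_eqI: "(\<And>x. coord f x = coord g x) \<Longrightarrow> f = g"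
  using coord_inject[of f g] by blast

lemma coord_single: "coord (single x v) y = (if y = x then v else 0)"
  by (transfer) simp

lemma coord_sum: "coord (\<Sum>i\<in>I. f i) x = (\<Sum>i\<in>I. coord (f i) x)"
  by (rule linear_sum[OF bounded_linear.linear[OF bounded_linear_coord]])

lemma single_scaleC: "single x (c *\<^sub>C v) = c *\<^sub>C single x v"
  by (rule ell2_eqI) (simp add: coord_single)

lemma single_zero [simp]: "single x 0 = 0"
  by (rule ell2_eqI) (simp add: coord_single)

lemma has_sum_norm_ell2: "((\<lambda>x. (norm (coord f x))\<^sup>2) has_sum (norm f)\<^sup>2) UNIV"
proof -
  have "(\<lambda>x. (norm (coord f x))\<^sup>2) summable_on UNIV"
    by transfer
  moreover have "(norm f)\<^sup>2 = (\<Sum>\<^sub>\<infinity>x. (norm (coord f x))\<^sup>2)"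
    by transfer (simp add: infsum_nonneg)
  ultimately show ?thesis by simp
qed

lemma sum_norm_coord_le: "finite F \<Longrightarrow> (\<Sum>x\<in>F. (norm (coord f x))\<^sup>2) \<le> (norm f)\<^sup>2"
  by (rule finite_sum_le_has_sum[OF has_sum_norm_ell2]) auto

lemma norm_ell2_mono:
  assumes "\<And>x. norm (coord f x) \<le> norm (coord g x)"
  shows "norm f \<le> norm g"
proof -
  have "(norm f)\<^sup>2 \<le> (norm g)\<^sup>2"
    by (rule has_sum_mono[OF has_sum_norm_ell2 has_sum_norm_ell2]) (simp add: assms power_mono)
  then show ?thesis by (rule power2_le_imp_le) simp
qed

lemma cinner_ell2_has_sum: "((\<lambda>x. cinner (coord f x) (coord g x)) has_sum cinner f g) UNIV"
  by transfer (rule has_sum_infsum, rule cinner_ell2_summable)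

lemma cinner_single_left: "cinner (single x v) f = cinner v (coord f x)"
proof -
  have "((\<lambda>y. cinner (coord (single x v) y) (coord f y)) has_sum cinner v (coord f x)) UNIV
      \<longleftrightarrow> ((\<lambda>y. cinner v (coord f y)) has_sum cinner v (coord f x)) {x}"
    by (rule has_sum_cong_neutral) (auto simp: coord_single)
  then have "((\<lambda>y. cinner (coord (single x v) y) (coord f y)) has_sum cinner v (coord f x)) UNIV"
    using has_sum_finite[of "{x}" "\<lambda>y. cinner v (coord f y)"] by simp
  then show ?thesis
    by (rule has_sum_unique[OF cinner_ell2_has_sum])
qed

lemma cinner_single_right: "cinner f (single x v) = cinner (coord f x) v"
  by (simp add: cinner_commute[of f "single x v"] cinner_commute[of "coord f x" v] cinner_single_left)

text \<open>A finite partial sum is a restriction of \<open>f\<close>, orthogonal to the remainder,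
  so the squared error is a tail of the convergent sum of squared norms.\<close>

lemma has_sum_single:
  fixes f :: "('x, 'h::complex_inner_space) ell2"
  shows "((\<lambda>x. single x (coord f x)) has_sum f) UNIV"
  unfolding has_sum_def
proof (rule tendstoI)
  fix e :: real assume e: "e > 0"
  then have "e\<^sup>2 > 0" by simp
  then have "\<forall>\<^sub>F G in finite_subsets_at_top UNIV.
      dist (\<Sum>x\<in>G. (norm (coord f x))\<^sup>2) ((norm f)\<^sup>2) < e\<^sup>2"
    by (rule tendstoD[OF has_sum_norm_ell2[of f, unfolded has_sum_def]])
  then have *: "\<forall>\<^sub>F G in finite_subsets_at_top UNIV.
      finite G \<and> dist (\<Sum>x\<in>G. (norm (coord f x))\<^sup>2) ((norm f)\<^sup>2) < e\<^sup>2"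
    using eventually_finite_subsets_at_top_weakI[of UNIV finite] eventually_conj by blast
  have "dist (\<Sum>x\<in>G. single x (coord f x)) f < e"
    if G: "finite G" "dist (\<Sum>x\<in>G. (norm (coord f x))\<^sup>2) ((norm f)\<^sup>2) < e\<^sup>2" for G
  proof -
    define s where "s = (\<Sum>x\<in>G. single x (coord f x))"
    have s: "coord s x = (if x \<in> G then coord f x else 0)" for x
      unfolding s_def coord_sum coord_single using G by (simp add: sum.delta)
    have ns: "(norm s)\<^sup>2 = (\<Sum>x\<in>G. (norm (coord f x))\<^sup>2)"
    proof -
      have "(norm (\<Sum>x\<in>G. single x (coord f x)))\<^sup>2 = (\<Sum>x\<in>G. (norm (single x (coord f x)))\<^sup>2)"
        by (rule norm_sum_orthogonal[OF G(1)]) (auto simp: cinner_single_left coord_single)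
      then show ?thesis by (simp add: s_def norm_single)
    qed
    have "cinner s (f - s) = 0"
      by (subst s_def, subst cinner_sum_left, rule sum.neutral)
         (auto simp: cinner_single_left s)
    then have "(norm f)\<^sup>2 = (norm s)\<^sup>2 + (norm (f - s))\<^sup>2"
      using norm_add_orthogonal[of s "f - s"] by simp
    then have "(norm (f - s))\<^sup>2 < e\<^sup>2"
      using G(2) ns by (simp add: dist_real_def)
    then show ?thesis
      using e by (simp add: s_def dist_norm norm_minus_commute power2_less_imp_less)
  qed
  with * show "\<forall>\<^sub>F G in finite_subsets_at_top UNIV. dist (\<Sum>x\<in>G. single x (coord f x)) f < e"
    by (auto elim: eventually_mono)
qed

lemma blinfun_ell2_has_sum:
  fixes T :: "('x, 'h::complex_inner_space) ell2 \<Rightarrow>\<^sub>L 'b::real_normed_vector"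
  shows "((\<lambda>x. T (single x (coord f x))) has_sum T f) UNIV"
  using has_sum_bounded_linear[OF blinfun.bounded_linear_right has_sum_single[of f], of T] by (simp add: o_def)

lemma blinfun_ell2_finite:
  fixes T :: "('x, 'h::complex_inner_space) ell2 \<Rightarrow>\<^sub>L 'b::real_normed_vector"
  assumes "finite F" "\<And>x. x \<notin> F \<Longrightarrow> T (single x (coord f x)) = 0"
  shows "T f = (\<Sum>x\<in>F. T (single x (coord f x)))"
proof -
  have "((\<lambda>x. T (single x (coord f x))) has_sum T f) UNIV \<longleftrightarrow>
      ((\<lambda>x. T (single x (coord f x))) has_sum T f) F"
    by (rule has_sum_cong_neutral) (use assms in auto)
  then have "((\<lambda>x. T (single x (coord f x))) has_sum T f) F"
    using blinfun_ell2_has_sum[of T f] by simp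
  then show ?thesis
    using has_sum_finite[OF assms(1)] by (rule has_sum_unique)
qed

lemma blinfun_ell2_eqI:
  fixes S T :: "('x, 'h::complex_inner_space) ell2 \<Rightarrow>\<^sub>L 'b::real_normed_vector"
  assumes "\<And>x v. S (single x v) = T (single x v)"
  shows "S = T"
proof (rule blinfun_eqI)
  fix f
  have "((\<lambda>x. T (single x (coord f x))) has_sum S f) UNIV"
    using blinfun_ell2_has_sum[of S f] by (simp only: assms)
  then show "S f = T f"
    using blinfun_ell2_has_sum[of T f] by (rule has_sum_unique)
qed

text \<open>The common source of the operators that are prescribed below by a formula for their
  coordinates; a bound on finite partial sums is all that has to be checked.\<close>

lemma ell2_operator:
  fixes w :: "'a::complex_inner_space \<Rightarrow> 'x \<Rightarrow> 'h::complex_inner_space"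
  assumes "\<And>f g x. w (f + g) x = w f x + w g x" "\<And>c f x. w (c *\<^sub>C f) x = c *\<^sub>C w f x"
    and "K \<ge> 0" "\<And>f F. finite F \<Longrightarrow> (\<Sum>x\<in>F. (norm (w f x))\<^sup>2) \<le> (K * norm f)\<^sup>2"
  shows "\<exists>T :: 'a \<Rightarrow>\<^sub>L ('x, 'h) ell2. clinear T \<and> (\<forall>f x. coord (T f) x = w f x) \<and> norm T \<le> K"
proof -
  have L: "L2_set (\<lambda>x. norm (w f x)) F \<le> K * norm f" if "finite F" for f F
    unfolding L2_set_def using assms(3) assms(4)[OF that] by (intro real_le_lsqrt) (auto simp: sum_nonneg)
  have s: "(\<lambda>x. (norm (w f x))\<^sup>2) summable_on UNIV" for f
    using L \<open>K \<ge> 0\<close> by (intro ell2_bound(1)[where B = "K * norm f"]) auto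
  define S where "S f = Abs_ell2 (w f)" for f
  have S: "coord (S f) x = w f x" for f x
    unfolding S_def using s by (simp add: Abs_ell2_inverse)
  have nS: "norm (S f) \<le> K * norm f" for f
  proof -
    have "norm (S f) = sqrt (\<Sum>\<^sub>\<infinity>x. (norm (w f x))\<^sup>2)"
      unfolding S[symmetric] by transfer simp
    then show ?thesis
      using ell2_bound(2)[where B = "K * norm f" and f = "w f"] L \<open>K \<ge> 0\<close> by simp
  qed
  have "bounded_linear S"
  proof (rule bounded_linear_intro[of _ K])
    show "S (f + g) = S f + S g" for f g
      by (rule ell2_eqI) (simp add: S assms)
    show "S (r *\<^sub>R f) = r *\<^sub>R S f" for r f
      unfolding scaleC_of_real[symmetric] by (rule ell2_eqI) (simp add: S assms)
  qed (simp add: nS mult.commute)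
  then have "\<And>f. blinfun_apply (Blinfun S) f = S f"
    by (simp add: bounded_linear_Blinfun_apply)
  moreover from this have "clinear (Blinfun S)"
    unfolding clinear_def by (auto intro!: ell2_eqI simp: S assms)
  moreover have "norm (Blinfun S) \<le> K"
    by (rule norm_blinfun_bound) (auto simp: calculation nS \<open>K \<ge> 0\<close>)
  ultimately show ?thesis using S by metis
qed

lemma finite_coord_large:
  assumes "e > 0"
  shows "finite {x. norm (coord f x) \<ge> e}"
proof (rule ccontr)
  assume inf: "infinite {x. norm (coord f x) \<ge> e}"
  obtain n :: nat where n: "real n * e\<^sup>2 > (norm f)\<^sup>2"
    using assms reals_Archimedean3[of "e\<^sup>2"] by auto
  obtain F where F: "finite F" "card F = n" "F \<subseteq> {x. norm (coord f x) \<ge> e}"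
    using infinite_arbitrarily_large[OF inf] by metis
  have "real n * e\<^sup>2 = (\<Sum>x\<in>F. e\<^sup>2)" using F by simp
  also have "\<dots> \<le> (\<Sum>x\<in>F. (norm (coord f x))\<^sup>2)"
    using F assms by (intro sum_mono power_mono) auto
  also have "\<dots> \<le> (norm f)\<^sup>2" by (rule sum_norm_coord_le[OF F(1)])
  finally show False using n by simp
qed

text \<open>An injective sequence leaves every finite set; in other words, unit vectors placed along
  it are weakly null.\<close>

lemma coord_tendsto_0:
  assumes "inj (k :: nat \<Rightarrow> 'x)"
  shows "(\<lambda>n. coord f (k n)) \<longlonglongrightarrow> 0"
proof (rule tendstoI)
  fix e :: real assume "e > 0"
  then have "finite (k -` {x. norm (coord f x) \<ge> e})"
    by (intro finite_vimageI finite_coord_large assms)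
  then have "\<forall>\<^sub>F n in sequentially. n \<notin> k -` {x. norm (coord f x) \<ge> e}"
    by (simp add: cofinite_eq_sequentially[symmetric] eventually_cofinite)
  then show "\<forall>\<^sub>F n in sequentially. dist (coord f (k n)) 0 < e"
    by eventually_elim auto
qed

section \<open>Projections, rank-one operators and compact operators\<close>

text \<open>Introduced by choice because such an operator exists only for suitable blocks; uniformly
  bounded complex-linear ones suffice.\<close>

definition diag :: "('x \<Rightarrow> 'h::complex_inner_space \<Rightarrow>\<^sub>L 'h) \<Rightarrow> (('x, 'h) ell2 \<Rightarrow>\<^sub>L ('x, 'h) ell2)" where
  "diag D = (SOME T. clinear T \<and> (\<forall>f x. coord (T f) x = D x (coord f x)))"

lemma
  assumes D: "\<And>x. clinear (D x)" "\<And>x. norm (D x) \<le> K"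
  shows clinear_diag: "clinear (diag D)"
    and coord_diag: "coord (diag D f) x = D x (coord f x)"
    and norm_diag: "norm (diag D) \<le> K"
proof -
  have K: "K \<ge> 0" using D(2) norm_ge_zero order_trans by blast
  have Dn: "norm (D x v) \<le> K * norm v" for x v
    using norm_blinfun[of "D x" v] D(2)[of x] by (meson mult_right_mono norm_ge_zero order_trans)
  have "(\<Sum>x\<in>F. (norm (D x (coord f x)))\<^sup>2) \<le> (K * norm f)\<^sup>2" if F: "finite F" for F f
  proof -
    have "(\<Sum>x\<in>F. (norm (D x (coord f x)))\<^sup>2) \<le> (\<Sum>x\<in>F. K\<^sup>2 * (norm (coord f x))\<^sup>2)"
      unfolding power_mult_distrib[symmetric] by (intro sum_mono power_mono Dn) auto
    also have "\<dots> \<le> K\<^sup>2 * (norm f)\<^sup>2"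
      unfolding sum_distrib_left[symmetric] by (intro mult_left_mono sum_norm_coord_le F) auto
    finally show ?thesis by (simp add: power_mult_distrib)
  qed
  then have "\<exists>T :: ('a, 'b) ell2 \<Rightarrow>\<^sub>L ('a, 'b) ell2.
      clinear T \<and> (\<forall>f x. coord (T f) x = D x (coord f x)) \<and> norm T \<le> K"
    using D K by (intro ell2_operator) (auto simp: blinfun.add_right clinear_scaleC)
  then have "\<exists>T :: ('a, 'b) ell2 \<Rightarrow>\<^sub>L ('a, 'b) ell2. clinear T \<and> (\<forall>f x. coord (T f) x = D x (coord f x))"
    by blast
  from someI_ex[OF this]
  have *: "clinear (diag D)" "\<And>f x. coord (diag D f) x = D x (coord f x)"
    unfolding diag_def by blast+
  then show "clinear (diag D)" "coord (diag D f) x = D x (coord f x)" by auto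
  show "norm (diag D) \<le> K"
  proof (rule norm_blinfun_bound[OF K])
    fix f
    have "norm (diag D f) \<le> norm (K *\<^sub>R f)"
      by (rule norm_ell2_mono) (use Dn K in \<open>simp add: *\<close>)
    then show "norm (diag D f) \<le> K * norm f" using K by simp
  qed
qed

definition ortho_proj :: "('a::complex_inner_space \<Rightarrow>\<^sub>L 'a) \<Rightarrow> bool" where
  "ortho_proj P \<longleftrightarrow> clinear P \<and> P o\<^sub>L P = P \<and> (\<forall>u v. cinner (P u) v = cinner u (P v))"

lemma ortho_proj_id: "ortho_proj id_blinfun"
  by (auto simp: ortho_proj_def clinear_def intro: blinfun_eqI)

lemma ortho_proj_clinear: "ortho_proj P \<Longrightarrow> clinear P"
  and ortho_proj_cinner: "ortho_proj P \<Longrightarrow> cinner (P u) v = cinner u (P v)"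
  by (simp_all add: ortho_proj_def)

lemma ortho_proj_idem: "ortho_proj P \<Longrightarrow> P (P u) = P u"
  by (metis ortho_proj_def blinfun_apply_blinfun_compose)

lemma ortho_proj_pythagoras:
  assumes "ortho_proj P"
  shows "(norm u)\<^sup>2 = (norm (P u))\<^sup>2 + (norm (u - P u))\<^sup>2"
proof -
  have "cinner (P u) (u - P u) = 0"
    using assms by (simp add: ortho_proj_cinner blinfun.diff_right ortho_proj_idem)
  from norm_add_orthogonal[OF this] show ?thesis by simp
qed

lemma ortho_proj_norm_le: assumes "ortho_proj P" shows "norm (P u) \<le> norm u"
  by (rule power2_le_imp_le) (use ortho_proj_pythagoras[OF assms, of u] in auto)

lemma ortho_proj_compl_norm_le: assumes "ortho_proj P" shows "norm (u - P u) \<le> norm u"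
  by (rule power2_le_imp_le) (use ortho_proj_pythagoras[OF assms, of u] in auto)

lemma ortho_proj_norm: "ortho_proj P \<Longrightarrow> norm P \<le> 1"
  by (rule norm_blinfun_bound) (auto simp: ortho_proj_norm_le)

text \<open>This is \<chi>_A \<otimes> P; with the identity as \<open>P\<close> it is restriction to
  \<open>A\<close>.\<close>

definition proj_on :: "'x set \<Rightarrow> ('h::complex_inner_space \<Rightarrow>\<^sub>L 'h) \<Rightarrow> (('x, 'h) ell2 \<Rightarrow>\<^sub>L ('x, 'h) ell2)" where
  "proj_on A P = diag (\<lambda>x. if x \<in> A then P else 0)"

lemma
  assumes "ortho_proj P"
  shows coord_proj_on: "coord (proj_on A P f) x = (if x \<in> A then P (coord f x) else 0)"
    and ortho_proj_proj_on: "ortho_proj (proj_on A P)"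
proof -
  have *: "clinear (if x \<in> A then P else 0)" "norm (if x \<in> A then P else 0) \<le> 1" for x
    using ortho_proj_norm[OF assms] ortho_proj_clinear[OF assms] by (auto simp: clinear_zero)
  show c: "coord (proj_on A P f) x = (if x \<in> A then P (coord f x) else 0)" for f x
    unfolding proj_on_def by (subst coord_diag[OF *]) auto
  show "ortho_proj (proj_on A P)"
    unfolding ortho_proj_def
  proof (intro conjI allI)
    show "clinear (proj_on A P)"
      unfolding proj_on_def by (rule clinear_diag[OF *])
    show "proj_on A P o\<^sub>L proj_on A P = proj_on A P"
      by (intro blinfun_eqI ell2_eqI) (auto simp: c ortho_proj_idem[OF assms])
    show "cinner (proj_on A P f) g = cinner f (proj_on A P g)" for f g
    proof (rule has_sum_unique[OF cinner_ell2_has_sum])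
      show "((\<lambda>x. cinner (coord (proj_on A P f) x) (coord g x)) has_sum cinner f (proj_on A P g)) UNIV"
        by (rule has_sum_cong[THEN iffD1, OF _ cinner_ell2_has_sum])
           (simp add: c ortho_proj_cinner[OF assms])
    qed
  qed
qed

lemma coord_proj_on_id: "coord (proj_on A id_blinfun f) x = (if x \<in> A then coord f x else 0)"
  by (simp add: coord_proj_on[OF ortho_proj_id])

lemma proj_on_single:
  "ortho_proj P \<Longrightarrow> proj_on {x} P f = single x (P (coord f x))"
  by (rule ell2_eqI) (auto simp: coord_proj_on coord_single)

lemma proj_on_finite:
  assumes "ortho_proj P" "finite A"
  shows "proj_on A P f = (\<Sum>x\<in>A. single x (P (coord f x)))"
  using assms by (intro ell2_eqI) (simp add: coord_proj_on coord_sum coord_single sum.delta)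

lemma norm_proj_on_finite:
  assumes "ortho_proj P" "finite A"
  shows "(norm (proj_on A P f))\<^sup>2 = (\<Sum>x\<in>A. (norm (P (coord f x)))\<^sup>2)"
proof -
  have "(norm (proj_on A P f))\<^sup>2 = (\<Sum>x\<in>A. (norm (single x (P (coord f x))))\<^sup>2)"
    unfolding proj_on_finite[OF assms]
    by (rule norm_sum_orthogonal[OF assms(2)]) (auto simp: cinner_single_left coord_single)
  then show ?thesis by (simp add: norm_single)
qed

lemma finite_tail:
  fixes f :: "('x, 'h::complex_inner_space) ell2"
  assumes "e > 0"
  obtains G where "finite G" "norm (f - proj_on G id_blinfun f) < e"
proof -
  have "\<forall>\<^sub>F G in finite_subsets_at_top UNIV. dist (\<Sum>x\<in>G. single x (coord f x)) f < e"
    using has_sum_single[of f] unfolding has_sum_def by (rule tendstoD) fact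
  moreover have "\<forall>\<^sub>F G in finite_subsets_at_top (UNIV :: 'x set). finite G"
    by (rule eventually_finite_subsets_at_top_weakI)
  ultimately have "\<forall>\<^sub>F G in finite_subsets_at_top UNIV.
      dist (\<Sum>x\<in>G. single x (coord f x)) f < e \<and> finite G"
    by (rule eventually_conj)
  then obtain G where "finite G" "dist (\<Sum>x\<in>G. single x (coord f x)) f < e"
    by (metis (no_types, lifting) eventually_happens finite_subsets_at_top_neq_bot)
  then show ?thesis
    by (intro that[of G]) (simp_all add: proj_on_finite ortho_proj_id dist_norm norm_minus_commute)
qed

section \<open>Rank-one operators\<close>

text \<open>The operator |u><v| of Dirac notation. As \<open>cinner\<close> is linear in its first
  argument, the coefficient is \<open>cinner w v\<close>.\<close>

definition butterfly :: "'a::complex_inner_space \<Rightarrow> 'b::complex_inner_space \<Rightarrow> ('b \<Rightarrow>\<^sub>L 'a)" where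
  "butterfly u v = Blinfun (\<lambda>w. cinner w v *\<^sub>C u)"

lemma butterfly_apply: "butterfly u v w = cinner w v *\<^sub>C u"
proof -
  have "bounded_linear (\<lambda>w. cinner w v *\<^sub>C u)"
  proof (rule bounded_linear_intro[of _ "norm v * norm u"])
    show "norm (cinner w v *\<^sub>C u) \<le> norm w * (norm v * norm u)" for w
      unfolding norm_scaleC mult.assoc[symmetric]
      by (intro mult_right_mono cinner_cauchy_schwarz) auto
    show "cinner (r *\<^sub>R w) v *\<^sub>C u = r *\<^sub>R cinner w v *\<^sub>C u" for r w
      unfolding scaleC_of_real[symmetric] by (simp add: cinner_scaleC_left scaleC_scaleC)
  qed (simp add: cinner_add_left scaleC_add_left)
  then show ?thesis
    unfolding butterfly_def by (simp add: bounded_linear_Blinfun_apply)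
qed

lemma clinear_butterfly: "clinear (butterfly u v)"
  by (simp add: clinear_def butterfly_apply cinner_scaleC_left scaleC_scaleC)

lemma norm_butterfly_le: "norm (butterfly u v) \<le> norm u * norm v"
proof (rule norm_blinfun_bound)
  show "norm (butterfly u v w) \<le> norm u * norm v * norm w" for w
    unfolding butterfly_apply norm_scaleC
    using mult_right_mono[OF cinner_cauchy_schwarz[of w v], of "norm u"] by (simp add: mult_ac)
qed simp

lemma blinfun_compose_butterfly: "clinear T \<Longrightarrow> T o\<^sub>L butterfly u v = butterfly (T u) v"
  by (rule blinfun_eqI) (simp add: butterfly_apply clinear_scaleC)

lemma butterfly_compose_butterfly:
  "butterfly u v o\<^sub>L butterfly w z = cinner w v *\<^sub>C butterfly u z"
  by (rule blinfun_eqI) (simp add: butterfly_apply cinner_scaleC_left scaleC_scaleC scaleC_blinfun_apply)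

lemma butterfly_add_left: "butterfly (u + u') v = butterfly u v + butterfly u' v"
  and butterfly_scaleC_left: "butterfly (c *\<^sub>C u) v = c *\<^sub>C butterfly u v"
  by (rule blinfun_eqI, simp add: butterfly_apply scaleC_add_right blinfun.add_left
      scaleC_blinfun_apply scaleC_scaleC mult.commute)+

lemma adj_eqI:
  fixes S T :: "'a::complex_hilbert_space \<Rightarrow>\<^sub>L 'a"
  assumes "\<And>u v. cinner (T u) v = cinner u (S v)" and "clinear T"
  shows "adj T = S"
proof (rule blinfun_eqI)
  fix v
  show "adj T v = S v"
    by (rule cinner_eqI) (metis assms cinner_adj bounded_operators_iff)
qed

lemma adj_butterfly: "adj (butterfly u v) = butterfly v (u::'a::complex_hilbert_space)"
  by (rule adj_eqI)
     (simp_all add: butterfly_apply clinear_butterfly cinner_scaleC_left cinner_scaleC_right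
       flip: cinner_commute)

section \<open>Compact operators\<close>

lemma compact_operatorsI:
  assumes "clinear T" "compact C" "\<And>u. norm u \<le> 1 \<Longrightarrow> T u \<in> C"
  shows "T \<in> compact_operators"
proof -
  have "closure (blinfun_apply T ` cball 0 1) \<subseteq> C"
    using assms by (intro closure_minimal) (auto simp: compact_imp_closed)
  then have "compact (closure (blinfun_apply T ` cball 0 1))"
    using assms(2) closed_closure closed_Int_compact by (metis inf.absorb_iff1)
  then show ?thesis
    using assms(1) by (simp add: compact_operators_def bounded_operators_iff)
qed

lemma compact_operatorsD:
  assumes "T \<in> compact_operators"
  shows "clinear T"
    and "\<exists>C. compact C \<and> (\<forall>u. norm u \<le> r \<longrightarrow> T u \<in> C)"
proof -
  show T: "clinear T"
    using assms by (simp add: compact_operators_def bounded_operators_iff)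
  \<comment> \<open>The scaling factor must be positive whatever the sign of
    \<open>r\<close>.\<close>
  define k where "k = \<bar>r\<bar> + 1"
  have k: "k > 0" "r \<le> k" by (auto simp: k_def)
  let ?C = "closure (blinfun_apply T ` cball 0 1)"
  have "compact ((\<lambda>x. k *\<^sub>R x) ` ?C)"
    using assms by (intro compact_scaling) (simp add: compact_operators_def)
  moreover have "T u \<in> (\<lambda>x. k *\<^sub>R x) ` ?C" if "norm u \<le> r" for u
  proof -
    have "T (u /\<^sub>R k) \<in> ?C"
      using that k by (intro closure_subset[THEN subsetD] imageI) (simp add: field_simps)
    moreover have "T u = k *\<^sub>R T (u /\<^sub>R k)"
      using k by (simp add: blinfun.scaleR_right)
    ultimately show ?thesis by blast
  qed
  ultimately show "\<exists>C. compact C \<and> (\<forall>u. norm u \<le> r \<longrightarrow> T u \<in> C)" by blast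
qed

lemma compact_operators_add:
  assumes "S \<in> compact_operators" "T \<in> compact_operators"
  shows "S + T \<in> compact_operators"
proof -
  obtain C D where "compact C" "\<And>u. norm u \<le> 1 \<Longrightarrow> S u \<in> C" "compact D" "\<And>u. norm u \<le> 1 \<Longrightarrow> T u \<in> D"
    using compact_operatorsD(2)[OF assms(1), of 1] compact_operatorsD(2)[OF assms(2), of 1] by metis
  then show ?thesis
    using compact_operatorsD(1)[OF assms(1)] compact_operatorsD(1)[OF assms(2)]
    by (intro compact_operatorsI[where C = "{x + y |x y. x \<in> C \<and> y \<in> D}"])
       (auto simp: clinear_add compact_sums blinfun.add_left)
qed

lemma compact_operators_compose_left:
  fixes S T :: "'a::complex_inner_space \<Rightarrow>\<^sub>L 'a"
  assumes "clinear S" "T \<in> compact_operators"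
  shows "S o\<^sub>L T \<in> compact_operators"
proof -
  obtain C where "compact C" "\<And>u. norm u \<le> 1 \<Longrightarrow> T u \<in> C"
    using compact_operatorsD(2)[OF assms(2), of 1] by metis
  then show ?thesis
    using assms(1) compact_operatorsD(1)[OF assms(2)]
    by (intro compact_operatorsI[where C = "blinfun_apply S ` C"])
       (auto simp: clinear_compose intro!: compact_continuous_image continuous_intros)
qed

lemma compact_operators_compose_right:
  fixes S T :: "'a::complex_inner_space \<Rightarrow>\<^sub>L 'a"
  assumes "clinear S" "T \<in> compact_operators"
  shows "T o\<^sub>L S \<in> compact_operators"
proof -
  obtain C where C: "compact C" "\<And>u. norm u \<le> norm S \<Longrightarrow> T u \<in> C"
    using compact_operatorsD(2)[OF assms(2), of "norm S"] by metis
  have "norm (S u) \<le> norm S" if "norm u \<le> 1" for u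
    using norm_blinfun[of S u] mult_left_mono[OF that norm_ge_zero, of S] by simp
  then show ?thesis
    using C assms(1) compact_operatorsD(1)[OF assms(2)]
    by (intro compact_operatorsI[where C = C]) (auto simp: clinear_compose)
qed

lemma compact_operators_scaleC:
  fixes T :: "'a::complex_inner_space \<Rightarrow>\<^sub>L 'a"
  assumes "T \<in> compact_operators"
  shows "c *\<^sub>C T \<in> compact_operators"
proof -
  have "c *\<^sub>C T = (c *\<^sub>C id_blinfun) o\<^sub>L T"
    by (rule blinfun_eqI) (simp add: scaleC_blinfun_apply)
  then show ?thesis
    using compact_operators_compose_left[OF _ assms] clinear_scaleC_blinfun[OF clinear_id] by metis
qed

lemma compact_operators_zero: "(0 :: 'a::complex_inner_space \<Rightarrow>\<^sub>L 'a) \<in> compact_operators"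
  by (rule compact_operatorsI[where C = "{0}"]) (auto simp: clinear_zero)

lemma compact_operators_sum:
  "(\<And>i. i \<in> I \<Longrightarrow> T i \<in> compact_operators) \<Longrightarrow> (\<Sum>i\<in>I. T i) \<in> compact_operators"
  by (induction I rule: infinite_finite_induct) (auto simp: compact_operators_zero compact_operators_add)

lemma compact_operators_butterfly:
  fixes u v :: "'a::complex_inner_space"
  shows "butterfly u v \<in> compact_operators"
proof (rule compact_operatorsI[OF clinear_butterfly])
  have "bounded_linear (\<lambda>c. c *\<^sub>C u)"
    by (rule bounded_linear_intro[of _ "norm u"])
       (auto simp: scaleC_add_left norm_scaleC scaleR_conv_of_real scaleC_scaleC simp flip: scaleC_of_real)
  then show "compact ((\<lambda>c. c *\<^sub>C u) ` cball 0 (norm v))"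
    by (intro compact_continuous_image linear_continuous_on) auto
  show "butterfly u v w \<in> (\<lambda>c. c *\<^sub>C u) ` cball 0 (norm v)" if "norm w \<le> 1" for w
  proof -
    have "cmod (cinner w v) \<le> norm v"
      using cinner_cauchy_schwarz[of w v] mult_right_mono[OF that norm_ge_zero, of v] by simp
    then show ?thesis unfolding butterfly_apply by (intro imageI) simp
  qed
qed

text \<open>Otherwise compactness gives a subsequence along which \<open>T (v n)\<close> stays away
  from 0 and converges in norm to some \<open>l\<close>. Moving \<open>T\<close> to the other side
  of the inner product shows that \<open>l\<close> is orthogonal to itself.\<close>

lemma compact_operator_weakly_null:
  fixes T :: "'a::complex_hilbert_space \<Rightarrow>\<^sub>L 'a"
  assumes T: "T \<in> compact_operators" and v: "\<And>n. norm (v n) \<le> r"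
    and w: "\<And>w. (\<lambda>n::nat. cinner (v n) w) \<longlonglongrightarrow> 0"
  shows "(\<lambda>n. T (v n)) \<longlonglongrightarrow> 0"
proof (rule ccontr)
  assume "\<not> (\<lambda>n. T (v n)) \<longlonglongrightarrow> 0"
  then obtain e where e: "e > 0" "\<exists>\<^sub>F n in sequentially. norm (T (v n)) \<ge> e"
    unfolding tendsto_iff by (auto simp: frequently_def not_le)
  then have "infinite {n. norm (T (v n)) \<ge> e}"
    by (simp add: cofinite_eq_sequentially[symmetric] frequently_cofinite)
  then obtain s :: "nat \<Rightarrow> nat" where s: "strict_mono s" "\<And>n. norm (T (v (s n))) \<ge> e"
    using infinite_enumerate by blast
  obtain C where C: "compact C" "\<And>u. norm u \<le> r \<Longrightarrow> T u \<in> C"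
    using compact_operatorsD(2)[OF T, of r] by metis
  have "\<forall>n. T (v (s n)) \<in> C" using C v by blast
  then obtain l q where q: "strict_mono (q :: nat \<Rightarrow> nat)" "((\<lambda>n. T (v (s n))) \<circ> q) \<longlonglongrightarrow> l"
    using C(1) unfolding compact_def by metis
  have lim: "(\<lambda>n. T (v (s (q n)))) \<longlonglongrightarrow> l"
    using q(2) by (simp add: o_def)
  have "(\<lambda>n. cinner (T (v (s (q n)))) l) \<longlonglongrightarrow> cinner l l"
    by (rule tendsto_cinner_left[OF lim])
  moreover have "(\<lambda>n. cinner (T (v (s (q n)))) l) \<longlonglongrightarrow> 0"
  proof -
    have "T \<in> bounded_operators"
      using compact_operatorsD(1)[OF T] by (simp add: bounded_operators_iff)
    then have "cinner (T (v n)) l = cinner (v n) (adj T l)" for n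
      by (rule cinner_adj)
    moreover have "((\<lambda>n. cinner (v n) (adj T l)) \<circ> (s \<circ> q)) \<longlonglongrightarrow> 0"
      by (rule LIMSEQ_subseq_LIMSEQ[OF w strict_mono_o[OF s(1) q(1)]])
    ultimately show ?thesis by (simp add: o_def)
  qed
  ultimately have "l = 0"
    using LIMSEQ_unique by fastforce
  then have "(\<lambda>n. norm (T (v (s (q n))))) \<longlonglongrightarrow> 0"
    using tendsto_norm[OF lim] by simp
  then have "e \<le> 0"
    by (rule LIMSEQ_le_const) (use s in auto)
  then show False using e by simp
qed

section \<open>Isomorphisms are spatially implemented\<close>

text \<open>\<open>adj\<close> is available only for operators of a space into itself, so a unitary
  between two spaces carries along its inverse, which is also its adjoint.\<close>

definition unitary_pair :: "('a::complex_inner_space \<Rightarrow>\<^sub>L 'b::complex_inner_space) \<Rightarrow> ('b \<Rightarrow>\<^sub>L 'a) \<Rightarrow> bool" where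
  "unitary_pair U V \<longleftrightarrow> clinear U \<and> clinear V \<and> (\<forall>u. V (U u) = u) \<and> (\<forall>v. U (V v) = v) \<and>
     (\<forall>u v. cinner (U u) v = cinner u (V v))"

lemma unitary_pairD:
  assumes "unitary_pair U V"
  shows "clinear U" "clinear V" "V (U u) = u" "U (V v) = v"
    "cinner (U u) v = cinner u (V v)" "cinner (V v) u = cinner v (U u)"
    "norm (U u) = norm u" "norm (V v) = norm v"
proof -
  show *: "clinear U" "clinear V" "V (U u) = u" "U (V v) = v"
    "\<And>u v. cinner (U u) v = cinner u (V v)" for u v
    using assms by (auto simp: unitary_pair_def)
  show **: "cinner (V v) u = cinner v (U u)" for u v
    using *(5)[of u v] by (metis cinner_commute)
  show "norm (U u) = norm u" by (rule isometry_norm) (simp add: * )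
  show "norm (V v) = norm v" by (rule isometry_norm) (simp add: * **)
qed

lemma unitary_pair_sym: assumes "unitary_pair U V" shows "unitary_pair V U"
  unfolding unitary_pair_def by (intro conjI allI unitary_pairD[OF assms])

lemma unitary_pair_of_isometry:
  fixes U0 :: "'a::complex_inner_space \<Rightarrow> 'b::complex_inner_space"
  assumes add: "\<And>v w. U0 (v + w) = U0 v + U0 w" and scale: "\<And>c v. U0 (c *\<^sub>C v) = c *\<^sub>C U0 v"
    and cinner: "\<And>v w. cinner (U0 v) (U0 w) = cinner v w" and surj: "\<And>w. \<exists>v. U0 v = w"
  obtains U V where "unitary_pair U V" "\<And>v. U v = U0 v"
proof -
  have U_norm: "norm (U0 v) = norm v" for v
    using cinner[of v v] unfolding cinner_self of_real_eq_iff
    by (intro power2_eq_imp_eq[of "norm (U0 v)"]) auto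
  have inj: "v = w" if "U0 v = U0 w" for v w
  proof -
    have "U0 (v - w) = 0" using add[of "v - w" w] that by simp
    then show ?thesis using U_norm[of "v - w"] by simp
  qed
  define V0 where "V0 = inv U0"
  have UV: "U0 (V0 w) = w" for w
    unfolding V0_def by (rule surj_f_inv_f) (metis surj surj_def)
  have VU: "V0 (U0 v) = v" for v by (rule inj) (simp add: UV)
  have V_norm: "norm (V0 w) = norm w" for w using U_norm[of "V0 w"] UV[of w] by simp
  have V_add: "V0 (v + w) = V0 v + V0 w" for v w by (rule inj) (simp add: UV add)
  have V_scale: "V0 (c *\<^sub>C v) = c *\<^sub>C V0 v" for c v by (rule inj) (simp add: UV scale)
  have "bounded_linear U0" "bounded_linear V0"
    using scale[of "complex_of_real _"] V_scale[of "complex_of_real _"]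
    by (auto intro!: bounded_linear_intro[of _ 1] simp: add V_add U_norm V_norm scaleC_of_real)
  then have U: "\<And>v. Blinfun U0 v = U0 v" and V: "\<And>v. Blinfun V0 v = V0 v"
    by (simp_all add: bounded_linear_Blinfun_apply)
  have "unitary_pair (Blinfun U0) (Blinfun V0)"
    unfolding unitary_pair_def
    using cinner[of _ "V0 _"] by (auto simp: clinear_def U V scale V_scale UV VU)
  then show ?thesis by (rule that) (rule U)
qed

text \<open>
  An isomorphism maps the minimal projection onto a unit vector \<open>e\<close> to a minimal projection,
  necessarily of rank one; if \<open>\<xi>\<close> spans its range, \<open>v \<mapsto> \<Phi>(\<bar>v\<rangle>\<langle>e\<bar>) \<xi>\<close> is the implementing unitary.
\<close>

lemma star_isomorphic_imp_unitary_pair: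
  fixes A :: "('a::complex_hilbert_space \<Rightarrow>\<^sub>L 'a) set" and B :: "('b::complex_hilbert_space \<Rightarrow>\<^sub>L 'b) set"
    and e :: 'a
  assumes iso: "star_isomorphic A B"
    and A: "A \<subseteq> Collect clinear" "\<And>u v. butterfly u v \<in> A"
    and B: "B \<subseteq> Collect clinear" "\<And>u v. butterfly u v \<in> B"
    and e: "norm e = 1"
  shows "\<exists>U V. unitary_pair U V \<and> (\<forall>T\<in>A. U o\<^sub>L T o\<^sub>L V \<in> B) \<and> (\<forall>T\<in>B. V o\<^sub>L T o\<^sub>L U \<in> A)"
proof -
  from iso[unfolded star_isomorphic_def] obtain \<Phi> where bij: "bij_betw \<Phi> A B"
    and "\<forall>S\<in>A. \<forall>T\<in>A. \<Phi> (S + T) = \<Phi> S + \<Phi> T"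
    and "\<forall>c. \<forall>T\<in>A. \<Phi> (c *\<^sub>C T) = c *\<^sub>C \<Phi> T"
    and "\<forall>S\<in>A. \<forall>T\<in>A. \<Phi> (S o\<^sub>L T) = \<Phi> S o\<^sub>L \<Phi> T"
    and "\<forall>T\<in>A. \<Phi> (adj T) = adj (\<Phi> T)"
    by (elim exE conjE)
  then have add: "\<Phi> (S + T) = \<Phi> S + \<Phi> T"
    and scale: "\<Phi> (c *\<^sub>C T) = c *\<^sub>C \<Phi> T"
    and mult: "\<Phi> (S o\<^sub>L T) = \<Phi> S o\<^sub>L \<Phi> T"
    and adj: "\<Phi> (adj T) = adj (\<Phi> T)" if "S \<in> A" "T \<in> A" for S T c
    using that by simp_all
  have AB: "\<Phi> T \<in> B" if "T \<in> A" for T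
    using bij that by (auto simp: bij_betw_def)
  have BA: "\<exists>S\<in>A. \<Phi> S = T" if "T \<in> B" for T
    using bij that by (auto simp: bij_betw_def)
  have lin: "clinear T" if "T \<in> A" for T using A(1) that by auto
  have lin': "clinear T" if "T \<in> B" for T using B(1) that by auto
  have ee: "cinner e e = 1" using e by (simp add: cinner_self)
  define p where "p = butterfly e e"
  define q where "q = \<Phi> p"
  have p: "p \<in> A" by (simp add: p_def A)
  have q: "q \<in> B" unfolding q_def by (rule AB[OF p])
  have q_idem: "q (q v) = q v" for v
  proof -
    have "p o\<^sub>L p = p" unfolding p_def butterfly_compose_butterfly ee by simp
    then have "q o\<^sub>L q = q" unfolding q_def using mult[OF p p] by simp
    then show ?thesis by (metis blinfun_apply_blinfun_compose)
  qed
  have q_adj: "cinner (q u) v = cinner u (q v)" for u v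
  proof -
    have "adj q = q" unfolding q_def adj[OF p p, symmetric] by (simp add: p_def adj_butterfly)
    then show ?thesis
      using cinner_adj[of q u v] lin'[OF q] by (simp add: bounded_operators_iff)
  qed
  \<comment> \<open>Injectivity of \<Phi>: it sends 0 to 0, and \<open>p\<close> is not 0.\<close>
  have "q \<noteq> 0"
  proof
    assume "q = 0"
    have "\<Phi> (0 *\<^sub>C p) = 0" using scale[OF p p, of 0] by simp
    then have "\<Phi> 0 = \<Phi> p" using \<open>q = 0\<close> by (simp add: q_def)
    moreover have "0 \<in> A" using A(2)[of 0 0] by (simp add: butterfly_def zero_blinfun_def)
    ultimately have "p = 0" using bij p by (auto simp: bij_betw_def inj_on_def)
    then have "p e = 0" by simp
    then show False using e by (auto simp: p_def butterfly_apply ee)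
  qed
  then obtain u0 where u0: "q u0 \<noteq> 0" by (metis blinfun_eqI zero_blinfun.rep_eq)
  define \<xi> where "\<xi> = q u0 /\<^sub>R norm (q u0)"
  have \<xi>: "norm \<xi> = 1" "q \<xi> = \<xi>" "cinner \<xi> \<xi> = 1"
    using u0 by (auto simp: \<xi>_def blinfun.scaleR_right q_idem cinner_self)
  \<comment> \<open>Minimality of \<open>p\<close> is transported: \<open>p S p\<close> is a scalar
    multiple of \<open>p\<close> for every \<open>S\<close>. For the preimage \<open>S\<close> of
    the projection onto \<xi>, this makes that projection a multiple of \<open>q\<close>, and
    evaluation at \<xi> shows that the scalar is 1.\<close>
  have q_eq: "q = butterfly \<xi> \<xi>"
  proof -
    obtain S where S: "S \<in> A" "\<Phi> S = butterfly \<xi> \<xi>" using BA[OF B(2)] by blast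
    have pS: "p o\<^sub>L (S o\<^sub>L p) = cinner (S e) e *\<^sub>C p"
      by (rule blinfun_eqI)
         (simp add: p_def butterfly_apply scaleC_blinfun_apply clinear_scaleC[OF lin[OF S(1)]]
           cinner_scaleC_left scaleC_scaleC mult.commute)
    have Sp: "S o\<^sub>L p \<in> A"
      unfolding p_def blinfun_compose_butterfly[OF lin[OF S(1)]] by (rule A)
    have "q o\<^sub>L (butterfly \<xi> \<xi> o\<^sub>L q) = cinner (S e) e *\<^sub>C q"
      using scale[OF p p, of "cinner (S e) e"] unfolding pS[symmetric] q_def S(2)[symmetric]
      by (simp add: mult[OF p Sp] mult[OF S(1) p])
    moreover have "q o\<^sub>L (butterfly \<xi> \<xi> o\<^sub>L q) = butterfly \<xi> \<xi>"
      by (rule blinfun_eqI)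
         (simp add: butterfly_apply clinear_scaleC[OF lin'[OF q]] \<xi> q_adj)
    ultimately have b: "butterfly \<xi> \<xi> = cinner (S e) e *\<^sub>C q" by simp
    then have "butterfly \<xi> \<xi> \<xi> = cinner (S e) e *\<^sub>C q \<xi>" by (simp add: scaleC_blinfun_apply)
    then have "\<xi> = cinner (S e) e *\<^sub>C \<xi>" by (simp add: butterfly_apply \<xi>)
    then have "cinner \<xi> \<xi> = cinner (S e) e * cinner \<xi> \<xi>" by (metis cinner_scaleC_left)
    then have "cinner (S e) e = 1" by (simp add: \<xi>)
    then show ?thesis using b by simp
  qed
  define U0 where "U0 v = \<Phi> (butterfly v e) \<xi>" for v
  have U0_cinner: "cinner (U0 v) (U0 w) = cinner v w" for v w
  proof -
    have "cinner (U0 v) (U0 w) = cinner (adj (\<Phi> (butterfly w e)) (\<Phi> (butterfly v e) \<xi>)) \<xi>"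
    proof -
      have "cinner (\<Phi> (butterfly w e) \<xi>) (\<Phi> (butterfly v e) \<xi>) =
          cinner \<xi> (adj (\<Phi> (butterfly w e)) (\<Phi> (butterfly v e) \<xi>))"
        by (rule cinner_adj) (simp add: bounded_operators_iff lin' AB A)
      then show ?thesis unfolding U0_def by (metis cinner_commute)
    qed
    also have "adj (\<Phi> (butterfly w e)) (\<Phi> (butterfly v e) \<xi>) = \<Phi> (butterfly e w o\<^sub>L butterfly v e) \<xi>"
      by (simp add: mult A adj_butterfly adj[symmetric, OF A(2) A(2)])
    also have "\<dots> = cinner v w *\<^sub>C \<xi>"
      unfolding butterfly_compose_butterfly
      using scale[OF p p] \<xi>(2) by (simp add: p_def[symmetric] q_def scaleC_blinfun_apply)
    finally show ?thesis by (simp add: cinner_scaleC_left \<xi>)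
  qed
  have U0_add: "U0 (v + w) = U0 v + U0 w" for v w
    by (simp add: U0_def butterfly_add_left add A blinfun.add_left)
  have U0_scale: "U0 (c *\<^sub>C v) = c *\<^sub>C U0 v" for c v
    by (simp add: U0_def butterfly_scaleC_left scale[OF A(2) A(2)] scaleC_blinfun_apply)
  have U0_intertwine: "U0 (T v) = \<Phi> T (U0 v)" if "T \<in> A" for T v
    using mult[OF that A(2), of v e] by (simp add: U0_def blinfun_compose_butterfly lin that)
  have U0_surj: "\<exists>v. U0 v = w" for w
  proof -
    \<comment> \<open>The rank-one operator taking \<xi> to \<open>w\<close> lies in
      \<open>B\<close>; its preimage applied to \<open>e\<close> is the vector sought.\<close>
    obtain S where S: "S \<in> A" "\<Phi> S = butterfly w \<xi>" using BA[OF B(2)] by blast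
    have "U0 e = \<xi>" using \<xi> by (simp add: U0_def p_def[symmetric] q_def[symmetric])
    then have "U0 (S e) = w"
      using U0_intertwine[OF S(1), of e] S(2) by (simp add: butterfly_apply \<xi>)
    then show ?thesis by blast
  qed
  obtain U V where UV: "unitary_pair U V" and U: "\<And>v. U v = U0 v"
    by (rule unitary_pair_of_isometry[of U0]) (auto simp: U0_add U0_scale U0_cinner U0_surj)
  have "U o\<^sub>L T o\<^sub>L V \<in> B" if "T \<in> A" for T
  proof -
    have "U (T v) = \<Phi> T (U v)" for v using U0_intertwine[OF that] by (simp add: U)
    then have "U o\<^sub>L T o\<^sub>L V = \<Phi> T"
      by (intro blinfun_eqI) (simp add: unitary_pairD[OF UV])
    then show ?thesis using AB[OF that] by simp
  qed
  moreover have "V o\<^sub>L T o\<^sub>L U \<in> A" if "T \<in> B" for T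
  proof -
    obtain S where S: "S \<in> A" "\<Phi> S = T" using BA[OF \<open>T \<in> B\<close>] by blast
    have "T (U v) = U (S v)" for v
      using U0_intertwine[OF S(1)] by (simp add: U S)
    then have "V o\<^sub>L T o\<^sub>L U = S"
      by (intro blinfun_eqI) (simp add: unitary_pairD[OF UV])
    then show ?thesis using S by simp
  qed
  ultimately show ?thesis using UV by (intro exI[of _ U] exI[of _ V]) simp
qed

lemma unitary_pair_imp_star_isomorphic:
  fixes A :: "('a::complex_hilbert_space \<Rightarrow>\<^sub>L 'a) set" and B :: "('b::complex_hilbert_space \<Rightarrow>\<^sub>L 'b) set"
  assumes UV: "unitary_pair U V"
    and A: "A \<subseteq> Collect clinear"
    and AB: "\<And>T. T \<in> A \<Longrightarrow> U o\<^sub>L T o\<^sub>L V \<in> B" and BA: "\<And>T. T \<in> B \<Longrightarrow> V o\<^sub>L T o\<^sub>L U \<in> A"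
  shows "star_isomorphic A B"
proof -
  note D = unitary_pairD[OF UV]
  let ?\<Phi> = "\<lambda>T. U o\<^sub>L T o\<^sub>L V"
  have 1: "V o\<^sub>L (U o\<^sub>L T o\<^sub>L V) o\<^sub>L U = T" for T by (rule blinfun_eqI) (simp add: D)
  have 2: "U o\<^sub>L (V o\<^sub>L T o\<^sub>L U) o\<^sub>L V = T" for T by (rule blinfun_eqI) (simp add: D)
  have b1: "bij_betw ?\<Phi> A B"
    by (rule bij_betwI[where g = "\<lambda>T. V o\<^sub>L T o\<^sub>L U"]) (auto simp: 1 2 AB BA)
  have b2: "?\<Phi> (S + T) = ?\<Phi> S + ?\<Phi> T" for S T
    by (rule blinfun_eqI) (simp add: blinfun.add_left blinfun.add_right)
  have b3: "?\<Phi> (c *\<^sub>C T) = c *\<^sub>C ?\<Phi> T" for c T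
    by (rule blinfun_eqI) (simp add: scaleC_blinfun_apply clinear_scaleC[OF D(1)])
  have b4: "?\<Phi> (S o\<^sub>L T) = ?\<Phi> S o\<^sub>L ?\<Phi> T" for S T
    by (rule blinfun_eqI) (simp add: D)
  have b5: "?\<Phi> (adj T) = adj (?\<Phi> T)" if "T \<in> A" for T
  proof (rule adj_eqI[symmetric])
    have T: "clinear T" using A that by auto
    then show "clinear (?\<Phi> T)" using D by (intro clinear_compose) auto
    show "cinner (?\<Phi> T u) v = cinner u (?\<Phi> (adj T) v)" for u v
      using T cinner_adj[of T "V u" "V v"] by (simp add: D bounded_operators_iff)
  qed
  show ?thesis
    unfolding star_isomorphic_def by (intro exI[of _ ?\<Phi>] conjI ballI allI b1 b2 b3 b4 b5)
qed

section \<open>Filtered Roe algebras\<close>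

text \<open>
  The constant sequence \<open>P n = 1\<close> gives the Roe algebra; the projections \<open>P n\<close> onto the span of the
  first \<open>n\<close> vectors of an orthonormal basis give the stabilised uniform Roe algebra.
\<close>

definition controlled ::
    "(nat \<Rightarrow> 'h::complex_hilbert_space \<Rightarrow>\<^sub>L 'h) \<Rightarrow> nat
     \<Rightarrow> (('x::metric_space, 'h) ell2 \<Rightarrow>\<^sub>L ('x, 'h) ell2) set" where
  "controlled P n = {T. clinear T \<and> (\<forall>x y. matrix_entry T x y \<in> compact_operators \<and>
     (matrix_entry T x y \<noteq> 0 \<longrightarrow> dist x y \<le> real n) \<and>
     P n o\<^sub>L matrix_entry T x y = matrix_entry T x y \<and>
     matrix_entry T x y o\<^sub>L P n = matrix_entry T x y)}"

definition filtered_roe ::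
    "(nat \<Rightarrow> 'h::complex_hilbert_space \<Rightarrow>\<^sub>L 'h)
     \<Rightarrow> (('x::metric_space, 'h) ell2 \<Rightarrow>\<^sub>L ('x, 'h) ell2) set" where
  "filtered_roe P = closure (\<Union>n. controlled P n)"

lemma matrix_entry_apply: "matrix_entry T x y v = coord (T (single y v)) x"
  by transfer simp

lemma clinear_closed: "closed {T :: 'a::complex_inner_space \<Rightarrow>\<^sub>L 'b::complex_inner_space. clinear T}"
proof -
  have "closed {T :: 'a \<Rightarrow>\<^sub>L 'b. T (c *\<^sub>C u) = c *\<^sub>C T u}" for c u
    by (intro closed_Collect_eq continuous_intros
        continuous_on_compose2[OF linear_continuous_on[OF bounded_linear_scaleC, of UNIV]]) auto
  then show ?thesis
    unfolding clinear_def by (intro closed_Collect_all) 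
qed

lemma filtered_roe_clinear: "filtered_roe P \<subseteq> Collect clinear"
  unfolding filtered_roe_def
  by (intro closure_minimal clinear_closed) (auto simp: controlled_def)

lemma filtered_roe_approx:
  assumes "T \<in> filtered_roe P" "e > 0"
  obtains n S where "S \<in> controlled P n" "norm (T - S) < e"
  using assms unfolding filtered_roe_def closure_approachable
  by (metis UN_iff dist_norm norm_minus_commute)

lemma controlled_clinear: "T \<in> controlled P n \<Longrightarrow> clinear T"
  by (simp add: controlled_def)

lemma controlled_compact: "T \<in> controlled P n \<Longrightarrow> matrix_entry T x y \<in> compact_operators"
  by (simp add: controlled_def)

lemma controlled_propagation:
  assumes "T \<in> controlled P n" "dist x y > real n"
  shows "coord (T (single y v)) x = 0"
proof -
  have "matrix_entry T x y = 0" using assms by (force simp: controlled_def)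
  then show ?thesis by (simp flip: matrix_entry_apply)
qed

lemma controlledI:
  fixes P :: "nat \<Rightarrow> 'h::complex_hilbert_space \<Rightarrow>\<^sub>L 'h"
    and T :: "('x::metric_space, 'h) ell2 \<Rightarrow>\<^sub>L ('x, 'h) ell2"
  assumes "clinear T" "\<And>x y. matrix_entry T x y \<in> compact_operators"
    and "\<And>x y v. dist x y > real n \<Longrightarrow> coord (T (single y v)) x = 0"
    and "\<And>x y v. P n (coord (T (single y v)) x) = coord (T (single y v)) x"
    and "\<And>x y v. coord (T (single y (P n v))) x = coord (T (single y v)) x"
  shows "T \<in> controlled P n"
proof -
  have "matrix_entry T x y = 0" if "dist x y > real n" for x y
    by (rule blinfun_eqI) (simp add: matrix_entry_apply assms(3) that)
  then show ?thesis
    using assms(1,2) unfolding controlled_def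
    by (auto intro!: blinfun_eqI simp: matrix_entry_apply assms(4,5) intro: leI)
qed

lemma controlled_compose:
  fixes P :: "nat \<Rightarrow> 'h::complex_hilbert_space \<Rightarrow>\<^sub>L 'h"
    and T :: "('x::metric_space, 'h) ell2 \<Rightarrow>\<^sub>L ('x, 'h) ell2"
  assumes "T \<in> controlled P n"
  shows "P n (coord (T (single y v)) x) = coord (T (single y v)) x"
    and "coord (T (single y (P n v))) x = coord (T (single y v)) x"
proof -
  have "(P n o\<^sub>L matrix_entry T x y) v = matrix_entry T x y v"
    "(matrix_entry T x y o\<^sub>L P n) v = matrix_entry T x y v"
    using assms by (simp_all add: controlled_def)
  then show "P n (coord (T (single y v)) x) = coord (T (single y v)) x"
    "coord (T (single y (P n v))) x = coord (T (single y v)) x"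
    by (simp_all add: matrix_entry_apply)
qed

lemma matrix_entry_add: "matrix_entry (S + T) x y = matrix_entry S x y + matrix_entry T x y"
  by (rule blinfun_eqI) (simp add: matrix_entry_apply blinfun.add_left)

lemma matrix_entry_scaleC: "matrix_entry (c *\<^sub>C T) x y = c *\<^sub>C matrix_entry T x y"
  by (rule blinfun_eqI) (simp add: matrix_entry_apply scaleC_blinfun_apply)

text \<open>Composing with the projection onto the point \<open>x\<close> isolates one row, an
  operator whose columns vanish off a finite ball.\<close>

lemma controlled_coord_sum:
  fixes T :: "('x::metric_space, 'h::complex_hilbert_space) ell2 \<Rightarrow>\<^sub>L ('x, 'h) ell2"
  assumes T: "T \<in> controlled P n" and fin: "finite (cball x (real n))"
  shows "coord (T f) x = (\<Sum>y\<in>cball x (real n). matrix_entry T x y (coord f y))"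
proof -
  let ?S = "proj_on {x} id_blinfun o\<^sub>L T"
  have S: "?S g = single x (coord (T g) x)" for g
    by (simp add: proj_on_single ortho_proj_id)
  have "?S f = (\<Sum>y\<in>cball x (real n). ?S (single y (coord f y)))"
    by (rule blinfun_ell2_finite[OF fin]) (simp add: S controlled_propagation[OF T] del: blinfun_apply_blinfun_compose)
  then have "coord (?S f) x = coord (\<Sum>y\<in>cball x (real n). ?S (single y (coord f y))) x"
    by (rule arg_cong)
  then show ?thesis unfolding S by (simp add: coord_sum coord_single matrix_entry_apply)
qed

lemma controlled_butterfly:
  fixes P :: "nat \<Rightarrow> 'h::complex_hilbert_space \<Rightarrow>\<^sub>L 'h" and b b' :: "('x::metric_space, 'h) ell2"
  assumes b: "\<And>x. P n (coord b x) = coord b x" "\<And>x. P n (coord b' x) = coord b' x"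
    and P: "ortho_proj (P n)"
    and d: "\<And>x y. coord b' x \<noteq> 0 \<Longrightarrow> coord b y \<noteq> 0 \<Longrightarrow> dist x y \<le> real n"
  shows "butterfly b' b \<in> controlled P n"
proof (rule controlledI)
  have c: "coord (butterfly b' b (single y v)) x = cinner v (coord b y) *\<^sub>C coord b' x" for x y v
    by (simp add: butterfly_apply cinner_single_left)
  have "matrix_entry (butterfly b' b) x y = butterfly (coord b' x) (coord b y)" for x y
    by (rule blinfun_eqI) (simp only: matrix_entry_apply c, simp add: butterfly_apply)
  then show "matrix_entry (butterfly b' b) x y \<in> compact_operators" for x y
    by (simp add: compact_operators_butterfly)
  show "coord (butterfly b' b (single y v)) x = 0" if "dist x y > real n" for x y v
    using d[of x y] that unfolding c by (cases "coord b y = 0") auto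
  show "P n (coord (butterfly b' b (single y v)) x) = coord (butterfly b' b (single y v)) x" for x y v
    by (simp add: c clinear_scaleC[OF ortho_proj_clinear[OF P]] b)
  show "coord (butterfly b' b (single y (P n v))) x = coord (butterfly b' b (single y v)) x" for x y v
    by (simp add: c ortho_proj_cinner[OF P] b)
qed (rule clinear_butterfly)

section \<open>Filtrations of the fibre and closure properties of the algebras\<close>

text \<open>Strong convergence to the identity is what puts every rank-one operator into the
  closure, as the recovery of a unitary requires.\<close>

locale filtration =
  fixes P :: "nat \<Rightarrow> 'h::complex_hilbert_space \<Rightarrow>\<^sub>L 'h"
  assumes proj: "ortho_proj (P n)"
    and mono: "m \<le> n \<Longrightarrow> P n (P m u) = P m u"
    and strong: "(\<lambda>n. P n u) \<longlonglongrightarrow> u"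
begin

text \<open>The adjoint of \<open>mono\<close>, the projections being self-adjoint.\<close>

lemma mono': "m \<le> n \<Longrightarrow> P m (P n u) = P m u"
proof (rule cinner_eqI)
  fix v assume "m \<le> n"
  have "cinner v (P m (P n u)) = cinner (P n (P m v)) u"
    by (simp add: ortho_proj_cinner[OF proj])
  also have "\<dots> = cinner v (P m u)"
    using mono[OF \<open>m \<le> n\<close>] by (simp add: ortho_proj_cinner[OF proj])
  finally show "cinner v (P m (P n u)) = cinner v (P m u)" .
qed

lemma controlled_mono:
  assumes T: "T \<in> controlled P m" and mn: "m \<le> n"
  shows "T \<in> controlled P n"
proof (rule controlledI)
  show "clinear T" "\<And>x y. matrix_entry T x y \<in> compact_operators"
    using T by (simp_all add: controlled_def)
  show "coord (T (single y v)) x = 0" if "dist x y > real n" for x y v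
    using controlled_propagation[OF T, of x y v] that mn by force
  show "P n (coord (T (single y v)) x) = coord (T (single y v)) x" for x y v
    using mono[OF mn, of "coord (T (single y v)) x"] by (simp add: controlled_compose(1)[OF T])
  show "coord (T (single y (P n v))) x = coord (T (single y v)) x" for x y v
    using controlled_compose(2)[OF T, of y "P n v" x] controlled_compose(2)[OF T, of y v x]
    by (simp add: mono'[OF mn])
qed

lemma controlled_add:
  assumes "S \<in> controlled P n" "T \<in> controlled P n"
  shows "S + T \<in> controlled P n"
  using assms
  by (intro controlledI)
     (auto simp: controlled_clinear clinear_add matrix_entry_add compact_operators_add controlled_compact
       blinfun.add_left blinfun.add_right controlled_propagation controlled_compose)

lemma controlled_scaleC:
  assumes "T \<in> controlled P n"
  shows "c *\<^sub>C T \<in> controlled P n"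
  using assms
  by (intro controlledI)
     (auto simp: controlled_clinear clinear_scaleC_blinfun matrix_entry_scaleC compact_operators_scaleC
       controlled_compact scaleC_blinfun_apply controlled_propagation controlled_compose
       clinear_scaleC[OF ortho_proj_clinear[OF proj]])

lemma filtered_roe_add:
  assumes "S \<in> filtered_roe P" "T \<in> filtered_roe P"
  shows "S + T \<in> filtered_roe P"
proof -
  obtain s t where st: "\<And>n. s n \<in> (\<Union>n. controlled P n)" "s \<longlonglongrightarrow> S"
    "\<And>n. t n \<in> (\<Union>n. controlled P n)" "t \<longlonglongrightarrow> T"
    using assms unfolding filtered_roe_def closure_sequential by metis
  have "s n + t n \<in> (\<Union>n. controlled P n)" for n
  proof -
    obtain i j where ij: "s n \<in> controlled P i" "t n \<in> controlled P j" using st by blast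
    then have "s n + t n \<in> controlled P (max i j)"
      by (intro controlled_add controlled_mono[of _ _ "max i j"]) auto
    then show ?thesis by blast
  qed
  then show ?thesis
    unfolding filtered_roe_def closure_sequential
    by (intro exI[of _ "\<lambda>n. s n + t n"] conjI allI tendsto_add st)
qed

lemma filtered_roe_scaleC:
  fixes T :: "('x::metric_space, 'h) ell2 \<Rightarrow>\<^sub>L ('x, 'h) ell2"
  assumes "T \<in> filtered_roe P"
  shows "c *\<^sub>C T \<in> filtered_roe P"
proof -
  have "(\<lambda>T :: ('x, 'h) ell2 \<Rightarrow>\<^sub>L ('x, 'h) ell2. c *\<^sub>C T) ` closure (\<Union>n. controlled P n) \<subseteq> closure (\<Union>n. controlled P n)"
  proof (rule image_closure_subset)
    have "bounded_linear (\<lambda>T. c *\<^sub>C (T :: ('x, 'h) ell2 \<Rightarrow>\<^sub>L ('x, 'h) ell2))"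
      by (rule bounded_linear_intro[of _ "cmod c"])
         (auto simp: scaleC_add_right scaleC_scaleC norm_scaleC_blinfun_le mult.commute
           order_trans[OF norm_scaleC_blinfun_le] simp flip: scaleC_of_real)
    then show "continuous_on (closure (\<Union>n. controlled P n))
        (\<lambda>T. c *\<^sub>C (T :: ('x, 'h) ell2 \<Rightarrow>\<^sub>L ('x, 'h) ell2))"
      by (rule linear_continuous_on)
    show "(\<lambda>T. c *\<^sub>C T) ` (\<Union>n. controlled P n) \<subseteq> closure (\<Union>n. controlled P n)"
      by (intro order_trans[OF _ closure_subset]) (auto intro: controlled_scaleC)
  qed auto
  then show ?thesis using assms unfolding filtered_roe_def by auto
qed

lemma filtered_roe_zero: "(0 :: ('x::metric_space, 'h) ell2 \<Rightarrow>\<^sub>L ('x, 'h) ell2) \<in> filtered_roe P"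
proof -
  have "butterfly 0 0 \<in> (controlled P 0 :: (('x, 'h) ell2 \<Rightarrow>\<^sub>L ('x, 'h) ell2) set)"
    by (rule controlled_butterfly) (auto simp: proj)
  moreover have "butterfly 0 0 = (0 :: ('x, 'h) ell2 \<Rightarrow>\<^sub>L ('x, 'h) ell2)"
    by (rule blinfun_eqI) (simp add: butterfly_apply)
  ultimately show ?thesis
    unfolding filtered_roe_def by (intro closure_subset[THEN subsetD]) auto
qed

text \<open>Cutting down to an arbitrary subset costs no propagation. This allows a set glued from
  infinitely many pieces to be used as a multiplier.\<close>

lemma proj_on_compose_controlled:
  assumes T: "T \<in> controlled P n"
  shows "proj_on A (P m) o\<^sub>L T \<in> controlled P (max m n)"
proof (rule controlledI)
  note T' = controlled_mono[OF T max.cobounded2[of n m]]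
  have c: "coord ((proj_on A (P m) o\<^sub>L T) f) x = (if x \<in> A then P m (coord (T f) x) else 0)" for f x
    by (simp add: coord_proj_on[OF proj])
  show "clinear (proj_on A (P m) o\<^sub>L T)"
    by (intro clinear_compose controlled_clinear[OF T] ortho_proj_clinear ortho_proj_proj_on proj)
  have "matrix_entry (proj_on A (P m) o\<^sub>L T) x y = (if x \<in> A then P m o\<^sub>L matrix_entry T x y else 0)" for x y
    by (rule blinfun_eqI) (simp add: matrix_entry_apply coord_proj_on[OF proj])
  then show "matrix_entry (proj_on A (P m) o\<^sub>L T) x y \<in> compact_operators" for x y
    by (simp add: compact_operators_zero compact_operators_compose_left controlled_compact[OF T]
        ortho_proj_clinear[OF proj])
  show "coord ((proj_on A (P m) o\<^sub>L T) (single y v)) x = 0" if "dist x y > real (max m n)" for x y v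
    unfolding c using controlled_propagation[OF T', of x y v] that by (simp add: max.commute)
  show "P (max m n) (coord ((proj_on A (P m) o\<^sub>L T) (single y v)) x) =
      coord ((proj_on A (P m) o\<^sub>L T) (single y v)) x" for x y v
    unfolding c by (simp add: mono)
  show "coord ((proj_on A (P m) o\<^sub>L T) (single y (P (max m n) v))) x =
      coord ((proj_on A (P m) o\<^sub>L T) (single y v)) x" for x y v
    unfolding c using controlled_compose(2)[OF T', of y v x] by (simp add: max.commute)
qed

lemma proj_on_compose_filtered_roe:
  fixes T :: "('x::metric_space, 'h) ell2 \<Rightarrow>\<^sub>L ('x, 'h) ell2"
  assumes "T \<in> filtered_roe P"
  shows "proj_on A (P m) o\<^sub>L T \<in> filtered_roe P"
proof -
  have "(\<lambda>T :: ('x, 'h) ell2 \<Rightarrow>\<^sub>L ('x, 'h) ell2. proj_on A (P m) o\<^sub>L T) ` closure (\<Union>n. controlled P n) \<subseteq> closure (\<Union>n. controlled P n)"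
  proof (rule image_closure_subset)
    show "continuous_on (closure (\<Union>n. controlled P n))
        (\<lambda>T :: ('x, 'h) ell2 \<Rightarrow>\<^sub>L ('x, 'h) ell2. proj_on A (P m) o\<^sub>L T)"
      by (intro continuous_intros)
    show "(\<lambda>T. proj_on A (P m) o\<^sub>L T) ` (\<Union>n. controlled P n) \<subseteq> closure (\<Union>n. controlled P n)"
      by (intro order_trans[OF _ closure_subset]) (auto dest: proj_on_compose_controlled)
  qed auto
  then show ?thesis using assms unfolding filtered_roe_def by auto
qed

lemma eventually_proj_on_approx:
  fixes u :: "('x, 'h) ell2"
  assumes "e > 0"
  obtains G where "finite G" "\<forall>\<^sub>F n in sequentially. norm (u - proj_on G (P n) u) < e"
proof -
  obtain G where G: "finite G" "norm (u - proj_on G id_blinfun u) < e"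
    using finite_tail[OF assms] by blast
  have s: "bounded_linear (single x :: 'h \<Rightarrow> ('x, 'h) ell2)" for x by (rule bounded_linear_single)
  have "(\<lambda>n. norm (u - proj_on G (P n) u)) \<longlonglongrightarrow> norm (u - proj_on G id_blinfun u)"
    unfolding proj_on_finite[OF proj G(1)] proj_on_finite[OF ortho_proj_id G(1)]
    unfolding id_blinfun.rep_eq id_apply
    by (intro tendsto_norm tendsto_diff tendsto_const tendsto_sum bounded_linear.tendsto[OF s] strong)
  then show ?thesis using that[OF G(1)] order_tendstoD(2) G(2) by blast
qed

lemma butterfly_in_filtered_roe: "butterfly u v \<in> filtered_roe P"
  unfolding filtered_roe_def closure_approachable
proof (intro allI impI)
  fix e :: real assume e: "e > 0"
  \<comment> \<open>Two error terms cost at most \<open>d * norm v\<close> and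
    \<open>norm u * d\<close>, together at most e/2; the added 1 covers two zero vectors.\<close>
  define d where "d = e / (2 * (norm u + norm v + 1))"
  have d: "d > 0" using e by (simp add: d_def add_nonneg_pos)
  obtain G H where G: "finite G" "\<forall>\<^sub>F n in sequentially. norm (u - proj_on G (P n) u) < d"
    and H: "finite H" "\<forall>\<^sub>F n in sequentially. norm (v - proj_on H (P n) v) < d"
    using eventually_proj_on_approx[OF d, of u] eventually_proj_on_approx[OF d, of v] by metis
  from eventually_conj[OF G(2) H(2)] obtain n where
    n: "norm (u - proj_on G (P n) u) < d" "norm (v - proj_on H (P n) v) < d"
    by (metis (mono_tags, lifting) eventually_sequentially order_refl)
  define u' v' where "u' = proj_on G (P n) u" and "v' = proj_on H (P n) v"
  \<comment> \<open>Both supports are finite, so the rank-one operator between them has finite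
    propagation.\<close>
  obtain D :: nat where D: "\<And>x y. x \<in> G \<Longrightarrow> y \<in> H \<Longrightarrow> dist x y \<le> D"
  proof -
    define M where "M = Max (insert 0 ((\<lambda>(x, y). dist x y) ` (G \<times> H)))"
    have "dist x y \<le> M" if "x \<in> G" "y \<in> H" for x y
      unfolding M_def using that G(1) H(1) by (intro Max_ge) auto
    then show ?thesis
      using that[of "nat \<lceil>M\<rceil>"] by (meson order_trans real_nat_ceiling_ge)
  qed
  have "butterfly u' v' \<in> controlled P (max n D)"
  proof (rule controlled_butterfly[OF _ _ proj])
    show "dist x y \<le> real (max n D)" if "coord u' x \<noteq> 0" "coord v' y \<noteq> 0" for x y
      using D[of x y] that by (force simp: u'_def v'_def coord_proj_on[OF proj] split: if_splits)
  qed (auto simp: u'_def v'_def coord_proj_on[OF proj] mono)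
  moreover have "dist (butterfly u' v') (butterfly u v) < e"
  proof -
    have eq: "butterfly u' v' - butterfly u v = butterfly (u' - u) v' + butterfly u (v' - v)"
      by (rule blinfun_eqI)
         (simp add: butterfly_apply blinfun.diff_left blinfun.add_left cinner_diff_right
           complex_vector.scale_left_diff_distrib complex_vector.scale_right_diff_distrib)
    have nv: "norm v' \<le> norm v"
      unfolding v'_def by (rule ortho_proj_norm_le[OF ortho_proj_proj_on[OF proj]])
    have "norm (butterfly u' v' - butterfly u v) \<le> norm (u' - u) * norm v' + norm u * norm (v' - v)"
      unfolding eq by (rule order_trans[OF norm_triangle_ineq]) (intro add_mono norm_butterfly_le)
    also have "\<dots> \<le> d * norm v + norm u * d"
      using n nv d by (intro add_mono mult_mono) (auto simp: u'_def v'_def norm_minus_commute less_imp_le)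
    also have "\<dots> \<le> d * (norm u + norm v + 1)"
      using d by (simp add: algebra_simps)
    also have "\<dots> = e / 2"
    proof -
      have "norm u + norm v + 1 \<noteq> 0" by (smt (verit) norm_ge_zero)
      then show ?thesis unfolding d_def by (simp add: field_simps)
    qed
    finally show ?thesis using e by (simp add: dist_norm)
  qed
  ultimately show "\<exists>y\<in>\<Union>n. controlled P n. dist y (butterfly u v) < e" by blast
qed

end

section \<open>Rigidity\<close>

lemma bounded_geometry_finite_cball:
  assumes "bounded_geometry TYPE('x::metric_space)"
  shows "finite (cball (x::'x) r)"
proof -
  \<comment> \<open>Bounded geometry speaks of positive radii only.\<close>
  have "finite (cball x (max r 1))"
    using assms unfolding bounded_geometry_def by (meson less_max_iff_disj zero_less_one)
  then show ?thesis by (rule rev_finite_subset) auto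
qed

lemma bounded_geometry_card_cball:
  assumes "bounded_geometry TYPE('x::metric_space)"
  obtains N where "\<And>x :: 'x. card (cball x r) \<le> N"
proof -
  obtain N where N: "\<And>x :: 'x. finite (cball x (max r 1)) \<and> card (cball x (max r 1)) \<le> N"
    using assms unfolding bounded_geometry_def by (meson less_max_iff_disj zero_less_one)
  have "card (cball x r) \<le> N" for x :: 'x
    using card_mono[of "cball x (max r 1)" "cball x r"] N[of x] by fastforce
  then show ?thesis by (rule that)
qed

text \<open>The direct sum of the operators |b'_n><b_n| over disjoint supports. Pointwise it has at
  most one term, so no convergence question arises; the norm bound is orthogonality of the
  \<open>b' n\<close> combined with Bessel for the \<open>b n\<close>.\<close>

lemma orthogonal_block_operator:
  fixes b b' :: "nat \<Rightarrow> ('x, 'h::complex_inner_space) ell2" and B :: "nat \<Rightarrow> 'x set"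
  assumes disj: "disjoint_family B"
    and nb: "\<And>n. norm (b n) \<le> 1" "\<And>n. norm (b' n) \<le> 1"
    and sb: "\<And>n x. x \<notin> B n \<Longrightarrow> coord (b n) x = 0" "\<And>n x. x \<notin> B n \<Longrightarrow> coord (b' n) x = 0"
  obtains W :: "('x, 'h) ell2 \<Rightarrow>\<^sub>L ('x, 'h) ell2" where "clinear W" "norm W \<le> 1"
    "\<And>n f. (\<And>x. x \<notin> B n \<Longrightarrow> coord f x = 0) \<Longrightarrow> W f = cinner f (b n) *\<^sub>C b' n"
    "\<And>f. (\<And>n x. x \<in> B n \<Longrightarrow> coord f x = 0) \<Longrightarrow> W f = 0"
proof -
  define w where "w f z = (\<Sum>m | z \<in> B m. cinner f (b m) *\<^sub>C coord (b' m) z)" for f z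
  have at_most_one: "{m. z \<in> B m} = {} \<or> (\<exists>n. {m. z \<in> B m} = {n})" for z
    using disj unfolding disjoint_family_on_def by blast
  then have fin: "finite {m. z \<in> B m}" for z
    by (metis finite.emptyI finite.insertI)
  have orth: "cinner g h = 0"
    if gh: "\<And>x. x \<notin> B i \<Longrightarrow> coord g x = 0" "\<And>x. x \<notin> B j \<Longrightarrow> coord h x = 0" and ij: "i \<noteq> j"
    for g h :: "('x, 'h) ell2" and i j
  proof -
    have "cinner (coord g x) (coord h x) = 0" for x
      using gh(1)[of x] gh(2)[of x] ij disj unfolding disjoint_family_on_def
      by (cases "x \<in> B i"; cases "x \<in> B j") auto
    then show ?thesis using cinner_ell2_has_sum[of g h] has_sum_unique[OF _ has_sum_0] by auto
  qed
  have "\<exists>T :: ('x, 'h) ell2 \<Rightarrow>\<^sub>L ('x, 'h) ell2. clinear T \<and> (\<forall>f x. coord (T f) x = w f x) \<and> norm T \<le> 1"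
  proof (rule ell2_operator)
    show "w (f + g) x = w f x + w g x" for f g x
      by (simp add: w_def cinner_add_left scaleC_add_left sum.distrib)
    show "w (c *\<^sub>C f) x = c *\<^sub>C w f x" for c f x
      unfolding w_def complex_vector.scale_sum_right
      by (simp add: cinner_scaleC_left scaleC_scaleC)
    show "(\<Sum>x\<in>F. (norm (w f x))\<^sup>2) \<le> (1 * norm f)\<^sup>2" if F: "finite F" for f F
    proof -
      \<comment> \<open>Only the finitely many blocks that meet \<open>F\<close> matter for a
        partial sum over \<open>F\<close>.\<close>
      define M where "M = (\<Union>z\<in>F. {m. z \<in> B m})"
      have M: "finite M" unfolding M_def using F fin by auto
      define g where "g = (\<Sum>m\<in>M. cinner f (b m) *\<^sub>C b' m)"
      have "w f z = coord g z" if "z \<in> F" for z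
        unfolding w_def g_def coord_sum
        by (rule sum.mono_neutral_cong_left) (use M that in \<open>auto simp: M_def sb\<close>)
      then have "(\<Sum>x\<in>F. (norm (w f x))\<^sup>2) = (\<Sum>x\<in>F. (norm (coord g x))\<^sup>2)" by simp
      also have "\<dots> \<le> (norm g)\<^sup>2" by (rule sum_norm_coord_le[OF F])
      also have "\<dots> = (\<Sum>m\<in>M. (norm (cinner f (b m) *\<^sub>C b' m))\<^sup>2)"
        unfolding g_def
        by (rule norm_sum_orthogonal[OF M])
           (auto simp: cinner_scaleC_left cinner_scaleC_right intro!: orth sb)
      also have "\<dots> \<le> (\<Sum>m\<in>M. (cmod (cinner f (b m)))\<^sup>2)"
        unfolding norm_scaleC power_mult_distrib
        using nb by (intro sum_mono) (simp add: mult_left_le power_le_one)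
      also have "\<dots> \<le> (norm f)\<^sup>2"
        by (rule bessel[OF M]) (auto simp: nb intro: orth sb)
      finally show ?thesis by simp
    qed
  qed simp
  then obtain W :: "('x, 'h) ell2 \<Rightarrow>\<^sub>L ('x, 'h) ell2" where
    W: "clinear W" "\<And>f x. coord (W f) x = w f x" "norm W \<le> 1" by blast
  show ?thesis
  proof (rule that[OF W(1,3)])
    show "W f = cinner f (b n) *\<^sub>C b' n" if f: "\<And>x. x \<notin> B n \<Longrightarrow> coord f x = 0" for n f
    proof (rule ell2_eqI)
      fix z
      have 0: "cinner f (b m) = 0" if "m \<noteq> n" for m
        by (rule orth[of n f m "b m"]) (use f sb that in auto)
      have "w f z = (\<Sum>m | z \<in> B m. if m = n then cinner f (b n) *\<^sub>C coord (b' n) z else 0)"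
        unfolding w_def by (rule sum.cong) (auto simp: 0)
      also have "\<dots> = cinner f (b n) *\<^sub>C coord (b' n) z"
        using fin[of z] by (simp add: sum.delta sb)
      finally show "coord (W f) z = coord (cinner f (b n) *\<^sub>C b' n) z" by (simp add: W)
    qed
    show "W f = 0" if f: "\<And>n x. x \<in> B n \<Longrightarrow> coord f x = 0" for f
    proof (rule ell2_eqI)
      fix z
      have "cinner f (b m) = 0" for m
      proof -
        have "cinner (coord f x) (coord (b m) x) = 0" for x
          using f[of x m] sb(1)[of x m] by (cases "x \<in> B m") auto
        then show ?thesis using cinner_ell2_has_sum[of f "b m"] has_sum_unique[OF _ has_sum_0] by auto
      qed
      then show "coord (W f) z = coord 0 z" by (simp add: W w_def)
    qed
  qed
qed

lemma finite_uniform_lower_bound: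
  fixes h :: "'a \<Rightarrow> 'b \<Rightarrow> real"
  assumes "finite F" "\<And>x. x \<in> F \<Longrightarrow> \<exists>y. h x y > 0"
  shows "\<exists>d>0. \<forall>x\<in>F. \<exists>y. h x y \<ge> d"
  using assms
proof (induction F)
  case (insert x F)
  then obtain d where d: "d > 0" "\<forall>x\<in>F. \<exists>y. h x y \<ge> d" by blast
  obtain y where y: "h x y > 0" using insert.prems by blast
  have "\<exists>y'. h z y' \<ge> min d (h x y)" if z: "z \<in> insert x F" for z
  proof (cases "z = x")
    case True
    then show ?thesis by (intro exI[of _ y]) simp
  next
    case False
    then obtain y' where "h z y' \<ge> d" using d(2) z by blast
    then show ?thesis by (intro exI[of _ y']) simp
  qed
  then show ?case using d y by (intro exI[of _ "min d (h x y)"] conjI ballI) auto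
qed (auto intro: exI[of _ 1])

lemma finite_dist_bounded:
  fixes h h' :: "'a \<Rightarrow> 'b::metric_space"
  assumes "finite F"
  shows "\<exists>s. \<forall>p\<in>F. dist (h p) (h' p) \<le> s"
  by (rule exI[of _ "Max (insert 0 ((\<lambda>p. dist (h p) (h' p)) ` F))"]) (use assms in auto)

text \<open>The control functions are the largest image distance at scale at most t and the smallest
  at scale at least t. Unboundedness of the latter comes from \<open>g\<close>: if two images are
  close, \<open>g\<close> brings them back to close points, which lie near the original
  ones.\<close>

lemma coarsely_equivalentI:
  fixes f :: "'x::metric_space \<Rightarrow> 'y::metric_space" and g :: "'y \<Rightarrow> 'x"
  assumes f: "\<And>r. \<exists>s. \<forall>x x'. dist x x' \<le> r \<longrightarrow> dist (f x) (f x') \<le> s"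
    and g: "\<And>r. \<exists>s. \<forall>y y'. dist y y' \<le> r \<longrightarrow> dist (g y) (g y') \<le> s"
    and gf: "\<exists>C. \<forall>x. dist x (g (f x)) \<le> C" and fg: "\<exists>C. \<forall>y. dist y (f (g y)) \<le> C"
  shows "coarsely_equivalent TYPE('x) TYPE('y)"
proof -
  define S where "S t = {dist (f x) (f x') |x x'. dist x x' \<le> t}" for t
  \<comment> \<open>Inserting \<open>t\<close> keeps the set non-empty, and the infimum growing,
    when no two points are that far apart.\<close>
  define I where "I t = insert t {dist (f x) (f x') |x x'. dist x x' \<ge> t}" for t
  \<comment> \<open>The summand \<open>t\<close> makes the function unbounded even if image
    distances are bounded.\<close>
  define \<rho>\<^sub>2 where "\<rho>\<^sub>2 t = t + Sup (insert 0 (S t))" for t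
  define \<rho>\<^sub>1 where "\<rho>\<^sub>1 t = Inf (I t)" for t
  have bS: "bdd_above (insert 0 (S t))" for t
  proof -
    obtain s where "\<And>x x'. dist x x' \<le> t \<Longrightarrow> dist (f x) (f x') \<le> s" using f[of t] by blast
    then have "bdd_above (S t)" unfolding S_def by (intro bdd_aboveI[of _ s]) auto
    then show ?thesis by simp
  qed
  have Sup0: "Sup (insert 0 (S t)) \<ge> 0" for t
    by (rule cSup_upper[OF _ bS]) simp
  have bI: "bdd_below (I t)" for t
    unfolding I_def by (simp, rule bdd_belowI[of _ 0]) auto
  have I0: "\<rho>\<^sub>1 t \<ge> 0" if "t \<ge> 0" for t
    unfolding \<rho>\<^sub>1_def by (rule cInf_greatest) (use that in \<open>auto simp: I_def\<close>)
  have "control_function \<rho>\<^sub>2"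
    unfolding control_function_def
  proof (intro conjI)
    show "\<rho>\<^sub>2 ` {0..} \<subseteq> {0..}" using Sup0 by (auto simp: \<rho>\<^sub>2_def)
    show "mono_on {0..} \<rho>\<^sub>2"
    proof (rule mono_onI)
      fix s t :: real assume "s \<le> t"
      then have "Sup (insert 0 (S s)) \<le> Sup (insert 0 (S t))"
        using bS[of t] by (intro cSup_subset_mono insert_mono) (auto simp: S_def intro: order_trans)
      then show "\<rho>\<^sub>2 s \<le> \<rho>\<^sub>2 t" using \<open>s \<le> t\<close> by (simp add: \<rho>\<^sub>2_def)
    qed
    show "\<not> bdd_above (\<rho>\<^sub>2 ` {0..})"
    proof
      assume "bdd_above (\<rho>\<^sub>2 ` {0..})"
      then obtain K where K: "\<And>t. t \<ge> 0 \<Longrightarrow> \<rho>\<^sub>2 t \<le> K" by (auto simp: bdd_above_def)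
      show False using K[of "\<bar>K\<bar> + 1"] Sup0[of "\<bar>K\<bar> + 1"] by (simp add: \<rho>\<^sub>2_def)
    qed
  qed
  moreover have "control_function \<rho>\<^sub>1"
    unfolding control_function_def
  proof (intro conjI)
    show "\<rho>\<^sub>1 ` {0..} \<subseteq> {0..}" using I0 by auto
    show "mono_on {0..} \<rho>\<^sub>1"
    proof (rule mono_onI)
      fix s t :: real assume "s \<le> t"
      show "\<rho>\<^sub>1 s \<le> \<rho>\<^sub>1 t"
        unfolding \<rho>\<^sub>1_def
      proof (rule cInf_mono[OF _ bI])
        show "I t \<noteq> {}" by (simp add: I_def)
        fix b assume "b \<in> I t"
        then show "\<exists>a\<in>I s. a \<le> b" using \<open>s \<le> t\<close> unfolding I_def by force
      qed
    qed
    show "\<not> bdd_above (\<rho>\<^sub>1 ` {0..})"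
    proof
      assume "bdd_above (\<rho>\<^sub>1 ` {0..})"
      then obtain K where K: "\<And>t. t \<ge> 0 \<Longrightarrow> \<rho>\<^sub>1 t \<le> K" by (auto simp: bdd_above_def)
      obtain C where C: "\<And>x. dist x (g (f x)) \<le> C" using gf by blast
      obtain s where s: "\<And>y y'. dist y y' \<le> K + 1 \<Longrightarrow> dist (g y) (g y') \<le> s" using g[of "K + 1"] by blast
      \<comment> \<open>If images are less than \<open>K + 1\<close> apart, the points are at most
        \<open>2 * C + s\<close> apart; the other entry of the maximum takes care of the inserted
        element \<open>t\<close>.\<close>
      define t where "t = max (\<bar>K\<bar> + 1) (2 * C + s + 1)"
      have "\<rho>\<^sub>1 t \<ge> K + 1"
        unfolding \<rho>\<^sub>1_def
      proof (rule cInf_greatest)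
        fix a assume "a \<in> I t"
        then consider "a = t" | x x' where "a = dist (f x) (f x')" "dist x x' \<ge> t" by (auto simp: I_def)
        then show "K + 1 \<le> a"
        proof cases
          case 2
          show ?thesis
          proof (rule ccontr)
            assume "\<not> K + 1 \<le> a"
            then have "dist (g (f x)) (g (f x')) \<le> s" using s 2 by simp
            moreover have "dist x x' \<le> dist x (g (f x)) + dist (g (f x)) (g (f x')) + dist (g (f x')) x'"
              using dist_triangle[of x x' "g (f x)"] dist_triangle[of "g (f x)" x' "g (f x')"] by linarith
            ultimately have "dist x x' \<le> 2 * C + s" using C[of x] C[of x'] by (simp add: dist_commute)
            then show False using 2(2) by (simp add: t_def)
          qed
        qed (simp add: t_def)
      qed (simp add: I_def)
      moreover have "t \<ge> 0" by (simp add: t_def max.coboundedI1)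
      ultimately show False using K[of t] by simp
    qed
  qed
  moreover have "\<rho>\<^sub>1 (dist x y) \<le> dist (f x) (f y)" for x y
    unfolding \<rho>\<^sub>1_def by (rule cInf_lower[OF _ bI]) (auto simp: I_def)
  moreover have "dist (f x) (f y) \<le> \<rho>\<^sub>2 (dist x y)" for x y
  proof -
    have "dist (f x) (f y) \<le> Sup (insert 0 (S (dist x y)))"
      by (rule cSup_upper[OF _ bS]) (auto simp: S_def)
    then show ?thesis unfolding \<rho>\<^sub>2_def using zero_le_dist[of x y] by linarith
  qed
  ultimately have "coarse_embedding f" unfolding coarse_embedding_def by blast
  moreover obtain C where C: "\<And>y. dist y (f (g y)) \<le> C" using fg by blast
  have "infdist y (range f) \<le> \<bar>C\<bar> + 1" for y
    using infdist_le[of "f (g y)" "range f" y] C[of y] by simp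
  ultimately show ?thesis
    unfolding coarsely_equivalent_def by (intro exI[of _ f] conjI exI[of _ "\<bar>C\<bar> + 1"]) auto
qed

section \<open>Consequences of a unitary that conjugates the algebras\<close>

text \<open>The vectors \<open>single x e0\<close> serve as the basis vectors at the points
  \<open>x\<close>, and \<open>m0\<close> names a corner containing \<open>e0\<close>. The
  hypotheses are symmetric in the two spaces, so each estimate for \<open>U\<close> is also one for
  \<open>V\<close>.\<close>

locale rigid_pair = filtration P
  for P :: "nat \<Rightarrow> 'h::complex_hilbert_space \<Rightarrow>\<^sub>L 'h" +
  fixes U :: "('x::metric_space, 'h) ell2 \<Rightarrow>\<^sub>L ('y::metric_space, 'h) ell2"
    and V :: "('y, 'h) ell2 \<Rightarrow>\<^sub>L ('x, 'h) ell2"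
    and e0 :: 'h and m0 :: nat
  assumes UV: "unitary_pair U V"
    and conj_U: "T \<in> filtered_roe P \<Longrightarrow> U o\<^sub>L T o\<^sub>L V \<in> filtered_roe P"
    and conj_V: "S \<in> filtered_roe P \<Longrightarrow> V o\<^sub>L S o\<^sub>L U \<in> filtered_roe P"
    and bgX: "bounded_geometry TYPE('x)" and bgY: "bounded_geometry TYPE('y)"
    and e0: "norm e0 = 1" "P m0 e0 = e0"
begin

lemma rigid_pair_sym: "rigid_pair P V U e0 m0"
  by unfold_locales (use unitary_pair_sym[OF UV] conj_U conj_V bgX bgY e0 in auto)

lemmas uv = unitary_pairD[OF UV]

text \<open>One number \<open>R\<close> bounds both the spatial radius and the fibre corner, so that
  rank-one operators between vectors in the range of \<open>loc R x\<close> lie in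
  \<open>controlled P (2 * R)\<close>, whatever \<open>x\<close> is.\<close>

definition loc :: "nat \<Rightarrow> 'x \<Rightarrow> (('x, 'h) ell2 \<Rightarrow>\<^sub>L ('x, 'h) ell2)" where
  "loc R x = proj_on (cball x (real R)) (P R)"

lemma ortho_proj_loc: "ortho_proj (loc R x)"
  unfolding loc_def by (rule ortho_proj_proj_on[OF proj])

lemma coord_loc: "coord (loc R x f) z = (if dist x z \<le> real R then P R (coord f z) else 0)"
  unfolding loc_def by (simp add: coord_proj_on[OF proj])

text \<open>The projection onto the closed span of all \<open>single x e0\<close>. It is one element
  of the algebra that fixes all these vectors, which is the source of uniformity in
  \<open>x\<close>.\<close>

definition base_proj :: "('x, 'h) ell2 \<Rightarrow>\<^sub>L ('x, 'h) ell2" where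
  "base_proj = diag (\<lambda>_. butterfly e0 e0)"

lemma coord_base_proj: "coord (base_proj f) x = cinner (coord f x) e0 *\<^sub>C e0"
  and clinear_base_proj: "clinear base_proj"
proof -
  have *: "clinear (butterfly e0 e0)" "norm (butterfly e0 e0) \<le> 1"
    using clinear_butterfly norm_butterfly_le[of e0 e0] e0 by auto
  show "coord (base_proj f) x = cinner (coord f x) e0 *\<^sub>C e0"
    unfolding base_proj_def using coord_diag[of "\<lambda>_. butterfly e0 e0", OF *] by (simp add: butterfly_apply)
  show "clinear base_proj"
    unfolding base_proj_def by (rule clinear_diag[of "\<lambda>_. butterfly e0 e0", OF *])
qed

lemma base_proj_single: "base_proj (single x e0) = single x e0"
  using e0 by (intro ell2_eqI) (simp add: coord_base_proj coord_single cinner_self)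

lemma base_proj_in: "base_proj \<in> filtered_roe P"
proof -
  have c: "coord (base_proj (single y v)) x = (if x = y then cinner v e0 *\<^sub>C e0 else 0)" for x y v
    by (simp add: coord_base_proj coord_single)
  have "base_proj \<in> controlled P m0"
  proof (rule controlledI[OF clinear_base_proj])
    have "matrix_entry base_proj x y = (if x = y then butterfly e0 e0 else 0)" for x y
      by (rule blinfun_eqI) (simp add: matrix_entry_apply c butterfly_apply)
    then show "matrix_entry base_proj x y \<in> compact_operators" for x y
      by (simp add: compact_operators_zero compact_operators_butterfly)
    show "coord (base_proj (single y v)) x = 0" if "dist x y > real m0" for x y v
      using that by (auto simp: c)
    show "P m0 (coord (base_proj (single y v)) x) = coord (base_proj (single y v)) x" for x y v
      by (simp add: c clinear_scaleC[OF ortho_proj_clinear[OF proj]] e0)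
    show "coord (base_proj (single y (P m0 v))) x = coord (base_proj (single y v)) x" for x y v
      by (simp add: c ortho_proj_cinner[OF proj] e0)
  qed
  then show ?thesis unfolding filtered_roe_def by (intro closure_subset[THEN subsetD]) auto
qed

lemma norm_U_single: "norm (U (single x e0)) = 1"
  by (simp add: uv norm_single e0)

text \<open>The conjugate \<open>T\<close> of \<open>base_proj\<close> fixes every
  \<open>U (single x e0)\<close>. An approximant of \<open>T\<close> has finitely many nonzero
  entries in row \<open>y\<close>, all compact, and these annihilate the weakly null coordinates in
  the limit.\<close>

lemma finite_large_coord_U:
  assumes e: "e > 0"
  shows "finite {x. norm (coord (U (single x e0)) y) \<ge> e}"
proof (rule ccontr)
  assume "infinite {x. norm (coord (U (single x e0)) y) \<ge> e}"
  then obtain k :: "nat \<Rightarrow> 'x" where k: "inj k" "range k \<subseteq> {x. norm (coord (U (single x e0)) y) \<ge> e}"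
    by (rule infinite_countable_subset[THEN exE]) auto
  define u where "u i = U (single (k i) e0)" for i
  define T where "T = U o\<^sub>L base_proj o\<^sub>L V"
  have Tu: "T (u i) = u i" for i by (simp add: T_def u_def uv base_proj_single)
  have "T \<in> filtered_roe P" unfolding T_def by (rule conj_U[OF base_proj_in])
  then obtain n S where S: "S \<in> controlled P n" "norm (T - S) < e / 2"
    by (rule filtered_roe_approx[of _ _ "e / 2"]) (use e in auto)
  have fin: "finite (cball y (real n))" by (rule bounded_geometry_finite_cball[OF bgY])
  have "(\<lambda>i. matrix_entry S y z (coord (u i) z)) \<longlonglongrightarrow> 0" for z
  proof (rule compact_operator_weakly_null[OF controlled_compact[OF S(1)]])
    show "norm (coord (u i) z) \<le> 1" for i
      using norm_coord_le[of "u i" z] by (simp add: u_def norm_U_single)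
    \<comment> \<open>Moved through \<open>U\<close>, this is a coordinate of the fixed vector
      \<open>V (single z w)\<close> at the injectively chosen point \<open>k i\<close>.\<close>
    show "(\<lambda>i. cinner (coord (u i) z) w) \<longlonglongrightarrow> 0" for w
    proof -
      have "cinner (coord (u i) z) w = cinner e0 (coord (V (single z w)) (k i))" for i
        by (simp add: u_def uv cinner_single_left flip: cinner_single_right)
      moreover have "(\<lambda>i. cinner e0 (coord (V (single z w)) (k i))) \<longlonglongrightarrow> cinner e0 0"
        by (rule tendsto_cinner_right[OF coord_tendsto_0[OF k(1)]])
      ultimately show ?thesis by simp
    qed
  qed
  then have "(\<lambda>i. \<Sum>z\<in>cball y (real n). matrix_entry S y z (coord (u i) z))
      \<longlonglongrightarrow> (\<Sum>z\<in>cball y (real n). 0)"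
    by (intro tendsto_sum)
  then have "(\<lambda>i. coord (S (u i)) y) \<longlonglongrightarrow> 0"
    by (simp add: controlled_coord_sum[OF S(1) fin])
  then have "\<forall>\<^sub>F i in sequentially. norm (coord (S (u i)) y) < e / 2"
    using e by (auto dest: tendstoD[of _ _ _ "e / 2"])
  then obtain i where i: "norm (coord (S (u i)) y) < e / 2"
    by (meson eventually_sequentially order_refl)
  have "norm (coord (u i) y - coord (S (u i)) y) \<le> norm ((T - S) (u i))"
    using norm_coord_le[of "(T - S) (u i)" y] by (simp add: blinfun.diff_left Tu)
  also have "\<dots> \<le> norm (T - S)"
    using norm_blinfun[of "T - S" "u i"] by (simp add: u_def norm_U_single)
  finally have "norm (coord (u i) y) < e"
    using S(2) i norm_triangle_sub[of "coord (u i) y" "coord (S (u i)) y"] by linarith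
  moreover have "norm (coord (u i) y) \<ge> e" using k(2) by (auto simp: u_def)
  ultimately show False by simp
qed

lemma finite_large_restriction_U:
  assumes e: "e > 0" and G: "finite G"
  shows "finite {x. norm (proj_on G id_blinfun (U (single x e0))) \<ge> e}"
proof -
  \<comment> \<open>A vector with all coordinates over \<open>G\<close> below \<open>d\<close> has
    norm below \<open>e\<close> there; the added 1 allows for empty \<open>G\<close>.\<close>
  define d where "d = e / (1 + real (card G))"
  have d: "d > 0" using e by (simp add: d_def add_pos_nonneg)
  have "finite (\<Union>y\<in>G. {x. norm (coord (U (single x e0)) y) \<ge> d})"
    using G finite_large_coord_U[OF d] by blast
  moreover have "{x. norm (proj_on G id_blinfun (U (single x e0))) \<ge> e}
      \<subseteq> (\<Union>y\<in>G. {x. norm (coord (U (single x e0)) y) \<ge> d})"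
  proof (rule subsetI, rule ccontr)
    fix x assume x: "x \<in> {x. norm (proj_on G id_blinfun (U (single x e0))) \<ge> e}"
      "x \<notin> (\<Union>y\<in>G. {x. norm (coord (U (single x e0)) y) \<ge> d})"
    have "norm (proj_on G id_blinfun (U (single x e0))) \<le> (\<Sum>y\<in>G. norm (coord (U (single x e0)) y))"
      unfolding proj_on_finite[OF ortho_proj_id G] by (rule order_trans[OF norm_sum]) (simp add: norm_single)
    also have "\<dots> \<le> (\<Sum>y\<in>G. d)" using x(2) by (intro sum_mono) (auto intro: less_imp_le)
    also have "\<dots> = real (card G) * d" by simp
    also have "\<dots> < (1 + real (card G)) * d" using d by (simp add: algebra_simps)
    also have "\<dots> = e"
    proof -
      have "1 + real (card G) \<noteq> 0" by linarith
      then show ?thesis by (simp add: d_def)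
    qed
    finally show False using x(1) by simp
  qed
  ultimately show ?thesis by (rule rev_finite_subset)
qed

text \<open>A single approximant of finite propagation serves all \<open>x\<close>, hence
  \<open>R\<close> does not depend on \<open>x\<close>.\<close>

lemma filtered_roe_localizes:
  assumes T: "T \<in> filtered_roe P" and e: "e > 0"
  obtains R where "\<And>x. norm (T (single x e0) - loc R x (T (single x e0))) \<le> e" "R \<ge> N"
proof -
  obtain n S where S: "S \<in> controlled P n" "norm (T - S) < e"
    using filtered_roe_approx[OF T e] by blast
  define R where "R = max n N"
  note S' = controlled_mono[OF S(1), of R]
  have "norm (T (single x e0) - loc R x (T (single x e0))) \<le> e" for x
  proof -
    let ?a = "single x e0"
    have "loc R x (S ?a) = S ?a"
      using controlled_propagation[OF S', of _ x e0] controlled_compose(1)[OF S', of x e0]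
      by (intro ell2_eqI) (auto simp: coord_loc R_def dist_commute)
    then have "T ?a - loc R x (T ?a) = (T - S) ?a - loc R x ((T - S) ?a)"
      by (simp add: blinfun.diff_left blinfun.diff_right)
    then have "norm (T ?a - loc R x (T ?a)) \<le> norm ((T - S) ?a)"
      using ortho_proj_compl_norm_le[OF ortho_proj_loc] by metis
    also have "\<dots> \<le> norm (T - S)"
      using norm_blinfun[of "T - S" ?a] by (simp add: norm_single e0)
    finally show ?thesis using S(2) by simp
  qed
  then show ?thesis using that[of R] by (simp add: R_def)
qed

section \<open>Gliding humps\<close>

text \<open>For a fixed \<open>A\<close> localization follows from membership in the algebra, but
  with \<open>R\<close> depending on \<open>A\<close>. If no \<open>R\<close> serves all sets,
  failing sets are glued along disjoint annuli that carry the respective vectors, and the resulting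
  set contradicts the case of a fixed set.\<close>

lemma restriction_localizes:
  assumes e: "e > 0"
  obtains R F where "finite F"
    "\<And>x A. x \<notin> F \<Longrightarrow> norm (V (proj_on A (P m) (U (single x e0))) -
       loc R x (V (proj_on A (P m) (U (single x e0))))) \<le> e"
proof -
  define u where "u x = U (single x e0)" for x
  define bad where "bad R x A \<longleftrightarrow>
    norm (V (proj_on A (P m) (u x)) - loc R x (V (proj_on A (P m) (u x)))) > e" for R x A
  have "\<exists>R F. finite F \<and> (\<forall>x A. x \<notin> F \<longrightarrow> \<not> bad R x A)"
  proof (rule ccontr)
    assume neg: "\<not> ?thesis"
    \<comment> \<open>\<open>G\<close> is the region already used, in which \<open>u x\<close> is
      nearly invisible; \<open>G'\<close> extends it to catch nearly all of \<open>u x\<close>. Thus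
      \<open>u x\<close> lives on the annulus \<open>G' - G\<close>.\<close>
    define good_step where "good_step n G x A G' \<longleftrightarrow> bad n x A \<and> norm (proj_on G id_blinfun (u x)) < e / 8 \<and>
      finite G' \<and> G \<subseteq> G' \<and> norm (u x - proj_on G' id_blinfun (u x)) < e / 8" for n G x A G'
    have "\<exists>x A G'. good_step n G x A G'" if G: "finite G" for n G
    proof -
      have "finite {x. norm (proj_on G id_blinfun (u x)) \<ge> e / 8}"
        unfolding u_def by (rule finite_large_restriction_U[OF _ G]) (use e in auto)
      then obtain x A where x: "bad n x A" "norm (proj_on G id_blinfun (u x)) < e / 8"
        using neg by (metis (mono_tags, lifting) mem_Collect_eq not_le)
      obtain H where H: "finite H" "norm (u x - proj_on H id_blinfun (u x)) < e / 8"
        by (rule finite_tail[of "e / 8" "u x"]) (use e in auto)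
      have "norm (u x - proj_on (G \<union> H) id_blinfun (u x)) \<le> norm (u x - proj_on H id_blinfun (u x))"
        by (rule norm_ell2_mono) (auto simp: coord_proj_on_id)
      then show ?thesis
        using x H G unfolding good_step_def by (intro exI[of _ x] exI[of _ A] exI[of _ "G \<union> H"]) auto
    qed
    \<comment> \<open>The choice is made total in \<open>n\<close> and \<open>G\<close> at once, so
      that the sequence can be defined by plain recursion.\<close>
    then have "\<forall>p. \<exists>s. finite (snd p) \<longrightarrow>
        good_step (fst p) (snd p) (fst s) (fst (snd s)) (snd (snd s))"
      by simp
    then obtain h where h: "\<forall>p. finite (snd p) \<longrightarrow>
        good_step (fst p) (snd p) (fst (h p)) (fst (snd (h p))) (snd (snd (h p)))"
      by (rule choice[THEN exE])
    define fx fA fG where "fx n G = fst (h (n, G))" and "fA n G = fst (snd (h (n, G)))"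
      and "fG n G = snd (snd (h (n, G)))" for n G
    have f: "good_step n G (fx n G) (fA n G) (fG n G)" if "finite G" for n G
      using h[rule_format, of "(n, G)"] that by (simp add: fx_def fA_def fG_def)
    define G where "G = rec_nat {} fG"
    have G0: "G 0 = {}" and GS: "G (Suc n) = fG n (G n)" for n by (simp_all add: G_def)
    have Gfin: "finite (G n)" for n
      by (induction n) (use f in \<open>auto simp: G0 GS good_step_def\<close>)
    define x where "x n = fx n (G n)" for n
    define A where "A n = fA n (G n)" for n
    have st: "good_step n (G n) (x n) (A n) (G (Suc n))" for n
      unfolding x_def A_def GS by (rule f[OF Gfin])
    have Gmono: "G i \<subseteq> G j" if "i \<le> j" for i j
      using that by (rule lift_Suc_mono_le[rotated]) (use st in \<open>auto simp: good_step_def\<close>)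
    \<comment> \<open>On the \<open>n\<close>-th annulus \<open>B\<close> coincides with
      \<open>A n\<close>.\<close>
    define B where "B = (\<Union>n. A n \<inter> (G (Suc n) - G n))"
    have B: "z \<in> B \<longleftrightarrow> z \<in> A n" if z: "z \<in> G (Suc n) - G n" for z n
    proof
      assume "z \<in> B"
      then obtain k where k: "z \<in> A k" "z \<in> G (Suc k)" "z \<notin> G k" unfolding B_def by auto
      have "\<not> k < n" using Gmono[of "Suc k" n] k z by auto
      moreover have "\<not> n < k" using Gmono[of "Suc n" k] k z by auto
      ultimately show "z \<in> A n" using k by (metis linorder_neqE_nat)
    qed (use z in \<open>auto simp: B_def\<close>)
    define T where "T = V o\<^sub>L (proj_on B (P m) o\<^sub>L (U o\<^sub>L base_proj o\<^sub>L V)) o\<^sub>L U"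
    have T: "T (single x e0) = V (proj_on B (P m) (u x))" for x
      by (simp add: T_def u_def uv base_proj_single)
    have "T \<in> filtered_roe P"
      unfolding T_def by (intro conj_V proj_on_compose_filtered_roe conj_U base_proj_in)
    then obtain n where n: "\<And>x. norm (T (single x e0) - loc n x (T (single x e0))) \<le> e / 4"
      by (rule filtered_roe_localizes[where e = "e / 4" and N = 0]) (use e in auto)
    define p where "p = V (proj_on (A n) (P m) (u (x n)))"
    define g where "g = proj_on (A n) (P m) (u (x n)) - proj_on B (P m) (u (x n))"
    \<comment> \<open>The two restrictions agree on the annulus; off it \<open>u (x n)\<close> has
      norm less than e/8 + e/8.\<close>
    have "norm g \<le> norm (proj_on (G n) id_blinfun (u (x n)) + (u (x n) - proj_on (G (Suc n)) id_blinfun (u (x n))))"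
    proof (rule norm_ell2_mono)
      fix z
      show "norm (coord g z) \<le> norm (coord (proj_on (G n) id_blinfun (u (x n)) +
          (u (x n) - proj_on (G (Suc n)) id_blinfun (u (x n)))) z)"
      proof (cases "z \<in> G (Suc n) - G n")
        case True
        then show ?thesis using B[OF True] by (auto simp: g_def coord_proj_on[OF proj])
      next
        case False
        then have "coord (proj_on (G n) id_blinfun (u (x n)) +
          (u (x n) - proj_on (G (Suc n)) id_blinfun (u (x n)))) z = coord (u (x n)) z"
          using Gmono[of n "Suc n"] by (auto simp: coord_proj_on_id)
        moreover have "norm (coord g z) \<le> norm (coord (u (x n)) z)"
          using ortho_proj_norm_le[OF proj, of m] by (auto simp: g_def coord_proj_on[OF proj])
        ultimately show ?thesis by simp
      qed
    qed
    also have "\<dots> < e / 4"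
      using st[of n] unfolding good_step_def by (intro le_less_trans[OF norm_triangle_ineq]) linarith
    finally have g: "norm g < e / 4" .
    have p: "p = T (single (x n) e0) + V g"
      by (simp add: p_def T g_def blinfun.diff_right)
    have "norm (p - loc n (x n) p) \<le> norm (T (single (x n) e0) - loc n (x n) (T (single (x n) e0))) +
        norm (V g - loc n (x n) (V g))"
      unfolding p blinfun.add_right by (rule order_trans[OF _ norm_triangle_ineq]) (simp add: algebra_simps)
    also have "\<dots> \<le> e / 4 + e / 4"
      using n[of "x n"] g ortho_proj_compl_norm_le[OF ortho_proj_loc, of "V g" n "x n"]
      by (simp add: uv)
    finally show False
      using st[of n] e unfolding good_step_def bad_def p_def by auto
  qed
  then show ?thesis
    using that unfolding bad_def u_def by (metis not_le)
qed

text \<open>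
  A gliding hump: if the estimate fails along a sequence of points \<open>x\<close> leaving every finite set, then
  the rank-one operators \<open>\<bar>b'\<rangle>\<langle>b\<bar>\<close> along a sparse subsequence add up to an operator of finite
  propagation whose conjugate by \<open>U\<close> has large entries arbitrarily far from the diagonal.
\<close>

lemma rank_one_separation:
  assumes e: "e > 0"
  obtains F L where "finite F"
    "\<And>x b b' y y' v v'. \<lbrakk>x \<notin> F; loc R x b = b; loc R x b' = b'; norm b \<le> 1; norm b' \<le> 1;
       norm v \<le> 1; norm v' \<le> 1; dist y y' > real L\<rbrakk> \<Longrightarrow>
       cmod (cinner b (V (single y v))) * cmod (cinner b' (V (single y' v'))) \<le> e"
proof -
  define bad where "bad x b b' y v y' v' \<longleftrightarrow> loc R x b = b \<and> loc R x b' = b' \<and> norm b \<le> 1 \<and> norm b' \<le> 1 \<and>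
       norm v \<le> 1 \<and> norm v' \<le> 1 \<and>
       cmod (cinner b (V (single y v))) * cmod (cinner b' (V (single y' v'))) > e" for x b b' y v y' v'
  have "\<exists>F L. finite F \<and> (\<forall>x b b' y v y' v'. x \<notin> F \<and> dist y y' > real L \<longrightarrow> \<not> bad x b b' y v y' v')"
  proof (rule ccontr)
    assume contra: "\<not> ?thesis"
    have neg: "\<exists>x b b' y v y' v'. x \<notin> F \<and> dist y y' > real L \<and> bad x b b' y v y' v'"
      if F: "finite F" for F L
    proof (rule ccontr)
      assume none: "\<not> ?thesis"
      have "\<exists>F L. finite F \<and> (\<forall>x b b' y v y' v'. x \<notin> F \<and> dist y y' > real L \<longrightarrow> \<not> bad x b b' y v y' v')"
      proof (intro exI conjI allI impI)
        fix x b b' and y :: 'y and v and y' :: 'y and v' assume "x \<notin> F \<and> dist y y' > real L"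
        then show "\<not> bad x b b' y v y' v'" using none by auto
      qed (rule F)
      then show False by (rule notE[OF contra])
    qed
    \<comment> \<open>The \<open>Z\<close> condition makes the rank-one operators chosen earlier
      contribute little to the entry between \<open>y\<close> and \<open>y'\<close>. The condition
      on \<open>G'\<close> does the same for those chosen later, whose balls will avoid
      \<open>G'\<close>.\<close>
    define good_step where "good_step n Z G x b b' y v y' v' G' \<longleftrightarrow> bad x b b' y v y' v' \<and>
      cball x (real R) \<inter> G = {} \<and> dist y y' > real n \<and>
      cmod (cinner (Z (single y v)) (single y' v')) \<le> e / 4 \<and> finite G' \<and> G \<union> cball x (real R) \<subseteq> G' \<and>
      norm (V (single y v) - proj_on G' id_blinfun (V (single y v))) \<le> e / 4"
      for n and Z :: "('y, 'h) ell2 \<Rightarrow>\<^sub>L ('y, 'h) ell2" and G x b b' y v y' v' G'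
    have "\<exists>x b b' y v y' v' G'. good_step n Z G x b b' y v y' v' G'"
      if G: "finite G" and Z: "Z \<in> filtered_roe P" for n Z G
    proof -
      \<comment> \<open>\<open>Z\<close> belongs to the algebra, so points farther apart than the
        propagation \<open>l\<close> of an approximant see at most e/4 of it.\<close>
      obtain l S where S: "S \<in> controlled P l" "norm (Z - S) < e / 4"
        by (rule filtered_roe_approx[OF Z, of "e / 4"]) (use e in auto)
      \<comment> \<open>Avoiding the \<open>R\<close>-neighbourhood of \<open>G\<close> makes the
        whole ball around the new point miss \<open>G\<close>.\<close>
      have "finite (\<Union>z\<in>G. cball z (real R))"
        using G bounded_geometry_finite_cball[OF bgX] by blast
      from neg[OF this, of "max n l"] obtain x b b' y v y' v' where
        x: "x \<notin> (\<Union>z\<in>G. cball z (real R))" "dist y y' > real (max n l)" "bad x b b' y v y' v'" by blast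
      obtain H where H: "finite H" "norm (V (single y v) - proj_on H id_blinfun (V (single y v))) < e / 4"
        by (rule finite_tail[of "e / 4" "V (single y v)"]) (use e in auto)
      let ?G = "G \<union> cball x (real R) \<union> H"
      have fG: "finite ?G"
        using G H bounded_geometry_finite_cball[OF bgX] by blast
      have "norm (V (single y v) - proj_on ?G id_blinfun (V (single y v)))
          \<le> norm (V (single y v) - proj_on H id_blinfun (V (single y v)))"
        by (rule norm_ell2_mono) (auto simp: coord_proj_on_id)
      moreover have "cmod (cinner (Z (single y v)) (single y' v')) \<le> e / 4"
      proof -
        have v: "norm v \<le> 1" "norm v' \<le> 1" using x(3) by (auto simp: bad_def)
        have "cinner (S (single y v)) (single y' v') = 0"
          using controlled_propagation[OF S(1), of y' y v] x(2)
          by (simp add: cinner_single_right dist_commute)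
        then have "cinner (Z (single y v)) (single y' v') = cinner ((Z - S) (single y v)) (single y' v')"
          by (simp add: blinfun.diff_left cinner_diff_left)
        then have "cmod (cinner (Z (single y v)) (single y' v')) \<le> norm ((Z - S) (single y v)) * norm v'"
          using cinner_cauchy_schwarz[of "(Z - S) (single y v)" "single y' v'"] by (simp add: norm_single)
        also have "\<dots> \<le> norm (Z - S) * 1"
          using v by (intro mult_mono norm_blinfun_unit_le) (auto simp: norm_single)
        finally show ?thesis using S(2) by simp
      qed
      moreover have "cball x (real R) \<inter> G = {}" using x(1) by (auto simp: dist_commute)
      ultimately have "good_step n Z G x b b' y v y' v' ?G"
        unfolding good_step_def using x H fG by auto
      then show ?thesis by blast
    qed
    then have "\<forall>p. \<exists>s. finite (snd (snd p)) \<and> fst (snd p) \<in> filtered_roe P \<longrightarrow>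
        (case s of (x, b, b', y, v, y', v', G') \<Rightarrow>
          good_step (fst p) (fst (snd p)) (snd (snd p)) x b b' y v y' v' G')"
      by simp
    then obtain h where h: "\<forall>p. finite (snd (snd p)) \<and> fst (snd p) \<in> filtered_roe P \<longrightarrow>
        (case h p of (x, b, b', y, v, y', v', G') \<Rightarrow>
          good_step (fst p) (fst (snd p)) (snd (snd p)) x b b' y v y' v' G')"
      by (rule choice[THEN exE])
    define fx fb fb' fy fv fy' fv' fG where "fx n Z G = fst (h (n, Z, G))"
      and "fb n Z G = fst (snd (h (n, Z, G)))"
      and "fb' n Z G = fst (snd (snd (h (n, Z, G))))"
      and "fy n Z G = fst (snd (snd (snd (h (n, Z, G)))))"
      and "fv n Z G = fst (snd (snd (snd (snd (h (n, Z, G))))))"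
      and "fy' n Z G = fst (snd (snd (snd (snd (snd (h (n, Z, G)))))))"
      and "fv' n Z G = fst (snd (snd (snd (snd (snd (snd (h (n, Z, G))))))))"
      and "fG n Z G = snd (snd (snd (snd (snd (snd (snd (h (n, Z, G))))))))" for n Z G
    have f: "good_step n Z G (fx n Z G) (fb n Z G) (fb' n Z G) (fy n Z G) (fv n Z G) (fy' n Z G)
        (fv' n Z G) (fG n Z G)" if "finite G" "Z \<in> filtered_roe P" for n Z G
      using h[rule_format, of "(n, Z, G)"] that
      by (simp add: fx_def fb_def fb'_def fy_def fv_def fy'_def fv'_def fG_def split_beta)
    \<comment> \<open>The state is the sum of the conjugated operators so far and the region used so
      far.\<close>
    define st where "st = rec_nat (0, {})
      (\<lambda>n (Z, G). (Z + (U o\<^sub>L butterfly (fb' n Z G) (fb n Z G) o\<^sub>L V), fG n Z G))"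
    define Z G where "Z n = fst (st n)" and "G n = snd (st n)" for n
    define x b b' y v y' v' where "x n = fx n (Z n) (G n)" and "b n = fb n (Z n) (G n)"
      and "b' n = fb' n (Z n) (G n)" and "y n = fy n (Z n) (G n)" and "v n = fv n (Z n) (G n)"
      and "y' n = fy' n (Z n) (G n)" and "v' n = fv' n (Z n) (G n)" for n
    have Z0: "Z 0 = 0" and ZS: "Z (Suc n) = Z n + (U o\<^sub>L butterfly (b' n) (b n) o\<^sub>L V)" for n
      by (simp_all add: Z_def G_def st_def b_def b'_def split_beta)
    have G0: "G 0 = {}" and GS: "G (Suc n) = fG n (Z n) (G n)" for n
      by (simp_all add: Z_def G_def st_def split_beta)
    have ZG: "finite (G n) \<and> Z n \<in> filtered_roe P" for n
    proof (induction n)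
      case (Suc n)
      then have "finite (G (Suc n))" using f[of "G n" "Z n" n] by (simp add: GS good_step_def)
      then show ?case
        using Suc by (simp add: ZS filtered_roe_add conj_U butterfly_in_filtered_roe)
    qed (simp add: Z0 G0 filtered_roe_zero)
    have step: "good_step n (Z n) (G n) (x n) (b n) (b' n) (y n) (v n) (y' n) (v' n) (G (Suc n))" for n
      unfolding GS x_def b_def b'_def y_def v_def y'_def v'_def using f ZG by blast
    have Gmono: "G i \<subseteq> G j" if "i \<le> j" for i j
      using that by (rule lift_Suc_mono_le[rotated]) (use step in \<open>auto simp: good_step_def\<close>)
    define B where "B n = cball (x n) (real R)" for n
    have BG: "B n \<inter> G n = {}" "B n \<subseteq> G (Suc n)" for n
      using step[of n] by (auto simp: good_step_def B_def)
    have BG': "B m \<subseteq> G n" if "m < n" for m n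
      using BG(2)[of m] Gmono[of "Suc m" n] that by auto
    have BG'': "B m \<inter> G n = {}" if "n \<le> m" for m n
      using BG(1)[of m] Gmono[of n m] that by auto
    have disj: "B m \<inter> B n = {}" if "m \<noteq> n" for m n
      using that BG'[of m n] BG'[of n m] BG(1)[of n] BG(1)[of m] by (cases "m < n") auto
    have nb: "norm (b n) \<le> 1" "norm (b' n) \<le> 1" "loc R (x n) (b n) = b n" "loc R (x n) (b' n) = b' n" for n
      using step[of n] by (auto simp: good_step_def bad_def)
    have sb: "coord (b n) z = 0" "coord (b' n) z = 0" if "z \<notin> B n" for n z
      using coord_loc[of R "x n" "b n" z] coord_loc[of R "x n" "b' n" z] that nb(3,4)[of n]
      by (auto simp: B_def)
    have Pb: "P R (coord (b n) z) = coord (b n) z" "P R (coord (b' n) z) = coord (b' n) z" for n z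
      using coord_loc[of R "x n" "b n" z] coord_loc[of R "x n" "b' n" z] nb(3,4)[of n]
      by (auto split: if_splits)
    obtain W :: "('x, 'h) ell2 \<Rightarrow>\<^sub>L ('x, 'h) ell2" where W: "clinear W" "norm W \<le> 1"
      "\<And>n f. (\<And>x. x \<notin> B n \<Longrightarrow> coord f x = 0) \<Longrightarrow> W f = cinner f (b n) *\<^sub>C b' n"
      "\<And>f. (\<And>n x. x \<in> B n \<Longrightarrow> coord f x = 0) \<Longrightarrow> W f = 0"
      by (rule orthogonal_block_operator[of B b b'])
         (use nb sb disj in \<open>auto simp: disjoint_family_on_def\<close>)
    have Ws: "coord (W (single z w)) z' = cinner w (coord (b n) z) *\<^sub>C coord (b' n) z'"
      if "z \<in> B n" for n z w z'
      using that by (subst W(3)[of n]) (auto simp: coord_single cinner_single_left)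
    have Ws0: "W (single z w) = 0" if "\<And>n. z \<notin> B n" for z w
      using that by (intro W(4)) (auto simp: coord_single)
    \<comment> \<open>Two points of a common ball of radius \<open>R\<close> are at most
      \<open>2 * R\<close> apart, and the blocks do not interact; so infinitely many summands keep
      one propagation bound.\<close>
    have "W \<in> controlled P (2 * R)"
    proof (rule controlledI[OF W(1)])
      fix z' z w
      consider n where "z \<in> B n" | "\<And>n. z \<notin> B n" by blast
      note cases = this
      show "matrix_entry W z' z \<in> compact_operators"
      proof (cases rule: cases)
        case (1 n)
        then have "matrix_entry W z' z = butterfly (coord (b' n) z') (coord (b n) z)"
          by (intro blinfun_eqI) (simp add: matrix_entry_apply Ws butterfly_apply)
        then show ?thesis by (simp add: compact_operators_butterfly)
      next
        case 2
        then have "matrix_entry W z' z = 0"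
          by (intro blinfun_eqI) (simp add: matrix_entry_apply Ws0)
        then show ?thesis by (simp add: compact_operators_zero)
      qed
      show "coord (W (single z w)) z' = 0" if d: "dist z' z > real (2 * R)"
      proof (cases rule: cases)
        case (1 n)
        have "z' \<notin> B n"
          using d 1 dist_triangle2[of z' z "x n"] by (auto simp: B_def dist_commute)
        then show ?thesis using 1 by (simp add: Ws sb)
      qed (simp add: Ws0)
      show "P (2 * R) (coord (W (single z w)) z') = coord (W (single z w)) z'"
      proof (cases rule: cases)
        case (1 n)
        have "P (2 * R) (coord (b' n) z') = coord (b' n) z'"
          using mono[of R "2 * R" "coord (b' n) z'"] by (simp add: Pb)
        then show ?thesis
          using 1 by (simp add: Ws clinear_scaleC[OF ortho_proj_clinear[OF proj]])
      qed (simp add: Ws0)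
      show "coord (W (single z (P (2 * R) w))) z' = coord (W (single z w)) z'"
      proof (cases rule: cases)
        case (1 n)
        have "P (2 * R) (coord (b n) z) = coord (b n) z"
          using mono[of R "2 * R" "coord (b n) z"] by (simp add: Pb)
        then show ?thesis
          using 1 by (simp add: Ws ortho_proj_cinner[OF proj])
      qed (simp add: Ws0)
    qed
    then have "W \<in> filtered_roe P"
      unfolding filtered_roe_def by (intro closure_subset[THEN subsetD]) auto
    then have "U o\<^sub>L W o\<^sub>L V \<in> filtered_roe P" by (rule conj_U)
    \<comment> \<open>The propagation bound \<open>n\<close> of the approximant decides which step
      to inspect: there \<open>y n\<close> and \<open>y' n\<close> are more than \<open>n\<close>
      apart.\<close>
    then obtain n S where S: "S \<in> controlled P n" "norm ((U o\<^sub>L W o\<^sub>L V) - S) < e / 4"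
      by (rule filtered_roe_approx[of _ _ "e / 4"]) (use e in auto)
    define \<eta> \<eta>' where "\<eta> = single (y n) (v n)" and "\<eta>' = single (y' n) (v' n)"
    define f where "f = V \<eta>"
    have vn: "norm \<eta> \<le> 1" "norm \<eta>' \<le> 1"
      using step[of n] by (auto simp: good_step_def bad_def \<eta>_def \<eta>'_def norm_single)
    \<comment> \<open>Balls of steps before \<open>k\<close> lie inside \<open>G k\<close> and all
      later ones miss it, so restricting to \<open>G k\<close> selects exactly the first
      \<open>k\<close> blocks.\<close>
    have WG: "W (proj_on (G k) id_blinfun f) = (\<Sum>m<k. cinner f (b m) *\<^sub>C b' m)" for k
    proof -
      have "W (proj_on (G k) id_blinfun f - (\<Sum>m<k. proj_on (B m) id_blinfun f)) = 0"
      proof (rule W(4))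
        fix j z assume z: "z \<in> B j"
        have "(\<Sum>m<k. if z \<in> B m then coord f z else 0) = (\<Sum>m<k. if m = j then coord f z else 0)"
          using z disj by (intro sum.cong) auto
        then have "(\<Sum>m<k. if z \<in> B m then coord f z else 0) = (if z \<in> G k then coord f z else 0)"
          using z BG'[of j k] BG''[of k j] by (cases "j < k") auto
        then show "coord (proj_on (G k) id_blinfun f - (\<Sum>m<k. proj_on (B m) id_blinfun f)) z = 0"
          by (simp add: coord_sum coord_proj_on_id)
      qed
      then have "W (proj_on (G k) id_blinfun f) = (\<Sum>m<k. W (proj_on (B m) id_blinfun f))"
        by (simp add: blinfun.diff_right blinfun.sum_right)
      also have "\<dots> = (\<Sum>m<k. cinner f (b m) *\<^sub>C b' m)"
      proof (rule sum.cong[OF refl])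
        fix m
        have "W (proj_on (B m) id_blinfun f) = cinner (proj_on (B m) id_blinfun f) (b m) *\<^sub>C b' m"
          by (rule W(3)) (simp add: coord_proj_on_id)
        also have "cinner (proj_on (B m) id_blinfun f) (b m) = cinner f (proj_on (B m) id_blinfun (b m))"
          by (rule ortho_proj_cinner[OF ortho_proj_proj_on[OF ortho_proj_id]])
        also have "proj_on (B m) id_blinfun (b m) = b m"
          by (rule ell2_eqI) (auto simp: coord_proj_on_id sb)
        finally show "W (proj_on (B m) id_blinfun f) = cinner f (b m) *\<^sub>C b' m" .
      qed
      finally show ?thesis .
    qed
    have Zn: "Z k \<eta> = (\<Sum>m<k. cinner f (b m) *\<^sub>C U (b' m))" for k
      by (induction k)
         (simp_all add: Z0 ZS blinfun.add_left butterfly_apply clinear_scaleC[OF uv(1)] f_def)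
    define g where "g = f - proj_on (G (Suc n)) id_blinfun f"
    have g: "norm g \<le> e / 4"
      using step[of n] by (simp add: good_step_def g_def f_def \<eta>_def)
    have "(U o\<^sub>L W o\<^sub>L V) \<eta> = U (W (proj_on (G (Suc n)) id_blinfun f)) + U (W g)"
      by (simp add: g_def f_def blinfun.diff_right)
    also have "U (W (proj_on (G (Suc n)) id_blinfun f)) = Z n \<eta> + cinner f (b n) *\<^sub>C U (b' n)"
      unfolding WG by (simp add: Zn blinfun.sum_right blinfun.add_right clinear_scaleC[OF uv(1)])
    \<comment> \<open>Earlier blocks, the \<open>n\<close>-th block, and the tail containing all
      later ones. The entry itself and the first and last parts are at most e/4 each, while the
      middle part exceeds \<open>e\<close>.\<close>
    finally have split: "cinner ((U o\<^sub>L W o\<^sub>L V) \<eta>) \<eta>' =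
        cinner (Z n \<eta>) \<eta>' + cinner f (b n) * cinner (b' n) (V \<eta>') + cinner (U (W g)) \<eta>'"
      by (simp add: cinner_add_left cinner_scaleC_left uv)
    have 1: "cmod (cinner ((U o\<^sub>L W o\<^sub>L V) \<eta>) \<eta>') \<le> e / 4"
    proof -
      have "cinner (S \<eta>) \<eta>' = 0"
        using controlled_propagation[OF S(1), of "y' n" "y n" "v n"] step[of n]
        by (simp add: \<eta>_def \<eta>'_def cinner_single_right dist_commute good_step_def)
      then have "cinner ((U o\<^sub>L W o\<^sub>L V) \<eta>) \<eta>' = cinner (((U o\<^sub>L W o\<^sub>L V) - S) \<eta>) \<eta>'"
        by (simp add: blinfun.diff_left cinner_diff_left)
      also have "cmod \<dots> \<le> norm (((U o\<^sub>L W o\<^sub>L V) - S) \<eta>) * norm \<eta>'"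
        by (rule cinner_cauchy_schwarz)
      also have "\<dots> \<le> norm ((U o\<^sub>L W o\<^sub>L V) - S) * 1"
        using vn by (intro mult_mono norm_blinfun_unit_le) auto
      finally show ?thesis using S(2) by simp
    qed
    have 2: "cmod (cinner (Z n \<eta>) \<eta>') \<le> e / 4"
      using step[of n] by (simp add: good_step_def \<eta>_def \<eta>'_def)
    have 3: "cmod (cinner (U (W g)) \<eta>') \<le> e / 4"
    proof -
      have "cmod (cinner (U (W g)) \<eta>') \<le> norm (W g) * norm \<eta>'"
        using cinner_cauchy_schwarz[of "U (W g)" \<eta>'] by (simp add: uv)
      also have "\<dots> \<le> (1 * norm g) * 1"
        using vn order_trans[OF norm_blinfun[of W g] mult_right_mono[OF W(2) norm_ge_zero]]
        by (intro mult_mono) auto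
      finally show ?thesis using g by simp
    qed
    have 4: "cmod (cinner f (b n) * cinner (b' n) (V \<eta>')) > e"
    proof -
      have "cmod (cinner f (b n)) = cmod (cinner (b n) f)"
        by (metis cinner_commute complex_mod_cnj)
      then show ?thesis
        using step[of n] by (simp add: norm_mult good_step_def bad_def f_def \<eta>_def \<eta>'_def)
    qed
    have "cmod (cinner f (b n) * cinner (b' n) (V \<eta>')) =
        cmod (cinner ((U o\<^sub>L W o\<^sub>L V) \<eta>) \<eta>' - cinner (Z n \<eta>) \<eta>' - cinner (U (W g)) \<eta>')"
      by (rule arg_cong[of _ _ cmod]) (use split in simp)
    then have "cmod (cinner f (b n) * cinner (b' n) (V \<eta>')) \<le> e / 4 + e / 4 + e / 4"
      using 1 2 3 norm_triangle_ineq4[of "cinner ((U o\<^sub>L W o\<^sub>L V) \<eta>) \<eta>' - cinner (Z n \<eta>) \<eta>'" "cinner (U (W g)) \<eta>'"]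
        norm_triangle_ineq4[of "cinner ((U o\<^sub>L W o\<^sub>L V) \<eta>) \<eta>'" "cinner (Z n \<eta>) \<eta>'"] by linarith
    then show False using 4 e by simp
  qed
  then show ?thesis
    using that unfolding bad_def by (metis not_le)
qed

section \<open>The uniform lower bound for the largest coordinate\<close>

text \<open>Compression by \<open>P m\<close> belongs to the statement because rank-one operators
  will be built from these coordinates and have to stay in one corner for all
  \<open>x\<close>.\<close>

lemma coordinate_lower_bound:
  obtains m d where "d > 0" "\<And>x. \<exists>y. norm (P m (coord (U (single x e0)) y)) \<ge> d"
proof -
  define u where "u x = U (single x e0)" for x
  define T where "T = U o\<^sub>L base_proj o\<^sub>L V"
  have Tu: "T (u x) = u x" for x by (simp add: T_def u_def uv base_proj_single)
  have nu: "norm (u x) = 1" for x by (simp add: u_def norm_U_single)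
  have "T \<in> filtered_roe P" unfolding T_def by (rule conj_U[OF base_proj_in])
  then obtain m S where S: "S \<in> controlled P m" "norm (T - S) < 1 / 4"
    by (rule filtered_roe_approx[of _ _ "1 / 4"]) auto
  define Q where "Q = (proj_on UNIV (P m) :: ('y, 'h) ell2 \<Rightarrow>\<^sub>L ('y, 'h) ell2)"
  have Q: "ortho_proj Q" unfolding Q_def by (rule ortho_proj_proj_on[OF proj])
  \<comment> \<open>\<open>S\<close> maps into the corner \<open>P m\<close>, and every
    \<open>u x\<close> is within 1/4 of \<open>S (u x)\<close>; so one corner holds all of
    \<open>u x\<close> up to a part of squared norm at most 1/16.\<close>
  have QS: "Q (S f) = S f" for f
  proof (rule ell2_eqI)
    fix y
    have "coord (S f) y = (\<Sum>z\<in>cball y (real m). matrix_entry S y z (coord f z))"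
      by (rule controlled_coord_sum[OF S(1) bounded_geometry_finite_cball[OF bgY]])
    then have "P m (coord (S f) y) = coord (S f) y"
      by (simp add: blinfun.sum_right matrix_entry_apply controlled_compose(1)[OF S(1)])
    then show "coord (Q (S f)) y = coord (S f) y"
      by (simp add: Q_def coord_proj_on[OF proj])
  qed
  define w where "w x = Q (u x)" for x
  have cw: "coord (w x) y = P m (coord (u x) y)" for x y
    by (simp add: w_def Q_def coord_proj_on[OF proj])
  have nw: "(norm (w x))\<^sup>2 \<ge> 15 / 16" for x
  proof -
    have "u x - w x = (T - S) (u x) - Q ((T - S) (u x))"
      by (simp add: blinfun.diff_left blinfun.diff_right QS Tu w_def)
    then have "norm (u x - w x) \<le> norm ((T - S) (u x))"
      using ortho_proj_compl_norm_le[OF Q] by metis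
    also have "\<dots> \<le> norm (T - S)" by (rule norm_blinfun_unit_le) (simp add: nu)
    finally have "norm (u x - w x) \<le> 1 / 4" using S(2) by simp
    then have "(norm (u x - w x))\<^sup>2 \<le> (1 / 4)\<^sup>2" by (intro power_mono) auto
    then show ?thesis
      using ortho_proj_pythagoras[OF Q, of "u x"] by (simp add: nu w_def power2_eq_square)
  qed
  \<comment> \<open>With 1/16, a difference of two errors is at most 1/8, and its square 1/64 times
    16 is the 1/4 that may be lost below.\<close>
  obtain R F1 where F1: "finite F1"
    "\<And>x A. x \<notin> F1 \<Longrightarrow> norm (V (proj_on A (P m) (u x)) - loc R x (V (proj_on A (P m) (u x)))) \<le> 1 / 16"
    unfolding u_def by (rule restriction_localizes[of "1 / 16" m]) auto
  obtain F2 L where F2: "finite F2"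
    "\<And>x b b' y y' v v'. \<lbrakk>x \<notin> F2; loc R x b = b; loc R x b' = b'; norm b \<le> 1; norm b' \<le> 1;
       norm v \<le> 1; norm v' \<le> 1; dist y y' > real L\<rbrakk> \<Longrightarrow>
       cmod (cinner b (V (single y v))) * cmod (cinner b' (V (single y' v'))) \<le> 1 / 4"
    by (rule rank_one_separation[of "1 / 4" R]) auto
  obtain N where N: "\<And>y :: 'y. card (cball y (real L)) \<le> N"
    using bounded_geometry_card_cball[OF bgY] by blast
  \<comment> \<open>A ball of radius \<open>L\<close> has at most \<open>N\<close> points; with
    coordinates bounded by \<open>d\<close> they carry squared mass at most 1/4.\<close>
  define d where "d = 1 / (2 * (real N + 1))"
  have d: "d > 0" by (simp add: d_def add_nonneg_pos)
  have "real N * d\<^sup>2 \<le> (real N + 1) * d\<^sup>2" by (simp add: mult_right_mono)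
  also have "\<dots> = 1 / (4 * (real N + 1))"
    unfolding d_def by (simp add: divide_simps power2_eq_square) (simp add: algebra_simps)
  also have "\<dots> \<le> 1 / 4" by (simp add: divide_simps)
  finally have Nd: "real N * d\<^sup>2 \<le> 1 / 4" .
  have main: "\<exists>y. norm (P m (coord (u x) y)) \<ge> d" if x: "x \<notin> F1 \<union> F2" for x
  proof (rule ccontr)
    assume "\<not> ?thesis"
    then have small: "norm (P m (coord (u x) y)) \<le> d" for y
      by (meson linear)
    define c where "c y = P m (coord (u x) y)" for y
    define r where "r y = V (single y (c y)) - loc R x (V (single y (c y)))" for y
    obtain H where H: "finite H" "norm (w x - proj_on H id_blinfun (w x)) < 1 / 8"
      by (rule finite_tail[of "1 / 8" "w x"]) auto
    \<comment> \<open>What remains is at least 15/16 - 1/64, more than 3/4.\<close>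
    have sumH: "(\<Sum>y\<in>H. (norm (c y))\<^sup>2) \<ge> 3 / 4"
    proof -
      have "(norm (w x - proj_on H id_blinfun (w x)))\<^sup>2 \<le> (1 / 8)\<^sup>2"
        using H(2) by (intro power_mono) auto
      then have "(norm (proj_on H id_blinfun (w x)))\<^sup>2 \<ge> 3 / 4"
        using ortho_proj_pythagoras[OF ortho_proj_proj_on[OF ortho_proj_id], of "w x" H] nw[of x]
        by (simp add: power2_eq_square)
      then show ?thesis
        by (simp add: norm_proj_on_finite[OF ortho_proj_id H(1)] cw c_def)
    qed
    have r_sum: "norm (\<Sum>y\<in>J. r y) \<le> 1 / 16" if "J \<subseteq> H" for J
    proof -
      have "finite J" using that H(1) by (rule finite_subset)
      then have "proj_on J (P m) (u x) = (\<Sum>y\<in>J. single y (c y))"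
        by (simp add: proj_on_finite[OF proj] c_def)
      then have "(\<Sum>y\<in>J. r y) = V (proj_on J (P m) (u x)) - loc R x (V (proj_on J (P m) (u x)))"
        by (simp add: r_def sum_subtractf blinfun.sum_right)
      then show ?thesis using F1(2)[of x J] x by simp
    qed
    txt \<open>Averaging over signs turns the uniform bound over subsets into a square-sum bound.\<close>
    have "(norm (0 :: ('x, 'h) ell2))\<^sup>2 + (\<Sum>y\<in>H. (norm (r y))\<^sup>2) \<le> (1 / 8)\<^sup>2"
    proof (rule sum_norm_squares_le_signed_sums[OF H(1)])
      fix J assume "J \<subseteq> H"
      then show "norm (0 + (\<Sum>y\<in>J. r y) - (\<Sum>y\<in>H - J. r y)) \<le> 1 / 8"
        using r_sum[of J] r_sum[of "H - J"] norm_triangle_ineq4[of "\<Sum>y\<in>J. r y" "\<Sum>y\<in>H - J. r y"]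
        by simp
    qed
    then have sumr: "(\<Sum>y\<in>H. (norm (r y))\<^sup>2) \<le> 1 / 64" by (simp add: power2_eq_square)
    \<comment> \<open>The points whose localization error is small relative to the coordinate
      itself. All others together carry at most 16/64 of the mass, leaving at least 1/2 for
      \<open>K\<close>.\<close>
    define K where "K = {y \<in> H. 4 * norm (r y) \<le> norm (c y) \<and> c y \<noteq> 0}"
    have K: "K \<subseteq> H" "finite K" using H(1) by (auto simp: K_def)
    have "(\<Sum>y\<in>H - K. (norm (c y))\<^sup>2) \<le> (\<Sum>y\<in>H - K. 16 * (norm (r y))\<^sup>2)"
    proof (rule sum_mono)
      fix y assume "y \<in> H - K"
      then have "norm (c y) \<le> 4 * norm (r y)" by (auto simp: K_def)
      then have "(norm (c y))\<^sup>2 \<le> (4 * norm (r y))\<^sup>2" by (intro power_mono) auto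
      then show "(norm (c y))\<^sup>2 \<le> 16 * (norm (r y))\<^sup>2" by (simp add: power_mult_distrib)
    qed
    also have "\<dots> \<le> 16 * (\<Sum>y\<in>H. (norm (r y))\<^sup>2)"
      unfolding sum_distrib_left by (rule sum_mono2) (use H in auto)
    also have "\<dots> \<le> 1 / 4" using sumr by simp
    finally have "(\<Sum>y\<in>K. (norm (c y))\<^sup>2) \<ge> 1 / 2"
      using sumH sum.subset_diff[OF K(1) H(1), of "\<lambda>y. (norm (c y))\<^sup>2"] by simp
    moreover have near: "(\<Sum>y\<in>K. (norm (c y))\<^sup>2) \<le> 1 / 4" if "K \<subseteq> cball y0 (real L)" for y0
    proof -
      have "(\<Sum>y\<in>K. (norm (c y))\<^sup>2) \<le> real (card K) * d\<^sup>2"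
        using small by (intro sum_bounded_above power_mono) (auto simp: c_def)
      also have "\<dots> \<le> real N * d\<^sup>2"
        using card_mono[OF bounded_geometry_finite_cball[OF bgY] that] N[of y0]
        by (intro mult_right_mono) auto
      finally show ?thesis using Nd by simp
    qed
    \<comment> \<open>Mass at least 1/2 does not fit into a ball that holds at most 1/4.\<close>
    ultimately have far: "\<not> K \<subseteq> cball y0 (real L)" for y0 by force
    then obtain y0 where y0: "y0 \<in> K" by blast
    with far[of y0] obtain y1 where y1: "y1 \<in> K" "dist y0 y1 > real L" by (auto simp: subset_iff not_le)
    define v where "v y = c y /\<^sub>R norm (c y)" for y
    define b where "b y = loc R x (V (single y (v y)))" for y
    have nv: "norm (v y) \<le> 1" for y by (cases "c y = 0") (simp_all add: v_def)
    have nb: "norm (b y) \<le> 1" for y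
      using ortho_proj_norm_le[OF ortho_proj_loc, of R x "V (single y (v y))"] nv[of y]
      by (simp add: b_def uv norm_single)
    have lb: "loc R x (b y) = b y" for y
      by (simp add: b_def ortho_proj_idem[OF ortho_proj_loc])
    \<comment> \<open>\<open>f\<close> is a unit vector within 1/4 of its localization. Its pairing
      with that localization is the squared norm of the latter, at least 1 - 1/16.\<close>
    have large: "cmod (cinner (b y) (V (single y (v y)))) \<ge> 15 / 16" if y: "y \<in> K" for y
    proof -
      define f where "f = V (single y (v y))"
      have cy: "norm (c y) > 0" "4 * norm (r y) \<le> norm (c y)" using y by (auto simp: K_def)
      have "norm f = 1" using cy by (simp add: f_def uv norm_single v_def)
      moreover have "norm (f - loc R x f) \<le> 1 / 4"
      proof -
        have "single y (v y) = single y (c y) /\<^sub>R norm (c y)"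
          unfolding v_def by (rule linear_scale[OF bounded_linear.linear[OF bounded_linear_single]])
        then have "f - loc R x f = r y /\<^sub>R norm (c y)"
          by (simp add: f_def r_def blinfun.scaleR_right scaleR_diff_right)
        then have "norm (f - loc R x f) = norm (r y) / norm (c y)"
          using cy by (simp add: divide_inverse mult.commute)
        also have "\<dots> \<le> 1 / 4" using cy by (simp add: divide_simps)
        finally show ?thesis .
      qed
      then have "(norm (f - loc R x f))\<^sup>2 \<le> (1 / 4)\<^sup>2" by (intro power_mono) auto
      ultimately have "(norm (loc R x f))\<^sup>2 \<ge> 15 / 16"
        using ortho_proj_pythagoras[OF ortho_proj_loc, of f R x] by (simp add: power2_eq_square)
      moreover have "cinner (loc R x f) f = cinner (loc R x f) (loc R x f)"
        using ortho_proj_cinner[OF ortho_proj_loc, of R x "loc R x f" f]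
        by (simp add: ortho_proj_idem[OF ortho_proj_loc])
      ultimately show ?thesis
        by (simp add: b_def f_def[symmetric] cinner_self norm_power)
    qed
    \<comment> \<open>The square of 15/16 is far above the 1/4 that separation permits.\<close>
    have "15 / 16 * (15 / 16) \<le> cmod (cinner (b y0) (V (single y0 (v y0)))) * cmod (cinner (b y1) (V (single y1 (v y1))))"
      by (intro mult_mono large y0 y1(1)) auto
    also have "\<dots> \<le> 1 / 4"
      using x by (intro F2(2)[of x] lb nb nv y1(2)) auto
    finally show False by simp
  qed
  \<comment> \<open>For the finitely many exceptional points it suffices that \<open>w x\<close> is
    not 0.\<close>
  have "\<exists>y. norm (P m (coord (u x) y)) > 0" for x
  proof (rule ccontr)
    assume "\<not> ?thesis"
    then have "w x = 0" by (intro ell2_eqI) (simp add: cw)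
    then show False using nw[of x] by simp
  qed
  then obtain d' where d': "d' > 0" "\<forall>x\<in>F1 \<union> F2. \<exists>y. norm (P m (coord (u x) y)) \<ge> d'"
    using finite_uniform_lower_bound[of "F1 \<union> F2" "\<lambda>x y. norm (P m (coord (u x) y))"] F1(1) F2(1) by auto
  have "\<exists>y. norm (P m (coord (u x) y)) \<ge> min d d'" for x
    using main[of x] d'(2) by (cases "x \<in> F1 \<union> F2") (meson min.coboundedI1 min.coboundedI2)+
  then show ?thesis using that[of "min d d'" m] d d'(1) unfolding u_def by simp
qed

section \<open>Coarse maps read off from large coordinates\<close>

text \<open>Two vectors \<open>single x e0\<close> and \<open>single x' e0\<close> with
  \<open>x'\<close> within \<open>r\<close> of \<open>x\<close> both lie in the range of one
  \<open>loc R x\<close>. The vectors paired with them sit at \<open>f x\<close> and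
  \<open>f x'\<close>, so separation bounds the distance of these points.\<close>

lemma large_coord_expansive:
  assumes d: "d > 0" and f: "\<And>x. norm (coord (U (single x e0)) (f x)) \<ge> d"
  shows "\<exists>s. \<forall>x x'. dist x x' \<le> r \<longrightarrow> dist (f x) (f x') \<le> s"
proof -
  define R where "R = max m0 (nat \<lceil>r\<rceil>)"
  have Rr: "r \<le> real R" unfolding R_def by (meson max.cobounded2 of_nat_mono order_trans real_nat_ceiling_ge)
  have PR: "P R e0 = e0" using mono[of m0 R e0] e0 by (simp add: R_def)
  obtain F L where F: "finite F"
    "\<And>x b b' y y' v v'. \<lbrakk>x \<notin> F; loc R x b = b; loc R x b' = b'; norm b \<le> 1; norm b' \<le> 1;
       norm v \<le> 1; norm v' \<le> 1; dist y y' > real L\<rbrakk> \<Longrightarrow>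
       cmod (cinner b (V (single y v))) * cmod (cinner b' (V (single y' v'))) \<le> d\<^sup>2 / 2"
    by (rule rank_one_separation[of "d\<^sup>2 / 2" R]) (use d in auto)
  have outside: "dist (f x) (f x') \<le> real L" if x: "x \<notin> F" "dist x x' \<le> r" for x x'
  proof (rule ccontr)
    assume "\<not> dist (f x) (f x') \<le> real L"
    then have far: "dist (f x) (f x') > real L" by simp
    \<comment> \<open>Normalizing the coordinate turns the inner product into its norm, at least
      \<open>d\<close>; hence the threshold of half of \<open>d\<^sup>2\<close> for
      separation.\<close>
    define v where "v z = sgn (coord (U (single z e0)) (f z))" for z
    have nv: "norm (v z) \<le> 1" for z by (simp add: v_def norm_sgn)
    have large: "cmod (cinner (single z e0) (V (single (f z) (v z)))) \<ge> d" for z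
    proof -
      let ?c = "coord (U (single z e0)) (f z)"
      have "cinner (single z e0) (V (single (f z) (v z))) = cinner ?c (sgn ?c)"
        by (simp add: v_def cinner_single_right flip: uv(5))
      also have "\<dots> = of_real (norm ?c)" by (rule cinner_sgn)
      finally show ?thesis using f[of z] by simp
    qed
    have loc: "loc R x (single z e0) = single z e0" if "dist x z \<le> r" for z
      using that Rr by (intro ell2_eqI) (auto simp: coord_loc coord_single PR)
    have "dist x x \<le> r" using x(2) by (meson dist_self order_trans zero_le_dist order.trans dist_self[THEN eq_refl])
    have "d\<^sup>2 \<le> cmod (cinner (single x e0) (V (single (f x) (v x)))) *
        cmod (cinner (single x' e0) (V (single (f x') (v x'))))"
      unfolding power2_eq_square using d by (intro mult_mono large) auto
    also have "\<dots> \<le> d\<^sup>2 / 2"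
      by (rule F(2)[of x]) (use x \<open>dist x x \<le> r\<close> far in \<open>auto intro!: loc simp: norm_single e0 nv\<close>)
    finally show False using d by simp
  qed
  \<comment> \<open>For \<open>x\<close> in \<open>F\<close> only finitely many pairs at distance at
    most \<open>r\<close> remain.\<close>
  have "finite (SIGMA x:F. cball x r)"
    using F(1) bounded_geometry_finite_cball[OF bgX] by blast
  from finite_dist_bounded[OF this, of "\<lambda>p. f (fst p)" "\<lambda>p. f (snd p)"]
  obtain s where "\<forall>p\<in>(SIGMA x:F. cball x r). dist (f (fst p)) (f (snd p)) \<le> s" by blast
  then have s: "dist (f x) (f x') \<le> s" if "x \<in> F" "dist x x' \<le> r" for x x'
    using that by (force dest: bspec[of _ _ "(x, x')"])
  show ?thesis
    by (rule exI[of _ "max s (real L)"]) (metis s outside max.coboundedI1 max.coboundedI2)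
qed

text \<open>Separation is applied with the spaces exchanged and centre \<open>f x\<close>. Both
  local vectors sit at the single point \<open>f x\<close>; one sees \<open>U (single x e0)\<close>,
  the other a vector coming from the point \<open>g (f x)\<close>, so these two points cannot be far
  apart.\<close>

lemma large_coord_inverse:
  assumes d: "d > 0" and f: "\<And>x. norm (P m (coord (U (single x e0)) (f x))) \<ge> d"
    and d': "d' > 0" and g: "\<And>y. norm (coord (V (single y e0)) (g y)) \<ge> d'"
  shows "\<exists>C. \<forall>x. dist x (g (f x)) \<le> C"
proof -
  interpret sym: rigid_pair P V U e0 m0 by (rule rigid_pair_sym)
  define R where "R = max m0 m"
  have PR: "P R e0 = e0" using mono[of m0 R e0] e0 by (simp add: R_def)
  have dd: "d * d' > 0" using d d' by simp
  obtain F L where F: "finite F"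
    "\<And>x b b' y y' v v'. \<lbrakk>x \<notin> F; sym.loc R x b = b; sym.loc R x b' = b'; norm b \<le> 1; norm b' \<le> 1;
       norm v \<le> 1; norm v' \<le> 1; dist y y' > real L\<rbrakk> \<Longrightarrow>
       cmod (cinner b (U (single y v))) * cmod (cinner b' (U (single y' v'))) \<le> d * d' / 2"
    by (rule sym.rank_one_separation[of "d * d' / 2" R]) (use dd in auto)
  have outside: "dist x (g (f x)) \<le> real L" if x: "f x \<notin> F" for x
  proof (rule ccontr)
    assume "\<not> dist x (g (f x)) \<le> real L"
    then have far: "dist x (g (f x)) > real L" by simp
    define c where "c = coord (U (single x e0)) (f x)"
    \<comment> \<open>The coordinate is compressed before normalizing, which places \<open>w\<close>
      in the corner \<open>P R\<close>, as locality demands.\<close>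
    define w where "w = sgn (P m c)"
    define v where "v = sgn (coord (V (single (f x) e0)) (g (f x)))"
    have Pw: "P m w = w"
      by (simp add: w_def sgn_div_norm blinfun.scaleR_right ortho_proj_idem[OF proj])
    have "cinner w c = cinner w (P m c)"
      using ortho_proj_cinner[OF proj, of m w c] by (simp add: Pw)
    also have "\<dots> = of_real (norm (P m c))"
      using cinner_sgn[of "P m c"] cinner_commute[of w "P m c"] by (simp add: w_def)
    finally have 1: "cmod (cinner (single (f x) w) (U (single x e0))) \<ge> d"
      using f[of x] by (simp add: cinner_single_left c_def)
    have "cinner (single (f x) e0) (U (single (g (f x)) v)) = cinner (V (single (f x) e0)) (single (g (f x)) v)"
      by (simp add: uv)
    then have 2: "cmod (cinner (single (f x) e0) (U (single (g (f x)) v))) \<ge> d'"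
      using g[of "f x"] by (simp add: cinner_single_right v_def cinner_sgn)
    have "P R w = w" using mono[of m R w] by (simp add: R_def Pw)
    then have loc: "sym.loc R (f x) (single (f x) w) = single (f x) w"
      "sym.loc R (f x) (single (f x) e0) = single (f x) e0"
      by (auto intro!: ell2_eqI simp: sym.coord_loc coord_single PR)
    have "d * d' \<le> cmod (cinner (single (f x) w) (U (single x e0))) *
        cmod (cinner (single (f x) e0) (U (single (g (f x)) v)))"
      using d d' by (intro mult_mono 1 2) auto
    also have "\<dots> \<le> d * d' / 2"
      by (rule F(2)[OF x loc]) (use far in \<open>auto simp: norm_single e0 w_def v_def norm_sgn\<close>)
    finally show False using dd by simp
  qed
  \<comment> \<open>A given point carries a large coordinate of \<open>U (single x e0)\<close> for
    finitely many \<open>x\<close> only.\<close>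
  have "{x. f x \<in> F} \<subseteq> (\<Union>y\<in>F. {x. norm (coord (U (single x e0)) y) \<ge> d})"
  proof
    fix x assume "x \<in> {x. f x \<in> F}"
    moreover have "norm (coord (U (single x e0)) (f x)) \<ge> d"
      using f[of x] ortho_proj_norm_le[OF proj] by (rule order_trans)
    ultimately show "x \<in> (\<Union>y\<in>F. {x. norm (coord (U (single x e0)) y) \<ge> d})" by blast
  qed
  then have "finite {x. f x \<in> F}"
    by (rule finite_subset) (use F(1) finite_large_coord_U[OF d] in blast)
  from finite_dist_bounded[OF this, of "\<lambda>x. x" "\<lambda>x. g (f x)"]
  obtain s where s: "\<And>x. f x \<in> F \<Longrightarrow> dist x (g (f x)) \<le> s" by auto
  show ?thesis
    by (rule exI[of _ "max s (real L)"]) (metis s outside max.coboundedI1 max.coboundedI2)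
qed

lemma coarse_equivalence: "coarsely_equivalent TYPE('x) TYPE('y)"
proof -
  interpret sym: rigid_pair P V U e0 m0 by (rule rigid_pair_sym)
  obtain m d where d: "d > 0" "\<And>x. \<exists>y. norm (P m (coord (U (single x e0)) y)) \<ge> d"
    using coordinate_lower_bound by blast
  obtain n d' where d': "d' > 0" "\<And>y. \<exists>x. norm (P n (coord (V (single y e0)) x)) \<ge> d'"
    using sym.coordinate_lower_bound by blast
  obtain f where f: "\<And>x. norm (P m (coord (U (single x e0)) (f x))) \<ge> d" using d(2) by metis
  obtain g where g: "\<And>y. norm (P n (coord (V (single y e0)) (g y))) \<ge> d'" using d'(2) by metis
  have f': "norm (coord (U (single x e0)) (f x)) \<ge> d" for x
    using f[of x] ortho_proj_norm_le[OF proj] order_trans by blast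
  have g': "norm (coord (V (single y e0)) (g y)) \<ge> d'" for y
    using g[of y] ortho_proj_norm_le[OF proj] order_trans by blast
  show ?thesis
    by (rule coarsely_equivalentI[of f g])
       (rule large_coord_expansive[OF d(1) f'] sym.large_coord_expansive[OF d'(1) g']
         large_coord_inverse[OF d(1) f d'(1) g'] sym.large_coord_inverse[OF d'(1) g d(1) f'])+
qed

end

section \<open>Orthonormal bases\<close>

text \<open>\<open>J\<close> takes basis coefficients and is bounded by Bessel. A preimage of
  \<open>c\<close> is the Riesz representative of pairing \<open>J u\<close> with \<open>c\<close>,
  so surjectivity and the adjoint relation come together.\<close>

lemma orthonormal_basis_unitary:
  fixes e :: "'i \<Rightarrow> 'a::complex_hilbert_space"
  assumes on: "\<And>i j. cinner (e i) (e j) = (if i = j then 1 else 0)"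
    and total: "\<And>v. (\<And>i. cinner v (e i) = 0) \<Longrightarrow> v = 0"
  obtains J :: "'a \<Rightarrow>\<^sub>L ('i, complex) ell2" and K where "unitary_pair J K"
    "\<And>v i. coord (J v) i = cinner v (e i)"
proof -
  have ne: "norm (e i) \<le> 1" for i
    using on[of i i] by (simp add: cinner_self_eq_1_iff)
  have "\<exists>T :: 'a \<Rightarrow>\<^sub>L ('i, complex) ell2. clinear T \<and> (\<forall>f x. coord (T f) x = cinner f (e x)) \<and> norm T \<le> 1"
  proof (rule ell2_operator)
    show "(\<Sum>x\<in>F. (cmod (cinner f (e x)))\<^sup>2) \<le> (1 * norm f)\<^sup>2" if "finite F" for f F
      using bessel[OF that, of e f] on ne by simp
  qed (auto simp: cinner_add_left cinner_scaleC_left scaleC_complex_def)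
  then obtain J :: "'a \<Rightarrow>\<^sub>L ('i, complex) ell2" where
    J: "clinear J" "\<And>v i. coord (J v) i = cinner v (e i)" by blast
  have J_surj: "\<exists>v. J v = c \<and> (\<forall>u. cinner (J u) c = cinner u v)" for c
  proof -
    have "\<exists>v. \<forall>u. cinner (J u) c = cinner u v"
    proof (rule hilbert_riesz)
      show "cinner (J (u + v)) c = cinner (J u) c + cinner (J v) c" for u v
        by (simp add: blinfun.add_right cinner_add_left)
      show "cinner (J (k *\<^sub>C u)) c = k * cinner (J u) c" for k u
        by (simp add: clinear_scaleC[OF J(1)] cinner_scaleC_left)
      show "cmod (cinner (J u) c) \<le> (norm J * norm c) * norm u" for u
        using cinner_cauchy_schwarz[of "J u" c] mult_right_mono[OF norm_blinfun[of J u] norm_ge_zero[of c]]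
        by (simp add: mult_ac)
    qed
    then obtain v where v: "\<And>u. cinner (J u) c = cinner u v" by blast
    have "J v = c"
    proof (rule ell2_eqI)
      fix i
      have "J (e i) = single i 1"
        by (rule ell2_eqI) (auto simp: J on coord_single)
      then have "cinner (e i) v = cnj (coord c i)"
        using v[of "e i"] by (simp add: cinner_single_left cinner_complex_def)
      then show "coord (J v) i = coord c i"
        using cinner_commute[of v "e i"] by (simp add: J)
    qed
    then show ?thesis using v by blast
  qed
  have J_inj: "u = v" if "J u = J v" for u v
  proof -
    have "cinner (u - v) (e i) = 0" for i
      using arg_cong[OF that, of "\<lambda>f. coord f i"] by (simp add: J cinner_diff_left)
    then show ?thesis using total[of "u - v"] by simp
  qed
  \<comment> \<open>The representative for \<open>c = J v\<close> has the same image as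
    \<open>v\<close>, so by injectivity it is \<open>v\<close>.\<close>
  have "cinner (J u) (J v) = cinner u v" for u v
    using J_surj[of "J v"] J_inj by metis
  then obtain U V where "unitary_pair U V" "\<And>v. U v = J v"
    using unitary_pair_of_isometry[of J] J_surj
    by (metis blinfun.add_right clinear_scaleC[OF J(1)])
  then show ?thesis by (intro that[of U V]) (auto simp: J)
qed

text \<open>A maximal orthonormal set exists by Zorn. Its points are at least 1 apart, so a
  countable dense set bounds its size; were it finite, it would span.\<close>

lemma separable_orthonormal_basis:
  assumes sep: "separable_infinite_dimensional TYPE('h::complex_hilbert_space)"
  obtains e :: "nat \<Rightarrow> 'h::complex_hilbert_space" where "\<And>i j. cinner (e i) (e j) = (if i = j then 1 else 0)"
    "\<And>v. (\<And>i. cinner v (e i) = 0) \<Longrightarrow> v = 0"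
proof -
  define ons where "ons = {S :: 'h set. \<forall>u\<in>S. \<forall>v\<in>S. cinner u v = (if u = v then 1 else 0)}"
  have "\<exists>M\<in>ons. \<forall>X\<in>ons. M \<subseteq> X \<longrightarrow> X = M"
  proof (rule subset_Zorn')
    fix C assume C: "subset.chain ons C"
    show "\<Union>C \<in> ons"
      unfolding ons_def
    proof (intro CollectI ballI)
      fix u v assume "u \<in> \<Union>C" "v \<in> \<Union>C"
      then obtain S where "S \<in> C" "u \<in> S" "v \<in> S"
        using C unfolding subset_chain_def by blast
      then show "cinner u v = (if u = v then 1 else 0)"
        using C unfolding subset_chain_def ons_def by blast
    qed
  qed
  then obtain M where M: "M \<in> ons" "\<And>X. X \<in> ons \<Longrightarrow> M \<subseteq> X \<Longrightarrow> X = M" by blast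
  have on: "cinner u v = (if u = v then 1 else 0)" if "u \<in> M" "v \<in> M" for u v
    using M(1) that by (simp add: ons_def)
  have total: "v = 0" if v: "\<And>u. u \<in> M \<Longrightarrow> cinner v u = 0" for v
  proof (rule ccontr)
    assume "v \<noteq> 0"
    define w where "w = complex_of_real (inverse (norm v)) *\<^sub>C v"
    have ww: "cinner w w = 1"
      unfolding cinner_self_eq_1_iff using \<open>v \<noteq> 0\<close> by (simp add: w_def norm_scaleC norm_inverse)
    have wM: "cinner w u = 0" "cinner u w = 0" if "u \<in> M" for u
      using v[OF that] cinner_eq_0_commute[of u v] by (simp_all add: w_def cinner_scaleC_left cinner_scaleC_right)
    have wnM: "w \<notin> M" using wM(1)[of w] ww by auto
    then have "insert w M \<in> ons"
      unfolding ons_def by (auto simp: on ww wM)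
    then show False using M(2)[of "insert w M"] wnM by blast
  qed
  obtain D :: "'h set" where D: "countable D" "closure D = UNIV"
    and infinite_dim: "\<not> (\<exists>B :: 'h set. finite B \<and> cspan B = UNIV)"
    using sep unfolding separable_infinite_dimensional_def by blast
  have dist_M: "dist u v \<ge> 1" if "u \<in> M" "v \<in> M" "u \<noteq> v" for u v
  proof -
    have "norm u = 1"
      using on[OF that(1,1)] by (simp add: cinner_self_eq_1_iff)
    have "(norm (u + (- v)))\<^sup>2 = (norm u)\<^sup>2 + (norm (- v))\<^sup>2"
      by (rule norm_add_orthogonal) (simp add: cinner_minus_right on that)
    then have "(norm (u - v))\<^sup>2 \<ge> 1\<^sup>2" using \<open>norm u = 1\<close> by simp
    then show ?thesis unfolding dist_norm by (rule power2_le_imp_le) simp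
  qed
  have "\<exists>d\<in>D. dist d u < 1 / 2" for u
  proof -
    have "u \<in> closure D" by (simp add: D(2))
    then show ?thesis unfolding closure_approachable by (metis half_gt_zero zero_less_one)
  qed
  then obtain p where p: "\<And>u. p u \<in> D" "\<And>u. dist (p u) u < 1 / 2" by metis
  have "inj_on p M"
  proof (rule inj_onI, rule ccontr)
    fix u v assume uv: "u \<in> M" "v \<in> M" "p u = p v" "u \<noteq> v"
    have "dist u v \<le> dist (p u) u + dist (p v) v"
      using dist_triangle2[of u v "p u"] uv(3) by (simp add: dist_commute)
    then show False using dist_M[OF uv(1,2,4)] p(2)[of u] p(2)[of v] by linarith
  qed
  then have cM: "countable M"
    by (rule countable_image_inj_on[rotated]) (use D(1) p(1) countable_subset[of "p ` M" D] in blast)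
  have iM: "infinite M"
  proof
    assume fM: "finite M"
    have "v \<in> cspan M" for v
    proof -
      \<comment> \<open>Subtracting the finite expansion leaves a vector orthogonal to
        \<open>M\<close>, and maximality makes it vanish.\<close>
      have "v - (\<Sum>u\<in>M. cinner v u *\<^sub>C u) = 0"
      proof (rule total)
        fix w assume w: "w \<in> M"
        have "(\<Sum>u\<in>M. cinner v u * cinner u w) = (\<Sum>u\<in>M. if u = w then cinner v w else 0)"
          by (rule sum.cong) (auto simp: on w)
        then show "cinner (v - (\<Sum>u\<in>M. cinner v u *\<^sub>C u)) w = 0"
          using w fM by (simp add: cinner_diff_left cinner_sum_left cinner_scaleC_left)
      qed
      moreover have "(\<Sum>u\<in>M. cinner v u *\<^sub>C u) \<in> cspan M"
        by (intro complex_vector.span_sum complex_vector.span_scale complex_vector.span_base)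
      ultimately show ?thesis by simp
    qed
    then show False using infinite_dim fM by blast
  qed
  define e where "e = from_nat_into M"
  have bij: "bij_betw e UNIV M"
    unfolding e_def by (rule bij_betw_from_nat_into[OF cM iM])
  have eM: "e i \<in> M" for i using bij by (auto simp: bij_betw_def)
  have einj: "e i = e j \<longleftrightarrow> i = j" for i j using bij by (auto simp: bij_betw_def inj_on_def)
  have "v = 0" if v: "\<And>i. cinner v (e i) = 0" for v
  proof (rule total)
    fix u assume "u \<in> M"
    then obtain i where "u = e i" using bij by (auto simp: bij_betw_def)
    then show "cinner v u = 0" using v by simp
  qed
  then show ?thesis by (intro that[of e]) (simp_all add: on[OF eM eM] einj)
qed

section \<open>Truncation to finitely many basis vectors\<close>

locale onb =
  fixes e :: "nat \<Rightarrow> 'h::complex_hilbert_space"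
  assumes on: "cinner (e i) (e j) = (if i = j then 1 else 0)"
    and total: "(\<And>i. cinner v (e i) = 0) \<Longrightarrow> v = 0"
begin

definition trunc :: "nat \<Rightarrow> 'h \<Rightarrow>\<^sub>L 'h" where
  "trunc n = (\<Sum>i<n. butterfly (e i) (e i))"

lemma trunc_apply: "trunc n v = (\<Sum>i<n. cinner v (e i) *\<^sub>C e i)"
  by (simp add: trunc_def blinfun.sum_left butterfly_apply)

lemma cinner_trunc: "cinner (trunc n v) (e j) = (if j < n then cinner v (e j) else 0)"
proof -
  have "cinner (trunc n v) (e j) = (\<Sum>i<n. if i = j then cinner v (e j) else 0)"
    unfolding trunc_apply cinner_sum_left by (rule sum.cong) (auto simp: cinner_scaleC_left on)
  then show ?thesis by simp
qed

lemma onb_eqI: "(\<And>i. cinner u (e i) = cinner v (e i)) \<Longrightarrow> u = v"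
  using total[of "u - v"] by (simp add: cinner_diff_left)

lemma norm_basis: "norm (e i) = 1"
  using on[of i i] by (simp add: cinner_self_eq_1_iff)

lemma ortho_proj_trunc: "ortho_proj (trunc n)"
  unfolding ortho_proj_def
proof (intro conjI allI)
  show "clinear (trunc n)"
    by (auto simp: clinear_def trunc_apply cinner_scaleC_left complex_vector.scale_sum_right scaleC_scaleC)
  show "trunc n o\<^sub>L trunc n = trunc n"
    by (intro blinfun_eqI onb_eqI) (simp add: cinner_trunc)
  show "cinner (trunc n u) v = cinner u (trunc n v)" for u v
    unfolding trunc_apply cinner_sum_left cinner_sum_right cinner_scaleC_left cinner_scaleC_right
    by (simp add: mult.commute flip: cinner_commute)
qed

text \<open>In coefficients, truncation at \<open>n\<close> is restriction to the indices below
  \<open>n\<close>, and a finite set of indices already captures all but \<open>r\<close> of the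
  norm.\<close>

lemma trunc_tendsto: "(\<lambda>n. trunc n v) \<longlonglongrightarrow> v"
proof (rule metric_LIMSEQ_I)
  fix r :: real assume r: "r > 0"
  obtain J :: "'h \<Rightarrow>\<^sub>L (nat, complex) ell2" and K where
    JK: "unitary_pair J K" and J: "\<And>v i. coord (J v) i = cinner v (e i)"
    by (rule orthonormal_basis_unitary[of e]) (use on total in auto)
  obtain G where G: "finite G" "norm (J v - proj_on G id_blinfun (J v)) < r"
    by (rule finite_tail[OF r])
  obtain N where N: "\<And>i. i \<in> G \<Longrightarrow> i < N"
    using G(1) by (metis finite_nat_set_iff_bounded)
  have "dist (trunc n v) v < r" if "n \<ge> N" for n
  proof -
    have "norm (J v - J (trunc n v)) \<le> norm (J v - proj_on G id_blinfun (J v))"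
    proof (rule norm_ell2_mono)
      fix i
      show "norm (coord (J v - J (trunc n v)) i) \<le> norm (coord (J v - proj_on G id_blinfun (J v)) i)"
        using N[of i] that by (auto simp: J cinner_trunc coord_proj_on_id)
    qed
    also have "norm (J v - J (trunc n v)) = norm (v - trunc n v)"
      by (simp add: unitary_pairD[OF JK] flip: blinfun.diff_right)
    finally show ?thesis using G(2) by (simp add: dist_norm norm_minus_commute)
  qed
  then show "\<exists>N. \<forall>n\<ge>N. dist (trunc n v) v < r" by blast
qed

sublocale filtration trunc
proof
  show "ortho_proj (trunc n)" for n by (rule ortho_proj_trunc)
  show "trunc n (trunc m u) = trunc m u" if "m \<le> n" for m n u
    using that by (intro onb_eqI) (auto simp: cinner_trunc)
  show "(\<lambda>n. trunc n u) \<longlonglongrightarrow> u" for u by (rule trunc_tendsto)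
qed

text \<open>On the left, the truncations converge uniformly on a totally bounded image. On the
  right, near-maximizing vectors of \<open>k\<close> after removal of the truncation are weakly
  null, and compactness sends their images to 0.\<close>

lemma compact_approx:
  assumes k: "k \<in> compact_operators" and r: "r > 0"
  shows "\<exists>n. norm (k - (trunc n o\<^sub>L k o\<^sub>L trunc n)) < r"
proof -
  have "\<forall>\<^sub>F n in sequentially. norm (k - (trunc n o\<^sub>L k)) \<le> r / 4"
  proof -
    obtain C where C: "compact C" "\<And>u. norm u \<le> 1 \<Longrightarrow> k u \<in> C"
      using compact_operatorsD(2)[OF k, of 1] by metis
    obtain F where F: "finite F" "C \<subseteq> (\<Union>c\<in>F. ball c (r / 8))"
    proof -
      have "\<exists>F. finite F \<and> F \<subseteq> C \<and> C \<subseteq> (\<Union>c\<in>F. ball c (r / 8))"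
        using C(1) r by (intro seq_compact_imp_totally_bounded[rule_format, of C "r / 8"]) (auto simp: compact_eq_seq_compact_metric)
      then show ?thesis using that by blast
    qed
    have "\<forall>\<^sub>F n in sequentially. \<forall>c\<in>F. norm (c - trunc n c) < r / 8"
    proof (rule eventually_ball_finite[OF F(1)], rule ballI)
      fix c
      have "\<forall>\<^sub>F n in sequentially. dist (trunc n c) c < r / 8"
        by (rule tendstoD[OF trunc_tendsto]) (use r in auto)
      then show "\<forall>\<^sub>F n in sequentially. norm (c - trunc n c) < r / 8"
        by (simp add: dist_norm norm_minus_commute)
    qed
    then show ?thesis
    proof eventually_elim
      case (elim n)
      have "norm ((k - (trunc n o\<^sub>L k)) u) \<le> r / 4" if u: "norm u \<le> 1" for u
      proof -
        obtain c where c: "c \<in> F" "norm (k u - c) < r / 8"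
          using C(2)[OF u] F(2) by (auto simp: dist_norm norm_minus_commute)
        have "(k - (trunc n o\<^sub>L k)) u = ((k u - c) - trunc n (k u - c)) + (c - trunc n c)"
          by (simp add: blinfun.diff_left blinfun.diff_right)
        then have "norm ((k - (trunc n o\<^sub>L k)) u) \<le> norm ((k u - c) - trunc n (k u - c)) + norm (c - trunc n c)"
          by (simp only: norm_triangle_ineq)
        then show ?thesis
          using ortho_proj_compl_norm_le[OF ortho_proj_trunc, of "k u - c" n] c elim by force
      qed
      then show ?case using r by (intro norm_blinfun_bound_unit) auto
    qed
  qed
  moreover have "\<forall>\<^sub>F n in sequentially. norm (k - (k o\<^sub>L trunc n)) < r / 4"
  proof -
    \<comment> \<open>A vector reaching half the operator norm; without one the norm would be at
      most half of itself, hence 0, contradicting the strict inequality at the zero vector.\<close>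
    have "\<exists>v. norm v \<le> 1 \<and> norm (k - (k o\<^sub>L trunc n)) \<le> 2 * norm ((k - (k o\<^sub>L trunc n)) v)" for n
    proof (rule ccontr)
      let ?S = "k - (k o\<^sub>L trunc n)"
      assume "\<not> ?thesis"
      then have small: "2 * norm (?S v) < norm ?S" if "norm v \<le> 1" for v using that by force
      have "norm ?S \<le> norm ?S / 2"
        using small by (intro norm_blinfun_bound_unit) (force dest: small)+
      then have "norm ?S = 0" using norm_ge_zero[of ?S] by linarith
      then show False using small[of 0] by simp
    qed
    then obtain v where v: "\<And>n. norm (v n) \<le> 1"
      "\<And>n. norm (k - (k o\<^sub>L trunc n)) \<le> 2 * norm ((k - (k o\<^sub>L trunc n)) (v n))" by metis
    have "(\<lambda>n. k (v n - trunc n (v n))) \<longlonglongrightarrow> 0"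
    proof (rule compact_operator_weakly_null[OF k])
      show "norm (v n - trunc n (v n)) \<le> 1" for n
        using ortho_proj_compl_norm_le[OF ortho_proj_trunc, of "v n" n] v(1)[of n] by linarith
      show "(\<lambda>n. cinner (v n - trunc n (v n)) w) \<longlonglongrightarrow> 0" for w
      proof (rule Lim_null_comparison)
        show "\<forall>\<^sub>F n in sequentially. norm (cinner (v n - trunc n (v n)) w) \<le> norm (w - trunc n w)"
        proof (rule always_eventually, rule allI)
          fix n
          have "cinner (v n - trunc n (v n)) w = cinner (v n) (w - trunc n w)"
            by (simp add: cinner_diff_left cinner_diff_right ortho_proj_cinner[OF ortho_proj_trunc])
          also have "cmod \<dots> \<le> norm (v n) * norm (w - trunc n w)" by (rule cinner_cauchy_schwarz)
          also have "\<dots> \<le> 1 * norm (w - trunc n w)" by (intro mult_right_mono v) auto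
          finally show "norm (cinner (v n - trunc n (v n)) w) \<le> norm (w - trunc n w)" by simp
        qed
        have "(\<lambda>n. norm (w - trunc n w)) \<longlonglongrightarrow> norm (w - w)"
          by (intro tendsto_intros trunc_tendsto)
        then show "(\<lambda>n. norm (w - trunc n w)) \<longlonglongrightarrow> 0" by simp
      qed
    qed
    then have "\<forall>\<^sub>F n in sequentially. dist (k (v n - trunc n (v n))) 0 < r / 8"
      by (rule tendstoD) (use r in auto)
    then show ?thesis
    proof eventually_elim
      case (elim n)
      then show ?case using v(2)[of n] by (simp add: blinfun.diff_left blinfun.diff_right)
    qed
  qed
  ultimately have "\<forall>\<^sub>F n in sequentially. norm (k - (trunc n o\<^sub>L k o\<^sub>L trunc n)) < r"
  proof eventually_elim
    case (elim n)
    have "k - (trunc n o\<^sub>L k o\<^sub>L trunc n) = (k - (trunc n o\<^sub>L k)) + (trunc n o\<^sub>L (k - (k o\<^sub>L trunc n)))"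
      by (rule blinfun_eqI) (simp add: blinfun.diff_left blinfun.add_left blinfun.diff_right)
    then have "norm (k - (trunc n o\<^sub>L k o\<^sub>L trunc n)) \<le> norm (k - (trunc n o\<^sub>L k)) + norm (trunc n o\<^sub>L (k - (k o\<^sub>L trunc n)))"
      by (simp only: norm_triangle_ineq)
    also have "norm (trunc n o\<^sub>L (k - (k o\<^sub>L trunc n))) \<le> 1 * norm (k - (k o\<^sub>L trunc n))"
      by (rule order_trans[OF norm_blinfun_compose]) (intro mult_right_mono ortho_proj_norm ortho_proj_trunc norm_ge_zero)
    finally show ?case using elim r by linarith
  qed
  then show ?thesis by (meson eventually_sequentially order_refl)
qed

end

section \<open>Roe algebras and stabilisations as filtered Roe algebras\<close>

lemma filtration_id: "filtration (\<lambda>_. id_blinfun :: 'h::complex_hilbert_space \<Rightarrow>\<^sub>L 'h)"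
  by unfold_locales (auto simp: ortho_proj_id)

lemma roe_algebra_eq_filtered_roe:
  "(roe_algebra :: (('x::metric_space, 'h::complex_hilbert_space) ell2 \<Rightarrow>\<^sub>L ('x, 'h) ell2) set) =
     filtered_roe (\<lambda>_. id_blinfun)"
proof -
  have "{T :: ('x, 'h) ell2 \<Rightarrow>\<^sub>L ('x, 'h) ell2.
      T \<in> bounded_operators \<and> finite_propagation T \<and> locally_compact_operator T} =
      (\<Union>n. controlled (\<lambda>_. id_blinfun) n)" (is "?A = ?B")
  proof (intro equalityI subsetI)
    fix T :: "('x, 'h) ell2 \<Rightarrow>\<^sub>L ('x, 'h) ell2" assume T: "T \<in> ?A"
    then obtain R where R: "\<And>x y. matrix_entry T x y \<noteq> 0 \<Longrightarrow> dist x y \<le> R"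
      unfolding finite_propagation_def by blast
    have "dist x y \<le> real (nat \<lceil>R\<rceil>)" if "matrix_entry T x y \<noteq> 0" for x y
      using R[OF that] by (rule order_trans) (rule real_nat_ceiling_ge)
    then have "T \<in> controlled (\<lambda>_. id_blinfun) (nat \<lceil>R\<rceil>)"
      using T by (auto simp: controlled_def locally_compact_operator_def bounded_operators_iff intro!: blinfun_eqI)
    then show "T \<in> ?B" by blast
  next
    fix T :: "('x, 'h) ell2 \<Rightarrow>\<^sub>L ('x, 'h) ell2" assume "T \<in> ?B"
    then show "T \<in> ?A"
      by (auto simp: controlled_def locally_compact_operator_def bounded_operators_iff finite_propagation_def)
  qed
  then show ?thesis unfolding roe_algebra_def filtered_roe_def by simp
qed

section \<open>Slices and elementary tensors\<close>

lemma coord_ell2_tensor: "coord (ell2_tensor f v) x = coord f x *\<^sub>C v"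
  by transfer simp

lemma single_eq_tensor: "single y v = ell2_tensor (single y 1) v"
  by (rule ell2_eqI) (simp add: coord_single coord_ell2_tensor)

text \<open>The partial inner product with \<open>w\<close> along the fibre, that is, 1 \<otimes>
  <w|.\<close>

definition slice :: "'h::complex_inner_space \<Rightarrow> (('x, 'h) ell2 \<Rightarrow>\<^sub>L ('x, complex) ell2)" where
  "slice w = (SOME T. clinear T \<and> (\<forall>F x. coord (T F) x = cinner (coord F x) w))"

lemma
  fixes w :: "'h::complex_inner_space" and F :: "('x, 'h) ell2"
  shows clinear_slice: "clinear (slice w :: ('x, 'h) ell2 \<Rightarrow>\<^sub>L ('x, complex) ell2)"
    and coord_slice: "coord (slice w F) x = cinner (coord F x) w"
proof -
  have "\<exists>T :: ('x, 'h) ell2 \<Rightarrow>\<^sub>L ('x, complex) ell2.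
      clinear T \<and> (\<forall>F x. coord (T F) x = cinner (coord F x) w) \<and> norm T \<le> norm w" for w :: 'h
  proof (rule ell2_operator)
    fix f :: "('x, 'h) ell2" and F :: "'x set" assume F: "finite F"
    have "(\<Sum>x\<in>F. (cmod (cinner (coord f x) w))\<^sup>2) \<le> (\<Sum>x\<in>F. (norm w)\<^sup>2 * (norm (coord f x))\<^sup>2)"
      unfolding power_mult_distrib[symmetric]
      using cinner_cauchy_schwarz[of "coord f _" w]
      by (intro sum_mono power_mono) (auto simp: mult.commute)
    also have "\<dots> \<le> (norm w)\<^sup>2 * (norm f)\<^sup>2"
      unfolding sum_distrib_left[symmetric] by (intro mult_left_mono sum_norm_coord_le F) auto
    finally show "(\<Sum>x\<in>F. (cmod (cinner (coord f x) w))\<^sup>2) \<le> (norm w * norm f)\<^sup>2"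
      by (simp add: power_mult_distrib)
  qed (auto simp: cinner_add_left cinner_scaleC_left scaleC_complex_def)
  then have "\<exists>T :: ('x, 'h) ell2 \<Rightarrow>\<^sub>L ('x, complex) ell2.
      clinear T \<and> (\<forall>F x. coord (T F) x = cinner (coord F x) w)" for w :: 'h
    by blast
  from someI_ex[OF this]
  show "clinear (slice w :: ('x, 'h) ell2 \<Rightarrow>\<^sub>L ('x, complex) ell2)"
    "coord (slice w F) x = cinner (coord F x) w" for w :: 'h and F :: "('x, 'h) ell2" and x
    unfolding slice_def by blast+
qed

text \<open>The operator 1 \<otimes> |v>, adjoint to \<open>slice v\<close>.\<close>

definition tensor :: "'h::complex_inner_space \<Rightarrow> (('x, complex) ell2 \<Rightarrow>\<^sub>L ('x, 'h) ell2)" where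
  "tensor v = (SOME T. clinear T \<and> (\<forall>f. T f = ell2_tensor f v))"

lemma
  fixes v :: "'h::complex_inner_space" and f :: "('x, complex) ell2"
  shows clinear_tensor: "clinear (tensor v :: ('x, complex) ell2 \<Rightarrow>\<^sub>L ('x, 'h) ell2)"
    and tensor_apply: "tensor v f = ell2_tensor f v"
proof -
  have "\<exists>T :: ('x, complex) ell2 \<Rightarrow>\<^sub>L ('x, 'h) ell2.
      clinear T \<and> (\<forall>f x. coord (T f) x = coord f x *\<^sub>C v) \<and> norm T \<le> norm v" for v :: 'h
  proof (rule ell2_operator)
    fix f :: "('x, complex) ell2" and F :: "'x set" assume F: "finite F"
    have "(\<Sum>x\<in>F. (norm (coord f x *\<^sub>C v))\<^sup>2) = (norm v)\<^sup>2 * (\<Sum>x\<in>F. (norm (coord f x))\<^sup>2)"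
      by (simp add: norm_scaleC power_mult_distrib sum_distrib_left mult.commute)
    also have "\<dots> \<le> (norm v)\<^sup>2 * (norm f)\<^sup>2"
      by (intro mult_left_mono sum_norm_coord_le F) auto
    finally show "(\<Sum>x\<in>F. (norm (coord f x *\<^sub>C v))\<^sup>2) \<le> (norm v * norm f)\<^sup>2"
      by (simp add: power_mult_distrib)
  qed (auto simp: scaleC_add_left scaleC_complex_def scaleC_scaleC)
  then have "\<exists>T :: ('x, complex) ell2 \<Rightarrow>\<^sub>L ('x, 'h) ell2. clinear T \<and> (\<forall>f. T f = ell2_tensor f v)" for v :: 'h
    by (metis ell2_eqI coord_ell2_tensor)
  from someI_ex[OF this]
  show "clinear (tensor v :: ('x, complex) ell2 \<Rightarrow>\<^sub>L ('x, 'h) ell2)"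
    "tensor v f = ell2_tensor f v" for v :: 'h and f :: "('x, complex) ell2"
    unfolding tensor_def by blast+
qed

lemma slice_tensor: "slice w (ell2_tensor f v) = cinner v w *\<^sub>C f"
  by (rule ell2_eqI) (simp add: coord_slice coord_ell2_tensor cinner_scaleC_left scaleC_complex_def mult.commute)

lemma ell2_tensor_scaleC: "ell2_tensor (c *\<^sub>C f) v = c *\<^sub>C ell2_tensor f v"
  "ell2_tensor f (c *\<^sub>C v) = c *\<^sub>C ell2_tensor f v"
  by (rule ell2_eqI, simp add: coord_ell2_tensor scaleC_scaleC scaleC_complex_def mult.commute)+

lemma ell2_tensor_sum: "ell2_tensor f (\<Sum>i\<in>I. v i) = (\<Sum>i\<in>I. ell2_tensor f (v i))"
  by (rule ell2_eqI) (simp add: coord_ell2_tensor coord_sum complex_vector.scale_sum_right)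

context onb begin

lemma proj_on_trunc_eq: "proj_on UNIV (trunc n) F = (\<Sum>i<n. ell2_tensor (slice (e i) F) (e i))"
  by (rule ell2_eqI)
     (simp add: coord_proj_on[OF ortho_proj_trunc] coord_sum coord_ell2_tensor coord_slice trunc_apply)

lemma proj_on_trunc_tendsto: "(\<lambda>n. proj_on UNIV (trunc n) F) \<longlonglongrightarrow> F"
proof (rule tendstoI)
  fix r :: real assume r: "r > 0"
  obtain G where G: "\<forall>\<^sub>F n in sequentially. norm (F - proj_on G (trunc n) F) < r"
    using eventually_proj_on_approx[OF r] by blast
  have "norm (F - proj_on UNIV (trunc n) F) \<le> norm (F - proj_on G (trunc n) F)" for n
    by (rule norm_ell2_mono)
       (auto simp: coord_proj_on[OF ortho_proj_trunc] ortho_proj_compl_norm_le[OF ortho_proj_trunc])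
  then show "\<forall>\<^sub>F n in sequentially. dist (proj_on UNIV (trunc n) F) F < r"
    using G by (auto elim!: eventually_mono simp: dist_norm norm_minus_commute intro: le_less_trans)
qed

lemma norm_sum_tensor: "(norm (\<Sum>i<n. ell2_tensor (g i) (e i)))\<^sup>2 = (\<Sum>i<n. (norm (g i))\<^sup>2)"
proof -
  have orth: "cinner (ell2_tensor f (e i)) (ell2_tensor g (e j)) = 0" if "i \<noteq> j"
    for i j and f g :: "('x, complex) ell2"
  proof -
    have "cinner (coord (ell2_tensor f (e i)) x) (coord (ell2_tensor g (e j)) x) = 0" for x
      using that by (simp add: coord_ell2_tensor cinner_scaleC_left cinner_scaleC_right on)
    then show ?thesis
      using cinner_ell2_has_sum[of "ell2_tensor f (e i)" "ell2_tensor g (e j)"] has_sum_unique[OF _ has_sum_0]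
      by auto
  qed
  have nt: "norm (ell2_tensor f (e i)) = norm f" for i and f :: "('x, complex) ell2"
  proof (rule antisym)
    have "norm (coord (ell2_tensor f (e i)) x) = norm (coord f x)" for x
      by (simp add: coord_ell2_tensor norm_scaleC norm_basis)
    then have "((\<lambda>x. (norm (coord f x))\<^sup>2) has_sum (norm (ell2_tensor f (e i)))\<^sup>2) UNIV"
      using has_sum_norm_ell2[of "ell2_tensor f (e i)"] by simp
    then have "(norm (ell2_tensor f (e i)))\<^sup>2 = (norm f)\<^sup>2"
      using has_sum_norm_ell2 has_sum_unique by blast
    then show "norm (ell2_tensor f (e i)) \<le> norm f" "norm f \<le> norm (ell2_tensor f (e i))"
      by (simp_all add: power2_eq_iff_nonneg)
  qed
  have "(norm (\<Sum>i<n. ell2_tensor (g i) (e i)))\<^sup>2 = (\<Sum>i<n. (norm (ell2_tensor (g i) (e i)))\<^sup>2)"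
    by (rule norm_sum_orthogonal) (auto simp: orth)
  then show ?thesis by (simp add: nt)
qed

text \<open>On finite sums of g_i \<otimes> e_i the operator acts as (1 \<otimes> k)(a \<otimes> 1).
  Orthonormality of the e_i bounds the second factor, \<open>diag\<close> the first, and truncated
  vectors are dense.\<close>

lemma norm_elementary_tensor_le:
  fixes T :: "('x, 'h) ell2 \<Rightarrow>\<^sub>L ('x, 'h) ell2" and a :: "('x, complex) ell2 \<Rightarrow>\<^sub>L ('x, complex) ell2"
    and k :: "'h \<Rightarrow>\<^sub>L 'h"
  assumes T: "\<And>f v. T (ell2_tensor f v) = ell2_tensor (a f) (k v)" and k: "clinear k"
  shows "norm T \<le> norm a * norm k"
proof (rule norm_blinfun_bound)
  fix F
  have K: "coord (diag (\<lambda>_. k) G) x = k (coord G x)" "norm (diag (\<lambda>_. k)) \<le> norm k"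
    for G :: "('x, 'h) ell2" and x :: 'x
    using coord_diag[of "\<lambda>_. k" "norm k" G x] norm_diag[of "\<lambda>_. k" "norm k"] k by auto
  have bound: "norm (T (proj_on UNIV (trunc n) F)) \<le> norm a * norm k * norm F" for n
  proof -
    let ?g = "\<Sum>i<n. ell2_tensor (a (slice (e i) F)) (e i)"
    have "T (proj_on UNIV (trunc n) F) = diag (\<lambda>_. k) ?g"
      by (rule ell2_eqI)
         (simp add: proj_on_trunc_eq blinfun.sum_right T K coord_sum coord_ell2_tensor clinear_scaleC[OF k])
    then have 1: "norm (T (proj_on UNIV (trunc n) F)) \<le> norm k * norm ?g"
      using order_trans[OF norm_blinfun[of "diag (\<lambda>_. k)" ?g] mult_right_mono[OF K(2) norm_ge_zero[of ?g]]]
      by simp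
    have "(norm ?g)\<^sup>2 \<le> (\<Sum>i<n. (norm a * norm (slice (e i) F))\<^sup>2)"
      unfolding norm_sum_tensor by (intro sum_mono power_mono norm_blinfun) auto
    also have "\<dots> = (norm a * norm (proj_on UNIV (trunc n) F))\<^sup>2"
      unfolding proj_on_trunc_eq power_mult_distrib norm_sum_tensor by (simp add: sum_distrib_left)
    finally have "norm ?g \<le> norm a * norm (proj_on UNIV (trunc n) F)"
      by (rule power2_le_imp_le) simp
    also have "\<dots> \<le> norm a * norm F"
      by (intro mult_left_mono ortho_proj_norm_le ortho_proj_proj_on ortho_proj_trunc) auto
    finally have "norm k * norm ?g \<le> norm k * (norm a * norm F)"
      by (intro mult_left_mono) auto
    then show ?thesis using 1 by (simp add: mult_ac)
  qed
  have "(\<lambda>n. norm (T (proj_on UNIV (trunc n) F))) \<longlonglongrightarrow> norm (T F)"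
    by (intro tendsto_norm blinfun.tendsto tendsto_const proj_on_trunc_tendsto)
  then show "norm (T F) \<le> norm a * norm k * norm F"
    by (rule LIMSEQ_le_const2) (use bound in auto)
qed simp

text \<open>After compression of \<open>k\<close> to finitely many basis vectors, a \<otimes> k is a
  finite sum of products of slices and tensors, so its existence is evident.\<close>

lemma truncated_tensor_exists:
  fixes a :: "('x, complex) ell2 \<Rightarrow>\<^sub>L ('x, complex) ell2" and k :: "'h \<Rightarrow>\<^sub>L 'h"
  assumes a: "clinear a" and k: "clinear k"
  shows "\<exists>T :: ('x, 'h) ell2 \<Rightarrow>\<^sub>L ('x, 'h) ell2. clinear T \<and>
    (\<forall>f v. T (ell2_tensor f v) = ell2_tensor (a f) ((trunc n o\<^sub>L k o\<^sub>L trunc n) v))"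
proof -
  define T :: "('x, 'h) ell2 \<Rightarrow>\<^sub>L ('x, 'h) ell2" where
    "T = (\<Sum>j<n. tensor (trunc n (k (e j))) o\<^sub>L a o\<^sub>L slice (e j))"
  have "T (ell2_tensor f v) = ell2_tensor (a f) (trunc n (k (trunc n v)))" for f v
    by (simp add: T_def blinfun.sum_left blinfun.sum_right slice_tensor clinear_scaleC[OF a] tensor_apply
        ell2_tensor_scaleC trunc_apply[of n v] clinear_scaleC[OF k]
        clinear_scaleC[OF ortho_proj_clinear[OF ortho_proj_trunc]] ell2_tensor_sum)
  moreover have "clinear T"
    unfolding clinear_def T_def blinfun.sum_left
    using a by (simp add: clinear_scaleC[OF clinear_slice] clinear_scaleC[OF a] clinear_scaleC[OF clinear_tensor]
        complex_vector.scale_sum_right)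
  ultimately show ?thesis by (intro exI[of _ T]) simp
qed

text \<open>Two replacements: first the compact factor by its truncation, then \<open>a\<close> by
  an operator of finite propagation. The result inherits its propagation from the second and its
  corner from the first.\<close>

lemma elementary_tensor_in_filtered_roe:
  fixes T :: "('x::metric_space, 'h) ell2 \<Rightarrow>\<^sub>L ('x, 'h) ell2"
    and a :: "('x, complex) ell2 \<Rightarrow>\<^sub>L ('x, complex) ell2" and k :: "'h \<Rightarrow>\<^sub>L 'h"
  assumes T: "\<And>f v. T (ell2_tensor f v) = ell2_tensor (a f) (k v)"
    and a: "a \<in> uniform_roe_algebra" and k: "k \<in> compact_operators"
  shows "T \<in> filtered_roe trunc"
  unfolding filtered_roe_def closure_approachable
proof (intro allI impI)
  fix r :: real assume r: "r > 0"
  have k': "clinear k" by (rule compact_operatorsD(1)[OF k])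
  have a': "clinear a"
  proof -
    have "uniform_roe_algebra \<subseteq> {T :: ('x, complex) ell2 \<Rightarrow>\<^sub>L ('x, complex) ell2. clinear T}"
      unfolding uniform_roe_algebra_def
      by (intro closure_minimal clinear_closed) (auto simp: bounded_operators_iff)
    then show ?thesis using a by blast
  qed
  define d where "d = r / (2 * (norm a + norm k + 1))"
  have pos: "norm a + norm k + 1 > 0" by (simp add: add_nonneg_pos)
  have d: "d > 0" using r pos by (simp add: d_def)
  obtain b where b: "b \<in> bounded_operators" "finite_propagation b" "norm (b - a) < d"
    using a d unfolding uniform_roe_algebra_def closure_approachable dist_norm by blast
  have b': "clinear b" using b by (simp add: bounded_operators_iff)
  obtain n where n: "norm (k - (trunc n o\<^sub>L k o\<^sub>L trunc n)) < d" using compact_approx[OF k d] by blast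
  define kn where "kn = trunc n o\<^sub>L k o\<^sub>L trunc n"
  have trunc_clinear: "clinear (trunc n)" for n by (rule ortho_proj_clinear[OF ortho_proj_trunc])
  have kn: "clinear kn" unfolding kn_def using k' trunc_clinear by (intro clinear_compose)
  have kn_compact: "kn \<in> compact_operators"
    unfolding kn_def
    by (intro compact_operators_compose_right compact_operators_compose_left trunc_clinear k)
  obtain Ta :: "('x, 'h) ell2 \<Rightarrow>\<^sub>L ('x, 'h) ell2" where Ta: "\<And>f v. Ta (ell2_tensor f v) = ell2_tensor (a f) (kn v)"
    using truncated_tensor_exists[OF a' k', of n] unfolding kn_def[symmetric] by blast
  obtain Tb :: "('x, 'h) ell2 \<Rightarrow>\<^sub>L ('x, 'h) ell2" where Tb: "clinear Tb" "\<And>f v. Tb (ell2_tensor f v) = ell2_tensor (b f) (kn v)"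
    using truncated_tensor_exists[OF b' k', of n] unfolding kn_def[symmetric] by blast
  have nkn: "norm kn \<le> norm k"
  proof (rule norm_blinfun_bound)
    fix v
    have "norm (kn v) \<le> norm (k (trunc n v))"
      by (simp add: kn_def ortho_proj_norm_le[OF ortho_proj_trunc])
    also have "\<dots> \<le> norm k * norm (trunc n v)" by (rule norm_blinfun)
    also have "\<dots> \<le> norm k * norm v"
      by (intro mult_left_mono ortho_proj_norm_le[OF ortho_proj_trunc]) auto
    finally show "norm (kn v) \<le> norm k * norm v" .
  qed simp
  have "norm (T - Ta) \<le> norm a * norm (k - kn)"
  proof (rule norm_elementary_tensor_le)
    show "(T - Ta) (ell2_tensor f v) = ell2_tensor (a f) ((k - kn) v)" for f v
      by (rule ell2_eqI)
         (simp add: blinfun.diff_left T Ta coord_ell2_tensor complex_vector.scale_right_diff_distrib)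
    show "clinear (k - kn)"
      using k' kn by (simp add: clinear_def blinfun.diff_left complex_vector.scale_right_diff_distrib)
  qed
  moreover have "norm (Ta - Tb) \<le> norm (a - b) * norm kn"
  proof (rule norm_elementary_tensor_le[OF _ kn])
    show "(Ta - Tb) (ell2_tensor f v) = ell2_tensor ((a - b) f) (kn v)" for f v
      by (rule ell2_eqI)
         (simp add: blinfun.diff_left Ta Tb coord_ell2_tensor complex_vector.scale_left_diff_distrib)
  qed
  moreover have "norm (T - Tb) \<le> norm (T - Ta) + norm (Ta - Tb)"
    using norm_triangle_ineq[of "T - Ta" "Ta - Tb"] by simp
  moreover have "norm a * norm (k - kn) \<le> norm a * d"
    using n by (intro mult_left_mono) (auto simp: kn_def)
  moreover have "norm (a - b) * norm kn \<le> d * norm k"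
    using b(3) nkn d by (intro mult_mono) (auto simp: norm_minus_commute)
  ultimately have "norm (T - Tb) \<le> norm a * d + d * norm k" by linarith
  also have "\<dots> < 2 * (norm a + norm k + 1) * d"
  proof -
    have "norm a * d + d * norm k = (norm a + norm k) * d" by (simp add: algebra_simps)
    moreover have "norm a + norm k < 2 * (norm a + norm k + 1)"
      using norm_ge_zero[of a] norm_ge_zero[of k] unfolding distrib_left by (smt (verit))
    ultimately show ?thesis using mult_strict_right_mono[OF _ d] by metis
  qed
  also have "\<dots> = r" using pos by (simp add: d_def)
  finally have "dist Tb T < r" by (simp add: dist_norm norm_minus_commute)
  moreover have "\<exists>m. Tb \<in> controlled trunc m"
  proof -
    obtain R where R: "\<And>x y. matrix_entry b x y \<noteq> 0 \<Longrightarrow> dist x y \<le> R"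
      using b(2) unfolding finite_propagation_def by blast
    define m where "m = max n (nat \<lceil>R\<rceil>)"
    have Rm: "R \<le> real m"
      unfolding m_def by (meson max.cobounded2 of_nat_mono order_trans real_nat_ceiling_ge)
    have c: "coord (Tb (single y v)) x = coord (b (single y 1)) x *\<^sub>C kn v" for x y v
      by (subst single_eq_tensor) (simp add: Tb coord_ell2_tensor)
    have "Tb \<in> controlled trunc m"
    proof (rule controlledI[OF Tb(1)])
      have "matrix_entry Tb x y = coord (b (single y 1)) x *\<^sub>C kn" for x y
        by (rule blinfun_eqI) (simp add: matrix_entry_apply c scaleC_blinfun_apply)
      then show "matrix_entry Tb x y \<in> compact_operators" for x y
        by (simp add: compact_operators_scaleC kn_compact)
      show "coord (Tb (single y v)) x = 0" if "dist x y > real m" for x y v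
      proof -
        have "matrix_entry b x y = 0" using R[of x y] that Rm by force
        then have "coord (b (single y 1)) x = 0" by (simp flip: matrix_entry_apply)
        then show ?thesis by (simp add: c)
      qed
      have nm: "n \<le> m" by (simp add: m_def)
      show "trunc m (coord (Tb (single y v)) x) = coord (Tb (single y v)) x" for x y v
        by (simp add: c clinear_scaleC[OF trunc_clinear] kn_def mono[OF nm])
      show "coord (Tb (single y (trunc m v))) x = coord (Tb (single y v)) x" for x y v
        by (simp add: c kn_def mono'[OF nm])
    qed
    then show ?thesis by blast
  qed
  ultimately show "\<exists>S\<in>\<Union>n. controlled trunc n. dist S T < r" by blast
qed

text \<open>Entries confined to a finite-dimensional corner decompose into matrix units: T is the
  finite sum of a_ij \<otimes> |e_i><e_j|, and each a_ij keeps the propagation of T.\<close>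

lemma controlled_trunc_in_span:
  fixes T :: "('x::metric_space, 'h) ell2 \<Rightarrow>\<^sub>L ('x, 'h) ell2"
  assumes T: "T \<in> controlled trunc n"
  shows "T \<in> cspan (elementary_tensors uniform_roe_algebra compact_operators)"
proof -
  define a :: "nat \<Rightarrow> nat \<Rightarrow> ('x, complex) ell2 \<Rightarrow>\<^sub>L ('x, complex) ell2" where
    "a i j = slice (e i) o\<^sub>L T o\<^sub>L tensor (e j)" for i j
  define t where "t i j = tensor (e i) o\<^sub>L a i j o\<^sub>L slice (e j)" for i j
  have Tc: "clinear T" by (rule controlled_clinear[OF T])
  have ac: "clinear (a i j)" for i j
    unfolding a_def by (intro clinear_compose clinear_slice clinear_tensor Tc)
  have t_elem: "t i j \<in> elementary_tensors uniform_roe_algebra compact_operators" for i j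
    unfolding elementary_tensors_def
  proof (intro CollectI conjI bexI allI)
    show "t i j \<in> bounded_operators"
      unfolding bounded_operators_iff t_def by (intro clinear_compose clinear_slice clinear_tensor ac)
    show "t i j (ell2_tensor f v) = ell2_tensor (a i j f) (butterfly (e i) (e j) v)" for f v
      by (simp add: t_def slice_tensor clinear_scaleC[OF ac] tensor_apply ell2_tensor_scaleC butterfly_apply)
    show "butterfly (e i) (e j) \<in> compact_operators" by (rule compact_operators_butterfly)
    have "finite_propagation (a i j)"
      unfolding finite_propagation_def
    proof (intro exI[of _ "real n"] allI impI, rule ccontr)
      fix x y assume nz: "matrix_entry (a i j) x y \<noteq> 0" and "\<not> dist x y \<le> real n"
      then have far: "dist x y > real n" by simp
      have "matrix_entry (a i j) x y z = 0" for z
      proof -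
        have "ell2_tensor (single y z) (e j) = single y (z *\<^sub>C e j)"
          by (rule ell2_eqI) (simp add: coord_ell2_tensor coord_single)
        then show ?thesis
          using controlled_propagation[OF T far]
          by (simp add: matrix_entry_apply a_def tensor_apply coord_slice)
      qed
      then show False using nz by (metis blinfun_eqI zero_blinfun.rep_eq)
    qed
    then show "a i j \<in> uniform_roe_algebra"
      unfolding uniform_roe_algebra_def
      by (intro closure_subset[THEN subsetD]) (simp add: bounded_operators_iff ac)
  qed
  have "T = (\<Sum>i<n. \<Sum>j<n. t i j)"
  proof (rule blinfun_ell2_eqI, rule ell2_eqI)
    fix y x :: 'x and v :: 'h
    have single_tensor: "ell2_tensor (slice (e j) (single y v)) (e j) = single y (cinner v (e j) *\<^sub>C e j)" for j
      by (rule ell2_eqI) (simp add: coord_ell2_tensor coord_slice coord_single)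
    have sum_single: "(\<Sum>j<n. T (single y (cinner v (e j) *\<^sub>C e j))) = T (single y (trunc n v))"
      unfolding trunc_apply
      by (simp add: blinfun.sum_right linear_sum[OF bounded_linear.linear[OF bounded_linear_single]])
    have "coord ((\<Sum>i<n. \<Sum>j<n. t i j) (single y v)) x =
        (\<Sum>i<n. \<Sum>j<n. cinner (coord (T (single y (cinner v (e j) *\<^sub>C e j))) x) (e i) *\<^sub>C e i)"
      by (simp add: blinfun.sum_left coord_sum t_def a_def tensor_apply coord_ell2_tensor coord_slice single_tensor)
    also have "\<dots> = (\<Sum>i<n. cinner (coord (T (single y (trunc n v))) x) (e i) *\<^sub>C e i)"
      unfolding sum_single[symmetric] coord_sum cinner_sum_left complex_vector.scale_sum_left ..
    also have "\<dots> = trunc n (coord (T (single y (trunc n v))) x)" by (simp add: trunc_apply)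
    also have "\<dots> = coord (T (single y v)) x"
      by (simp add: controlled_compose(1)[OF T] controlled_compose(2)[OF T])
    finally show "coord (T (single y v)) x = coord ((\<Sum>i<n. \<Sum>j<n. t i j) (single y v)) x" ..
  qed
  then show ?thesis
    by (simp add: complex_vector.span_sum complex_vector.span_base t_elem)
qed

lemma stabilisation_uniform_roe_eq:
  "stabilisation (uniform_roe_algebra :: (('x::metric_space, complex) ell2 \<Rightarrow>\<^sub>L ('x, complex) ell2) set) =
     filtered_roe trunc"
proof (rule equalityI)
  let ?E = "elementary_tensors (uniform_roe_algebra :: (('x, complex) ell2 \<Rightarrow>\<^sub>L ('x, complex) ell2) set)
    compact_operators :: (('x, 'h) ell2 \<Rightarrow>\<^sub>L ('x, 'h) ell2) set"
  have "?E \<subseteq> filtered_roe trunc"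
    unfolding elementary_tensors_def using elementary_tensor_in_filtered_roe by blast
  moreover have "complex_vector.subspace (filtered_roe trunc :: (('x, 'h) ell2 \<Rightarrow>\<^sub>L ('x, 'h) ell2) set)"
    by (rule complex_vector.subspaceI) (auto simp: filtered_roe_zero filtered_roe_add filtered_roe_scaleC)
  ultimately have "cspan ?E \<subseteq> filtered_roe trunc" by (rule complex_vector.span_minimal)
  then have "closure (cspan ?E) \<subseteq> filtered_roe trunc"
    by (rule closure_minimal) (simp add: filtered_roe_def)
  then show "stabilisation (uniform_roe_algebra :: (('x, complex) ell2 \<Rightarrow>\<^sub>L ('x, complex) ell2) set) \<subseteq> filtered_roe trunc"
    unfolding stabilisation_def .
  show "filtered_roe trunc \<subseteq> stabilisation (uniform_roe_algebra :: (('x, complex) ell2 \<Rightarrow>\<^sub>L ('x, complex) ell2) set)"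
    unfolding stabilisation_def filtered_roe_def
    by (intro closure_mono subsetI) (auto intro: controlled_trunc_in_span)
qed

end

section \<open>Coarse equivalences induce isomorphisms\<close>

text \<open>Numbering the k points of a fibre by remainders mod k, division with remainder
  interleaves their k copies of the natural numbers into one. An index grows by at most a factor of
  about \<open>N\<close>, which keeps truncations comparable.\<close>

lemma fibre_bijection:
  fixes p :: "'a \<Rightarrow> 'z"
  assumes fin: "\<And>a. finite (p -` {p a})" and card: "\<And>a. card (p -` {p a}) \<le> N"
  obtains \<beta> :: "'a \<times> nat \<Rightarrow> 'z \<times> nat" where "inj \<beta>" "range \<beta> = range p \<times> UNIV"
    "\<And>a i z j. \<beta> (a, i) = (z, j) \<Longrightarrow> z = p a \<and> i \<le> j \<and> j < N * (i + 1)"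
proof -
  define k where "k z = card (p -` {z})" for z
  have kpos: "k (p a) > 0" for a
    unfolding k_def using fin[of a] by (auto simp: card_gt_0_iff)
  have "\<exists>h. bij_betw h {0..<k z} (p -` {z})" if "z \<in> range p" for z
    unfolding k_def using that fin by (intro ex_bij_betw_nat_finite) auto
  then obtain h where h: "\<And>z. z \<in> range p \<Longrightarrow> bij_betw (h z) {0..<k z} (p -` {z})" by metis
  have "\<exists>r<k (p a). h (p a) r = a" for a
    using h[of "p a"] unfolding bij_betw_def by (force simp: set_eq_iff image_iff)
  then obtain r where r: "\<And>a. r a < k (p a)" "\<And>a. h (p a) (r a) = a" by metis
  define \<beta> where "\<beta> = (\<lambda>(a, i). (p a, i * k (p a) + r a))"
  have "inj \<beta>"
  proof (rule injI, clarify)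
    fix a i a' i' assume eq: "\<beta> (a, i) = \<beta> (a', i')"
    then have pa: "p a = p a'" and s: "i * k (p a) + r a = i' * k (p a) + r a'" by (auto simp: \<beta>_def)
    have "i = (i * k (p a) + r a) div k (p a)" "r a = (i * k (p a) + r a) mod k (p a)"
      using r(1)[of a] by auto
    moreover have "i' = (i' * k (p a) + r a') div k (p a)" "r a' = (i' * k (p a) + r a') mod k (p a)"
      using r(1)[of a'] pa by auto
    ultimately have "i = i'" "r a = r a'" using s by metis+
    then show "a = a' \<and> i = i'" using r(2)[of a] r(2)[of a'] pa by metis
  qed
  moreover have "range \<beta> = range p \<times> UNIV"
  proof (intro equalityI subsetI)
    fix q assume "q \<in> range p \<times> (UNIV :: nat set)"
    then obtain a j where q: "q = (p a, j)" by auto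
    define b where "b = h (p a) (j mod k (p a))"
    have mod: "j mod k (p a) \<in> {0..<k (p a)}" using kpos[of a] by simp
    have "b \<in> p -` {p a}"
      unfolding b_def using bij_betwE[OF h[of "p a"]] mod by blast
    then have pb: "p b = p a" by simp
    have "h (p a) (r b) = h (p a) (j mod k (p a))"
      using r(2)[of b] pb by (simp add: b_def)
    moreover have "r b \<in> {0..<k (p a)}" using r(1)[of b] pb by simp
    ultimately have "r b = j mod k (p a)"
      using h[of "p a"] mod unfolding bij_betw_def inj_on_def by blast
    then have "\<beta> (b, j div k (p a)) = q"
      by (simp add: \<beta>_def pb q)
    then show "q \<in> range \<beta>" by blast
  qed (auto simp: \<beta>_def)
  moreover have "z = p a \<and> i \<le> j \<and> j < N * (i + 1)" if "\<beta> (a, i) = (z, j)" for a i z j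
  proof -
    have zj: "z = p a" "j = i * k (p a) + r a" using that by (auto simp: \<beta>_def)
    have "i \<le> i * k (p a)" using kpos[of a] by simp
    moreover have "i * k (p a) + r a < (i + 1) * k (p a)" using r(1)[of a] by simp
    moreover have "(i + 1) * k (p a) \<le> (i + 1) * N"
      using card[of a] by (intro mult_left_mono) (auto simp: k_def)
    ultimately have "i \<le> i * k (p a) + r a" "i * k (p a) + r a < (i + 1) * N" by linarith+
    then show ?thesis using zj by (simp add: mult.commute)
  qed
  ultimately show ?thesis by (rule that)
qed

lemma coarsely_equivalentE:
  assumes "coarsely_equivalent TYPE('x::metric_space) TYPE('y::metric_space)"
  obtains f :: "'x::metric_space \<Rightarrow> 'y::metric_space" and C where
    "\<And>r. \<exists>s. \<forall>x x'. dist x x' \<le> r \<longrightarrow> dist (f x) (f x') \<le> s"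
    "\<And>s. \<exists>r. \<forall>x x'. dist (f x) (f x') \<le> s \<longrightarrow> dist x x' \<le> r"
    "\<And>y. \<exists>x. dist y (f x) \<le> C"
proof -
  obtain f :: "'x \<Rightarrow> 'y" and C where f: "coarse_embedding f" and C: "\<And>y. infdist y (range f) \<le> C"
    using assms unfolding coarsely_equivalent_def by blast
  obtain \<rho>\<^sub>1 \<rho>\<^sub>2 where \<rho>: "control_function \<rho>\<^sub>1" "control_function \<rho>\<^sub>2"
    "\<And>x y. \<rho>\<^sub>1 (dist x y) \<le> dist (f x) (f y)" "\<And>x y. dist (f x) (f y) \<le> \<rho>\<^sub>2 (dist x y)"
    using f unfolding coarse_embedding_def by blast
  show ?thesis
  proof (rule that[of f "C + 1"])
    show "\<exists>s. \<forall>x x'. dist x x' \<le> r \<longrightarrow> dist (f x) (f x') \<le> s" for r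
    proof (intro exI[of _ "\<rho>\<^sub>2 (max r 0)"] allI impI)
      fix x x' :: 'x assume "dist x x' \<le> r"
      then have "\<rho>\<^sub>2 (dist x x') \<le> \<rho>\<^sub>2 (max r 0)"
        using \<rho>(2) unfolding control_function_def by (intro mono_onD[of "{0..}" \<rho>\<^sub>2]) auto
      then show "dist (f x) (f x') \<le> \<rho>\<^sub>2 (max r 0)" using \<rho>(4)[of x x'] by linarith
    qed
    show "\<exists>r. \<forall>x x'. dist (f x) (f x') \<le> s \<longrightarrow> dist x x' \<le> r" for s
    proof -
      obtain t where t: "t \<ge> 0" "\<rho>\<^sub>1 t > s"
        using \<rho>(1) unfolding control_function_def bdd_above_def by (force simp: not_le)
      show ?thesis
      proof (intro exI[of _ t] allI impI, rule ccontr)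
        fix x x' assume d: "dist (f x) (f x') \<le> s" "\<not> dist x x' \<le> t"
        then have "\<rho>\<^sub>1 t \<le> \<rho>\<^sub>1 (dist x x')"
          using \<rho>(1) t unfolding control_function_def by (intro mono_onD[of "{0..}" \<rho>\<^sub>1]) auto
        then show False using \<rho>(3)[of x x'] d t by linarith
      qed
    qed
    \<comment> \<open>The infimum need not be attained, hence the extra 1.\<close>
    show "\<exists>x. dist y (f x) \<le> C + 1" for y
    proof -
      have "Inf {dist y a |a. a \<in> range f} < C + 1"
        using C[of y] unfolding infdist_def by (simp add: setcompr_eq_image)
      then obtain d where d: "d \<in> {dist y a |a. a \<in> range f}" "d < C + 1"
        by (rule cInf_lessD[rotated, THEN bexE]) auto
      then obtain x where "d = dist y (f x)" by auto
      then show ?thesis using d(2) by (intro exI[of _ x]) simp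
    qed
  qed
qed

section \<open>Transport of the algebras along a matching of bases\<close>

text \<open>\<open>rel x i y j\<close> says that basis vector \<open>i\<close> over \<open>x\<close>
  is matched with basis vector \<open>j\<close> over \<open>y\<close>. A relation, rather than a
  function, makes the conditions symmetric, so that the inverse conjugation needs no separate
  proof.\<close>

locale matching = onb e
  for e :: "nat \<Rightarrow> 'h::complex_hilbert_space" +
  fixes W :: "('x::metric_space, 'h) ell2 \<Rightarrow>\<^sub>L ('y::metric_space, 'h) ell2"
    and W' :: "('y, 'h) ell2 \<Rightarrow>\<^sub>L ('x, 'h) ell2"
    and rel :: "'x \<Rightarrow> nat \<Rightarrow> 'y \<Rightarrow> nat \<Rightarrow> bool" and M :: nat
  assumes WW: "unitary_pair W W'"
    and match: "rel x i y j \<Longrightarrow> cinner (coord (W F) y) (e j) = cinner (coord F x) (e i)"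
    and ex_left: "\<exists>x i. rel x i y j" and ex_right: "\<exists>y j. rel x i y j"
    and index: "rel x i y j \<Longrightarrow> j < M * (i + 1)" "rel x i y j \<Longrightarrow> i < M * (j + 1)"
    and fin_left: "finite {x. \<exists>i j. rel x i y j}" and fin_right: "finite {y. \<exists>i j. rel x i y j}"
    and control_right: "\<exists>s. \<forall>x i y j x' i' y' j'. rel x i y j \<and> rel x' i' y' j' \<and> dist x x' \<le> r \<longrightarrow> dist y y' \<le> s"
    and control_left: "\<exists>s. \<forall>x i y j x' i' y' j'. rel x i y j \<and> rel x' i' y' j' \<and> dist y y' \<le> r \<longrightarrow> dist x x' \<le> s"
begin

lemma match': "rel x i y j \<Longrightarrow> cinner (coord (W' G) x) (e i) = cinner (coord G y) (e j)"
  using match[of x i y j "W' G"] by (simp add: unitary_pairD[OF WW])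

lemma matching_sym: "matching e W' W (\<lambda>y j x i. rel x i y j) M"
proof
  show "unitary_pair W' W" by (rule unitary_pair_sym[OF WW])
  show "rel x i y j \<Longrightarrow> cinner (coord (W' G) x) (e i) = cinner (coord G y) (e j)" for x i y j G
    by (rule match')
  show "\<exists>y j. rel x i y j" for x i by (rule ex_right)
  show "\<exists>x i. rel x i y j" for y j by (rule ex_left)
  show "rel x i y j \<Longrightarrow> i < M * (j + 1)" "rel x i y j \<Longrightarrow> j < M * (i + 1)" for x i y j
    by (rule index, assumption)+
  show "finite {y. \<exists>j i. rel x i y j}" for x using fin_right[of x] by (rule rev_finite_subset) blast
  show "finite {x. \<exists>j i. rel x i y j}" for y using fin_left[of y] by (rule rev_finite_subset) blast
  show "\<exists>s. \<forall>y j x i y' j' x' i'. rel x i y j \<and> rel x' i' y' j' \<and> dist y y' \<le> r \<longrightarrow> dist x x' \<le> s" for r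
    using control_left[of r] by metis
  show "\<exists>s. \<forall>y j x i y' j' x' i'. rel x i y j \<and> rel x' i' y' j' \<and> dist x x' \<le> r \<longrightarrow> dist y y' \<le> s" for r
    using control_right[of r] by metis
qed

lemma W_local:
  assumes "\<And>x i j. rel x i y j \<Longrightarrow> coord F x = 0"
  shows "coord (W F) y = 0"
proof (rule onb_eqI)
  fix j
  obtain x i where "rel x i y j" using ex_left by blast
  then show "cinner (coord (W F) y) (e j) = cinner 0 (e j)" using assms by (simp add: match)
qed

lemma W'_local:
  assumes "\<And>y i j. rel x i y j \<Longrightarrow> coord G y = 0"
  shows "coord (W' G) x = 0"
proof (rule onb_eqI)
  fix i
  obtain y j where "rel x i y j" using ex_right by blast
  then show "cinner (coord (W' G) x) (e i) = cinner 0 (e i)" using assms by (simp add: match')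
qed

text \<open>The control conditions bound the propagation, the index bounds move the corner by a
  controlled amount, and finiteness of matched points writes each entry as a finite sum of compact
  operators.\<close>

lemma conj_controlled:
  assumes P: "P = trunc \<or> P = (\<lambda>_. id_blinfun)" and T: "T \<in> controlled P n"
  shows "\<exists>m. W o\<^sub>L T o\<^sub>L W' \<in> controlled P m"
proof -
  interpret P: filtration P using P filtration_axioms filtration_id by auto
  note D = unitary_pairD[OF WW]
  have Tc: "clinear T" by (rule controlled_clinear[OF T])
  obtain s where s: "\<And>x i y j x' i' y' j'. rel x i y j \<Longrightarrow> rel x' i' y' j' \<Longrightarrow> dist x x' \<le> real n \<Longrightarrow> dist y y' \<le> s"
    using control_right[of "real n"] by blast
  \<comment> \<open>Large enough for all partners of indices below \<open>n\<close> and for the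
    distances between partners of points within \<open>n\<close>.\<close>
  define m where "m = max (M * (n + 1)) (max n (nat \<lceil>s\<rceil>))"
  have sm: "s \<le> real m"
    unfolding m_def by (meson max.cobounded2 of_nat_mono order_trans real_nat_ceiling_ge)
  have Mm: "M * (i + 1) \<le> m" if "i < n" for i
    using that unfolding m_def by (meson Suc_leI add_le_mono1 less_imp_le_nat max.coboundedI1 mult_le_mono2)
  have left: "P m (coord (W F) y) = coord (W F) y" if F: "\<And>x. P n (coord F x) = coord F x" for F y
  proof (cases "P = trunc")
    case True
    show ?thesis
    proof (rule onb_eqI)
      fix j
      obtain x i where r: "rel x i y j" using ex_left by blast
      have "cinner (coord F x) (e i) = 0" if "i \<ge> n"
        using cinner_trunc[of n "coord F x" i] F[of x] that True by simp
      moreover have "j < m" if "i < n" using index(1)[OF r] Mm[OF that] by linarith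
      ultimately show "cinner (P m (coord (W F) y)) (e j) = cinner (coord (W F) y) (e j)"
        using match[OF r, of F] by (cases "i < n") (auto simp: True cinner_trunc)
    qed
  qed (use P in auto)
  \<comment> \<open>An index below \<open>n\<close> over \<open>x\<close> has its partner below
    \<open>m\<close>, so \<open>P m\<close> removes nothing that \<open>P n\<close> can see.\<close>
  have right: "P n (coord (W' (single y (P m v))) x) = P n (coord (W' (single y v)) x)" for y v x
  proof (cases "P = trunc")
    case True
    show ?thesis
    proof (rule onb_eqI)
      fix i
      obtain z j where r: "rel x i z j" using ex_right by blast
      have "j < m" if "i < n" using index(1)[OF r] Mm[OF that] by linarith
      then show "cinner (P n (coord (W' (single y (P m v))) x)) (e i) = cinner (P n (coord (W' (single y v)) x)) (e i)"
        by (auto simp: True cinner_trunc match'[OF r] coord_single)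
    qed
  qed (use P in auto)
  define S where "S y = {x. \<exists>i j. rel x i y j}" for y
  have S: "finite (S y)" for y unfolding S_def by (rule fin_left)
  define E where "E y x = Blinfun (\<lambda>v. coord (W (single x v)) y)" for x y
  define E' where "E' x y = Blinfun (\<lambda>v. coord (W' (single y v)) x)" for x y
  have E: "E y x v = coord (W (single x v)) y" and E': "E' x y v = coord (W' (single y v)) x" for x y v
    unfolding E_def E'_def
    by (subst bounded_linear_Blinfun_apply, rule bounded_linear_compose[OF bounded_linear_coord],
        rule bounded_linear_compose[OF blinfun.bounded_linear_right], rule bounded_linear_single, rule refl)+
  have E_clinear: "clinear (E y x)" "clinear (E' x y)" for x y
    by (auto simp: clinear_def E E' single_scaleC clinear_scaleC[OF D(1)] clinear_scaleC[OF D(2)])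
  \<comment> \<open>The coordinate at \<open>y\<close> sees only the finitely many points matched
    with \<open>y\<close>, so \<open>F\<close> may be restricted to them.\<close>
  have W_sum: "coord (W F) y = (\<Sum>x\<in>S y. E y x (coord F x))" for F y
  proof -
    have "coord (W (F - proj_on (S y) id_blinfun F)) y = 0"
      by (rule W_local) (auto simp: coord_proj_on_id S_def)
    then show ?thesis
      by (simp add: blinfun.diff_right proj_on_finite[OF ortho_proj_id S] blinfun.sum_right coord_sum E)
  qed
  have W'_sum: "W' (single y v) = (\<Sum>x\<in>S y. single x (E' x y v))" for y v
  proof (rule ell2_eqI)
    fix x
    show "coord (W' (single y v)) x = coord (\<Sum>x\<in>S y. single x (E' x y v)) x"
    proof (cases "x \<in> S y")
      case True
      then show ?thesis using S[of y] by (simp add: coord_sum coord_single E' sum.delta)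
    next
      case False
      then have "coord (W' (single y v)) x = 0" by (intro W'_local) (auto simp: S_def coord_single)
      then show ?thesis using False S[of y] by (simp add: coord_sum coord_single sum.delta)
    qed
  qed
  have TW': "coord (T (W' (single y v))) x = (\<Sum>x'\<in>S y. matrix_entry T x x' (E' x' y v))" for x y v
    by (simp add: W'_sum blinfun.sum_right coord_sum matrix_entry_apply)
  have "W o\<^sub>L T o\<^sub>L W' \<in> controlled P m"
  proof (rule controlledI)
    show "clinear (W o\<^sub>L T o\<^sub>L W')" by (intro clinear_compose D Tc)
    show "matrix_entry (W o\<^sub>L T o\<^sub>L W') y y' \<in> compact_operators" for y y'
    proof -
      have "matrix_entry (W o\<^sub>L T o\<^sub>L W') y y' = (\<Sum>x\<in>S y. \<Sum>x'\<in>S y'. E y x o\<^sub>L matrix_entry T x x' o\<^sub>L E' x' y')"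
        by (rule blinfun_eqI) (simp add: matrix_entry_apply[of "W o\<^sub>L T o\<^sub>L W'"] W_sum TW' blinfun.sum_right blinfun.sum_left)
      also have "\<dots> \<in> compact_operators"
        by (intro compact_operators_sum compact_operators_compose_right compact_operators_compose_left
            E_clinear controlled_compact[OF T])
      finally show ?thesis .
    qed
    show "coord ((W o\<^sub>L T o\<^sub>L W') (single y' v)) y = 0" if far: "dist y y' > real m" for y y' v
    proof -
      have "coord (T (W' (single y' v))) x = 0" if r: "rel x i y j" for x i j
        unfolding TW'
      proof (rule sum.neutral, rule ballI)
        fix x' assume "x' \<in> S y'"
        then obtain i' j' where r': "rel x' i' y' j'" by (auto simp: S_def)
        have "dist x x' > real n" using s[OF r r'] far sm by force
        then show "matrix_entry T x x' (E' x' y' v) = 0"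
          by (simp add: matrix_entry_apply controlled_propagation[OF T])
      qed
      then show ?thesis by (simp add: W_local)
    qed
    show "P m (coord ((W o\<^sub>L T o\<^sub>L W') (single y' v)) y) = coord ((W o\<^sub>L T o\<^sub>L W') (single y' v)) y" for y y' v
    proof -
      have "P n (coord (T (W' (single y' v))) x) = coord (T (W' (single y' v))) x" for x
        unfolding TW' by (simp add: blinfun.sum_right matrix_entry_apply controlled_compose(1)[OF T])
      then show ?thesis by (simp add: left)
    qed
    show "coord ((W o\<^sub>L T o\<^sub>L W') (single y' (P m v))) y = coord ((W o\<^sub>L T o\<^sub>L W') (single y' v)) y" for y y' v
    proof -
      have "matrix_entry T x x' (E' x' y' (P m v)) = matrix_entry T x x' (E' x' y' v)" for x x'
        using controlled_compose(2)[OF T, of x' "E' x' y' (P m v)" x]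
          controlled_compose(2)[OF T, of x' "E' x' y' v" x]
        by (simp add: matrix_entry_apply E' right)
      then have "T (W' (single y' (P m v))) = T (W' (single y' v))"
        by (intro ell2_eqI) (simp add: TW')
      then show ?thesis by simp
    qed
  qed
  then show ?thesis by blast
qed

lemma conj_filtered_roe:
  assumes P: "P = trunc \<or> P = (\<lambda>_. id_blinfun)" and T: "T \<in> filtered_roe P"
  shows "W o\<^sub>L T o\<^sub>L W' \<in> filtered_roe P"
proof -
  have "(\<lambda>T. W o\<^sub>L T o\<^sub>L W') ` closure (\<Union>n. controlled P n) \<subseteq> closure (\<Union>n. controlled P n)"
  proof (rule image_closure_subset)
    show "continuous_on (closure (\<Union>n. controlled P n)) (\<lambda>T. W o\<^sub>L T o\<^sub>L W')"
      by (intro continuous_intros)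
    show "(\<lambda>T. W o\<^sub>L T o\<^sub>L W') ` (\<Union>n. controlled P n) \<subseteq> closure (\<Union>n. controlled P n)"
      using conj_controlled[OF P] by (intro order_trans[OF _ closure_subset]) auto
  qed auto
  then show ?thesis using T unfolding filtered_roe_def by auto
qed

lemma filtered_roe_isomorphic:
  assumes P: "P = trunc \<or> P = (\<lambda>_. id_blinfun)"
  shows "star_isomorphic (filtered_roe P :: (('x, 'h) ell2 \<Rightarrow>\<^sub>L ('x, 'h) ell2) set)
    (filtered_roe P :: (('y, 'h) ell2 \<Rightarrow>\<^sub>L ('y, 'h) ell2) set)"
proof -
  interpret sym: matching e W' W "\<lambda>y j x i. rel x i y j" M by (rule matching_sym)
  show ?thesis
    by (rule unitary_pair_imp_star_isomorphic[OF WW filtered_roe_clinear])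
       (auto intro: conj_filtered_roe[OF P] sym.conj_filtered_roe[OF P])
qed

end

section \<open>The matching attached to a coarse equivalence\<close>

context onb begin

text \<open>Both spaces get an orthonormal basis indexed by the same set, the second one through
  \<beta>; the unitary takes coefficients in the first and reassembles them in the second.\<close>

lemma unitary_of_bijection:
  fixes \<beta> :: "'x \<times> nat \<Rightarrow> 'y \<times> nat"
  assumes bij: "bij \<beta>"
  obtains W :: "('x, 'h) ell2 \<Rightarrow>\<^sub>L ('y, 'h) ell2" and W' where "unitary_pair W W'"
    "\<And>x i y j F. \<beta> (x, i) = (y, j) \<Longrightarrow> cinner (coord (W F) y) (e j) = cinner (coord F x) (e i)"
proof -
  define a :: "'x \<times> nat \<Rightarrow> ('x, 'h) ell2" where "a p = single (fst p) (e (snd p))" for p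
  define b :: "'x \<times> nat \<Rightarrow> ('y, 'h) ell2" where "b p = single (fst (\<beta> p)) (e (snd (\<beta> p)))" for p
  obtain J :: "('x, 'h) ell2 \<Rightarrow>\<^sub>L ('x \<times> nat, complex) ell2" and K where
    J: "unitary_pair J K" "\<And>v p. coord (J v) p = cinner v (a p)"
  proof (rule orthonormal_basis_unitary[of a])
    show "cinner (a p) (a q) = (if p = q then 1 else 0)" for p q
      by (auto simp: a_def cinner_single_left coord_single on prod_eq_iff)
    show "v = 0" if "\<And>p. cinner v (a p) = 0" for v
    proof (intro ell2_eqI onb_eqI)
      show "cinner (coord v x) (e i) = cinner (coord 0 x) (e i)" for x i
        using that[of "(x, i)"] by (simp add: a_def cinner_single_right)
    qed
  qed blast
  obtain J' :: "('y, 'h) ell2 \<Rightarrow>\<^sub>L ('x \<times> nat, complex) ell2" and K' where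
    J': "unitary_pair J' K'" "\<And>v p. coord (J' v) p = cinner v (b p)"
  proof (rule orthonormal_basis_unitary[of b])
    fix p q
    have "\<beta> p = \<beta> q \<longleftrightarrow> p = q" using bij by (metis bij_def injD)
    then have "fst (\<beta> p) = fst (\<beta> q) \<and> snd (\<beta> p) = snd (\<beta> q) \<longleftrightarrow> p = q"
      by (simp add: prod_eq_iff)
    then show "cinner (b p) (b q) = (if p = q then 1 else 0)"
      unfolding b_def cinner_single_left coord_single by (auto simp: on)
  next
    show "v = 0" if v: "\<And>p. cinner v (b p) = 0" for v :: "('y, 'h) ell2"
    proof (intro ell2_eqI onb_eqI)
      fix y i
      obtain p where "\<beta> p = (y, i)" using bij by (metis bij_pointE)
      then show "cinner (coord v y) (e i) = cinner (coord 0 y) (e i)"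
        using v[of p] by (simp add: b_def cinner_single_right)
    qed
  qed blast
  note D = unitary_pairD[OF J(1)] and D' = unitary_pairD[OF J'(1)]
  have "unitary_pair (K' o\<^sub>L J) (K o\<^sub>L J')"
    unfolding unitary_pair_def by (auto intro!: clinear_compose simp: D D')
  moreover have "cinner (coord ((K' o\<^sub>L J) F) y) (e j) = cinner (coord F x) (e i)"
    if "\<beta> (x, i) = (y, j)" for x i y j F
  proof -
    have "coord (J' ((K' o\<^sub>L J) F)) (x, i) = coord (J F) (x, i)" by (simp add: D')
    then show ?thesis by (simp add: J J' a_def b_def that cinner_single_right)
  qed
  ultimately show ?thesis by (rule that)
qed

text \<open>A coarse equivalence need be neither injective nor surjective. Both spaces are therefore
  mapped onto \<open>range f\<close> with uniformly bounded fibres, and after multiplying with the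
  natural numbers both become copies of \<open>range f \<times> UNIV\<close>.\<close>

lemma coarsely_equivalent_matching:
  assumes bgX: "bounded_geometry TYPE('x::metric_space)" and bgY: "bounded_geometry TYPE('y::metric_space)"
    and ce: "coarsely_equivalent TYPE('x) TYPE('y)"
  obtains W :: "('x::metric_space, 'h) ell2 \<Rightarrow>\<^sub>L ('y::metric_space, 'h) ell2" and W' rel M where "matching e W W' rel M"
proof -
  obtain f :: "'x \<Rightarrow> 'y" and C0 where
    up: "\<And>r. \<exists>s. \<forall>x x'. dist x x' \<le> r \<longrightarrow> dist (f x) (f x') \<le> s" and
    low: "\<And>s. \<exists>r. \<forall>x x'. dist (f x) (f x') \<le> s \<longrightarrow> dist x x' \<le> r" and
    dense: "\<And>y. \<exists>x. dist y (f x) \<le> C0"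
    by (rule coarsely_equivalentE[OF ce]) blast
  define C where "C = \<bar>C0\<bar>"
  obtain c where c: "\<And>y. dist y (f (c y)) \<le> C" using dense unfolding C_def by (metis abs_ge_self order_trans)
  \<comment> \<open>Being the identity on \<open>range f\<close> makes the range of \<open>g\<close>
    all of it, so the two bijections have the same target.\<close>
  define g where "g y = (if y \<in> range f then y else f (c y))" for y
  have g: "dist (g y) y \<le> C" for y using c[of y] by (simp add: g_def C_def dist_commute)
  have range_g: "range g = range f"
    by (auto simp: g_def image_iff)
  \<comment> \<open>Points with equal image are at distance at most \<open>r0\<close>, so bounded
    geometry bounds the fibres of \<open>f\<close>.\<close>
  obtain r0 where r0: "\<And>x x'. dist (f x) (f x') \<le> 0 \<Longrightarrow> dist x x' \<le> r0" using low[of 0] by blast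
  obtain N1 where N1: "\<And>x :: 'x. card (cball x r0) \<le> N1" using bounded_geometry_card_cball[OF bgX] by blast
  obtain N2 where N2: "\<And>y :: 'y. card (cball y C) \<le> N2" using bounded_geometry_card_cball[OF bgY] by blast
  have sub1: "f -` {f x} \<subseteq> cball x r0" for x using r0 by auto
  have sub2: "g -` {g y} \<subseteq> cball (g y) C" for y
  proof
    fix x assume "x \<in> g -` {g y}"
    then show "x \<in> cball (g y) C" using g[of x] by simp
  qed
  have fib1: "finite (f -` {f x})" "card (f -` {f x}) \<le> N1" for x
    using finite_subset[OF sub1 bounded_geometry_finite_cball[OF bgX]]
      order_trans[OF card_mono[OF bounded_geometry_finite_cball[OF bgX] sub1] N1] by auto
  have fib2: "finite (g -` {g y})" "card (g -` {g y}) \<le> N2" for y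
    using finite_subset[OF sub2 bounded_geometry_finite_cball[OF bgY]]
      order_trans[OF card_mono[OF bounded_geometry_finite_cball[OF bgY] sub2] N2] by auto
  obtain \<beta>1 :: "'x \<times> nat \<Rightarrow> 'y \<times> nat" where b1: "inj \<beta>1" "range \<beta>1 = range f \<times> UNIV"
    "\<And>a i z j. \<beta>1 (a, i) = (z, j) \<Longrightarrow> z = f a \<and> i \<le> j \<and> j < N1 * (i + 1)"
    by (rule fibre_bijection[OF fib1]) blast
  obtain \<beta>2 :: "'y \<times> nat \<Rightarrow> 'y \<times> nat" where b2: "inj \<beta>2" "range \<beta>2 = range g \<times> UNIV"
    "\<And>a i z j. \<beta>2 (a, i) = (z, j) \<Longrightarrow> z = g a \<and> i \<le> j \<and> j < N2 * (i + 1)"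
    by (rule fibre_bijection[OF fib2]) blast
  define \<beta> where "\<beta> = inv \<beta>2 \<circ> \<beta>1"
  have ranges: "range \<beta>1 = range \<beta>2" by (simp add: b1 b2 range_g)
  have \<beta>: "\<beta>2 (\<beta> p) = \<beta>1 p" for p
    unfolding \<beta>_def using ranges by (metis comp_apply f_inv_into_f rangeI)
  have bij: "bij \<beta>"
  proof (rule bijI)
    show "inj \<beta>" by (rule injI) (metis \<beta> b1(1) injD)
    show "surj \<beta>"
      unfolding surj_def
    proof
      fix q
      obtain p where "\<beta>1 p = \<beta>2 q" using ranges by (metis imageE rangeI)
      then have "\<beta> p = q" using \<beta>[of p] b2(1) by (metis injD)
      then show "\<exists>p. q = \<beta> p" by blast
    qed
  qed
  define M where "M = max N1 N2"
  have near: "dist (f x) y \<le> C" and idx: "j < M * (i + 1)" "i < M * (j + 1)" if r: "\<beta> (x, i) = (y, j)" for x i y j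
  proof -
    \<comment> \<open>The common target index \<open>l\<close> is at least both \<open>i\<close> and
      \<open>j\<close>, and below \<open>N1 * (i + 1)\<close> and \<open>N2 * (j + 1)\<close>;
      comparing crosswise gives both index bounds.\<close>
    obtain z l where zl: "\<beta>1 (x, i) = (z, l)" by (metis surj_pair)
    then have "\<beta>2 (y, j) = (z, l)" using \<beta>[of "(x, i)"] r by simp
    note z1 = b1(3)[OF zl] and z2 = b2(3)[OF this]
    show "dist (f x) y \<le> C" using g[of y] z1 z2 by simp
    have "N1 * (i + 1) \<le> M * (i + 1)" "N2 * (j + 1) \<le> M * (j + 1)"
      by (simp_all only: M_def mult_le_mono1 max.cobounded1 max.cobounded2)
    then show "j < M * (i + 1)" "i < M * (j + 1)" using z1 z2 by linarith+
  qed
  obtain W :: "('x, 'h) ell2 \<Rightarrow>\<^sub>L ('y, 'h) ell2" and W' where W: "unitary_pair W W'"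
    "\<And>x i y j F. \<beta> (x, i) = (y, j) \<Longrightarrow> cinner (coord (W F) y) (e j) = cinner (coord F x) (e i)"
    by (rule unitary_of_bijection[OF bij]) blast
  have "matching e W W' (\<lambda>x i y j. \<beta> (x, i) = (y, j)) M"
  proof
    show "\<exists>x i. \<beta> (x, i) = (y, j)" for y j using bij by (metis bij_pointE surj_pair)
    show "\<exists>y j. \<beta> (x, i) = (y, j)" for x i by (metis surj_pair)
    show "finite {x. \<exists>i j. \<beta> (x, i) = (y, j)}" for y
    proof (cases "{x. \<exists>i j. \<beta> (x, i) = (y, j)} = {}")
      case False
      then obtain x0 where x0: "dist (f x0) y \<le> C" using near by blast
      obtain r where r: "\<And>x x'. dist (f x) (f x') \<le> 2 * C \<Longrightarrow> dist x x' \<le> r" using low[of "2 * C"] by blast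
      have "{x. \<exists>i j. \<beta> (x, i) = (y, j)} \<subseteq> cball x0 r"
      proof
        fix x assume "x \<in> {x. \<exists>i j. \<beta> (x, i) = (y, j)}"
        then have "dist (f x) y \<le> C" using near by blast
        then have "dist (f x0) (f x) \<le> 2 * C" using x0 dist_triangle2[of "f x0" "f x" y] by linarith
        then show "x \<in> cball x0 r" using r by simp
      qed
      then show ?thesis using bounded_geometry_finite_cball[OF bgX] by (rule finite_subset)
    qed simp
    show "finite {y. \<exists>i j. \<beta> (x, i) = (y, j)}" for x
      by (rule finite_subset[OF _ bounded_geometry_finite_cball[OF bgY, of "f x" C]]) (use near in auto)
    show "\<exists>s. \<forall>x i y j x' i' y' j'. \<beta> (x, i) = (y, j) \<and> \<beta> (x', i') = (y', j') \<and> dist x x' \<le> r \<longrightarrow> dist y y' \<le> s" for r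
    proof -
      obtain s where s: "\<And>x x'. dist x x' \<le> r \<Longrightarrow> dist (f x) (f x') \<le> s" using up[of r] by blast
      show ?thesis
      proof (intro exI[of _ "2 * C + s"] allI impI, elim conjE)
        fix x i y j x' i' y' j' assume r: "\<beta> (x, i) = (y, j)" "\<beta> (x', i') = (y', j')" "dist x x' \<le> r"
        have "dist y y' \<le> dist y (f x) + dist (f x) (f x') + dist (f x') y'"
          using dist_triangle[of y y' "f x"] dist_triangle[of "f x" y' "f x'"] by linarith
        then show "dist y y' \<le> 2 * C + s"
          using near[OF r(1)] near[OF r(2)] s[OF r(3)] by (simp add: dist_commute)
      qed
    qed
    show "\<exists>s. \<forall>x i y j x' i' y' j'. \<beta> (x, i) = (y, j) \<and> \<beta> (x', i') = (y', j') \<and> dist y y' \<le> r \<longrightarrow> dist x x' \<le> s" for r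
    proof -
      obtain s where s: "\<And>x x'. dist (f x) (f x') \<le> 2 * C + r \<Longrightarrow> dist x x' \<le> s" using low[of "2 * C + r"] by blast
      show ?thesis
      proof (intro exI[of _ s] allI impI, elim conjE)
        fix x i y j x' i' y' j' assume r: "\<beta> (x, i) = (y, j)" "\<beta> (x', i') = (y', j')" "dist y y' \<le> r"
        have "dist (f x) (f x') \<le> dist (f x) y + dist y y' + dist y' (f x')"
          using dist_triangle[of "f x" "f x'" y] dist_triangle[of y "f x'" y'] by linarith
        then show "dist x x' \<le> s"
          using near[OF r(1)] near[OF r(2)] r(3) by (intro s) (simp add: dist_commute)
      qed
    qed
  qed (use W idx in auto)
  then show ?thesis by (rule that)
qed

theorem filtered_roe_isomorphic_iff:
  assumes bgX: "bounded_geometry TYPE('x::metric_space)" and bgY: "bounded_geometry TYPE('y::metric_space)"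
    and P: "P = trunc \<or> P = (\<lambda>_. id_blinfun)"
  shows "star_isomorphic (filtered_roe P :: (('x, 'h) ell2 \<Rightarrow>\<^sub>L ('x, 'h) ell2) set)
    (filtered_roe P :: (('y, 'h) ell2 \<Rightarrow>\<^sub>L ('y, 'h) ell2) set) \<longleftrightarrow> coarsely_equivalent TYPE('x) TYPE('y)"
proof
  assume "coarsely_equivalent TYPE('x) TYPE('y)"
  then obtain W :: "('x, 'h) ell2 \<Rightarrow>\<^sub>L ('y, 'h) ell2" and W' rel M where "matching e W W' rel M"
    by (rule coarsely_equivalent_matching[OF bgX bgY])
  then show "star_isomorphic (filtered_roe P :: (('x, 'h) ell2 \<Rightarrow>\<^sub>L ('x, 'h) ell2) set)
    (filtered_roe P :: (('y, 'h) ell2 \<Rightarrow>\<^sub>L ('y, 'h) ell2) set)"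
    using P by (rule matching.filtered_roe_isomorphic)
next
  assume iso: "star_isomorphic (filtered_roe P :: (('x, 'h) ell2 \<Rightarrow>\<^sub>L ('x, 'h) ell2) set)
    (filtered_roe P :: (('y, 'h) ell2 \<Rightarrow>\<^sub>L ('y, 'h) ell2) set)"
  interpret P: filtration P using P filtration_axioms filtration_id by auto
  \<comment> \<open>The auxiliary unit vector may sit over any point, hence
    \<open>undefined\<close>.\<close>
  have "\<exists>U V. unitary_pair U V \<and>
      (\<forall>T\<in>(filtered_roe P :: (('x, 'h) ell2 \<Rightarrow>\<^sub>L ('x, 'h) ell2) set). U o\<^sub>L T o\<^sub>L V \<in> filtered_roe P) \<and>
      (\<forall>T\<in>(filtered_roe P :: (('y, 'h) ell2 \<Rightarrow>\<^sub>L ('y, 'h) ell2) set). V o\<^sub>L T o\<^sub>L U \<in> filtered_roe P)"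
    by (rule star_isomorphic_imp_unitary_pair[OF iso filtered_roe_clinear _ filtered_roe_clinear,
          of "single undefined (e 0)"])
       (auto simp: P.butterfly_in_filtered_roe norm_single norm_basis)
  then obtain U :: "('x, 'h) ell2 \<Rightarrow>\<^sub>L ('y, 'h) ell2" and V where UV: "unitary_pair U V"
    "\<And>T. T \<in> filtered_roe P \<Longrightarrow> U o\<^sub>L T o\<^sub>L V \<in> filtered_roe P"
    "\<And>T. T \<in> filtered_roe P \<Longrightarrow> V o\<^sub>L T o\<^sub>L U \<in> filtered_roe P"
    by blast
  \<comment> \<open>The first corner that contains \<open>e 0\<close> has number 1, as
    \<open>trunc 0\<close> is 0.\<close>
  have "trunc 1 (e 0) = e 0" by (simp add: trunc_apply on)
  then have "P 1 (e 0) = e 0" using P by auto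
  then have "rigid_pair P U V (e 0) 1"
    by unfold_locales (use UV bgX bgY norm_basis in auto)
  then show "coarsely_equivalent TYPE('x) TYPE('y)"
    by (rule rigid_pair.coarse_equivalence)
qed

end

theorem theorem1:
  assumes "bounded_geometry TYPE('x::metric_space)"
    and "bounded_geometry TYPE('y::metric_space)"
    and "\<not> contains_ghostly_measured_asymptotic_expanders TYPE('x) \<or>
         \<not> contains_ghostly_measured_asymptotic_expanders TYPE('y)"
    and "separable_infinite_dimensional TYPE('h::complex_hilbert_space)"
    and "separable_infinite_dimensional TYPE('k::complex_hilbert_space)"
  shows "(coarsely_equivalent TYPE('x) TYPE('y) \<longleftrightarrow>
            stably_star_isomorphic TYPE('k)
              (uniform_roe_algebra :: (('x, complex) ell2 \<Rightarrow>\<^sub>L ('x, complex) ell2) set)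
              (uniform_roe_algebra :: (('y, complex) ell2 \<Rightarrow>\<^sub>L ('y, complex) ell2) set)) \<and>
         (coarsely_equivalent TYPE('x) TYPE('y) \<longleftrightarrow>
            star_isomorphic
              (roe_algebra :: (('x, 'h) ell2 \<Rightarrow>\<^sub>L ('x, 'h) ell2) set)
              (roe_algebra :: (('y, 'h) ell2 \<Rightarrow>\<^sub>L ('y, 'h) ell2) set))"
proof -
  \<comment> \<open>The stabilisation and the Roe algebra have different fibres, so each gets its
    own basis.\<close>
  obtain e :: "nat \<Rightarrow> 'k" where e: "onb e"
    using separable_orthonormal_basis[OF assms(5)] unfolding onb_def by metis
  obtain e' :: "nat \<Rightarrow> 'h" where e': "onb e'"
    using separable_orthonormal_basis[OF assms(4)] unfolding onb_def by metis
  show ?thesis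
    unfolding stably_star_isomorphic_def onb.stabilisation_uniform_roe_eq[OF e] roe_algebra_eq_filtered_roe
    using onb.filtered_roe_isomorphic_iff[OF e assms(1,2)] onb.filtered_roe_isomorphic_iff[OF e' assms(1,2)]
    by simp
qed

end
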